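(* Let $p$ be a prime. $\Delta_S$ is the generator (one-step transition operator) of the Markov chain $\big(\widetilde{\ker}(\mathrm{SymHaar}_{n,n})\big)_{n\ge 1}$; that is, conditionally on $\widetilde{\ker}(\mathrm{SymHaar}_{1,1}),\dots,\widetilde{\ker}(\mathrm{SymHaar}_{n,n})$ with $\widetilde{\ker}(\mathrm{SymHaar}_{n,n})=x\in X_S$, the distribution of $\widetilde{\ker}(\mathrm{SymHaar}_{n+1,n+1})$ is that of $\Delta_S(x)$.
   Context: Fix a prime $p$. $\mathrm{SymHaar}=(a_{ij})_{i,j\ge 1}$ is the random infinite symmetric matrix with entries in $\mathbb{Z}_p$ such that the entries $a_{ij}$, $i\le j$, are independent and distributed according to the Haar probability measure on $\mathbb{Z}_p$, and $a_{ji}=a_{ij}$; $\mathrm{SymHaar}_{n,n}$ is its top-left $n\times n$ corner (almost surely non-singular for every $n$). For a symmetric $k\times k$ matrix $M$ over $\mathbb{Z}_p$, $\ker(M)$ denotes the kernel of $M:(\mathbb{Q}_p/\mathbb{Z}_p)^k\to(\mathbb{Q}_p/\mathbb{Z}_p)^k$, with the symmetric pairing $(v,w)\mapsto v^TMw \bmod \mathbb{Z}_p$ (computed with lifts to $\mathbb{Q}_p^k$), which is perfect when $M$ is non-singular. $\widetilde{\ker}(M)$ denotes $\ker(M)$ together with this pairing, up to isomorphism preserving the pairing. $X_S$ denotes the set of isomorphism classes of finite abelian $p$-groups with a perfect symmetric pairing to $\mathbb{Q}_p/\mathbb{Z}_p$. Definition of $\Delta_S$. For $(G,\langle\,,\rangle)\in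 X_S$, $\Delta_S(G,\langle\,,\rangle)$ is the random output of the following procedure. (1) Pick $g\in G$ uniformly at random. (2) Pick a symmetric pairing on $G\times\mathbb{Q}_p$ with values in $\mathbb{Q}_p/\mathbb{Z}_p$ uniformly at random among those such that (A) its restriction to $G$ is the original pairing, and (B) $(g,1)\in(g,1)^{\perp}$. Concretely, such a pairing has no cross terms between $G$ and $\mathbb{Q}_p$, and on $\mathbb{Q}_p$ it has the form $\langle q_1,q_2\rangle=q\,q_1q_2 \bmod \mathbb{Z}_p$ for some $q\in\mathbb{Q}_p$; condition (B) says $q\equiv-\langle g,g\rangle \bmod \mathbb{Z}_p$, and $q$ is chosen according to the normalized Haar measure on this coset of $\mathbb{Z}_p$ in $\mathbb{Q}_p$. Then $\Delta_S(G,\langle\,,\rangle)$ is the isomorphism class of $(g,1)^{\perp}/(g,1)$ with its induced pairing, where $(g,1)$ in the quotient stands for the $\mathbb{Z}_p$-span of $(g,1)$ in $G\times\mathbb{Q}_p$. This is almost surely an element of $X_S$. *)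

theory Defs
  imports
    "HOL-Probability.Probability"
    "HOL-Algebra.Coset"
    "HOL-Computational_Algebra.Fraction_Field"
    "Jordan_Normal_Form.Matrix"
    "Berlekamp_Zassenhaus.Finite_Field"
begin

section \<open>The p-adic integers, the p-adic numbers and their quotient\<close>

text \<open>The prime \<open>p\<close> is the cardinality of the type parameter \<open>'p\<close>, as for the type
  \<open>'p mod_ring\<close> of the integers modulo \<open>p\<close>.  The ring \<open>\<int>\<^sub>p\<close> is the inverse limit of the
  rings \<open>\<int>/p\<^sup>n\<close>: \<open>Rep_zp x n\<close> is the residue of \<open>x\<close> modulo \<open>p\<^sup>n\<close>, represented in
  \<open>{0..<p\<^sup>n}\<close> (this range is forced by the compatibility condition).\<close>

typedef 'p zp = "{x :: nat \<Rightarrow> int. \<forall>n. x (Suc n) mod int CARD('p::prime_card) ^ n = x n}"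
  by (rule exI[of _ "\<lambda>_. 0"]) simp

setup_lifting type_definition_zp

lemma Rep_zp_Suc_mod: "Rep_zp (x :: 'p::prime_card zp) (Suc n) mod int CARD('p) ^ n = Rep_zp x n"
  using Rep_zp[of x] by simp

lemma Rep_zp_mod_self [simp]: "Rep_zp (x :: 'p::prime_card zp) n mod int CARD('p) ^ n = Rep_zp x n"
  by (metis Rep_zp_Suc_mod mod_mod_trivial)

lemma Rep_zp_add_mod: "Rep_zp (x :: 'p::prime_card zp) (n + k) mod int CARD('p) ^ n = Rep_zp x n"
proof (induction k)
  case (Suc k)
  have "Rep_zp x (n + Suc k) mod int CARD('p) ^ n
      = Rep_zp x (Suc (n + k)) mod int CARD('p) ^ (n + k) mod int CARD('p) ^ n"
    by (simp add: mod_mod_cancel le_imp_power_dvd)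
  with Suc show ?case by (simp add: Rep_zp_Suc_mod)
qed simp

lemma mod_power_Suc_mod: "(a :: int) mod q ^ Suc n mod q ^ n = a mod q ^ n"
  by (simp add: mod_mod_cancel)

instantiation zp :: (prime_card) comm_ring_1
begin

lift_definition zero_zp :: "'a zp" is "\<lambda>_. 0" by simp

lift_definition one_zp :: "'a zp" is "\<lambda>n. 1 mod int CARD('a) ^ n"
  by (simp only: mod_power_Suc_mod simp_thms)

lift_definition plus_zp :: "'a zp \<Rightarrow> 'a zp \<Rightarrow> 'a zp"
  is "\<lambda>x y n. (x n + y n) mod int CARD('a) ^ n"
proof -
  fix x y :: "nat \<Rightarrow> int" and n
  assume *: "\<And>n. x (Suc n) mod int CARD('a) ^ n = x n" "\<And>n. y (Suc n) mod int CARD('a) ^ n = y n"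
  show "(x (Suc n) + y (Suc n)) mod int CARD('a) ^ Suc n mod int CARD('a) ^ n
      = (x n + y n) mod int CARD('a) ^ n"
    unfolding mod_power_Suc_mod
    using mod_add_eq[of "x (Suc n)" "int CARD('a) ^ n" "y (Suc n)"] by (simp only: *)
qed

lift_definition times_zp :: "'a zp \<Rightarrow> 'a zp \<Rightarrow> 'a zp"
  is "\<lambda>x y n. (x n * y n) mod int CARD('a) ^ n"
proof -
  fix x y :: "nat \<Rightarrow> int" and n
  assume *: "\<And>n. x (Suc n) mod int CARD('a) ^ n = x n" "\<And>n. y (Suc n) mod int CARD('a) ^ n = y n"
  show "(x (Suc n) * y (Suc n)) mod int CARD('a) ^ Suc n mod int CARD('a) ^ n
      = (x n * y n) mod int CARD('a) ^ n"
    unfolding mod_power_Suc_mod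
    using mod_mult_eq[of "x (Suc n)" "int CARD('a) ^ n" "y (Suc n)"] by (simp only: *)
qed

lift_definition uminus_zp :: "'a zp \<Rightarrow> 'a zp"
  is "\<lambda>x n. (- x n) mod int CARD('a) ^ n"
proof -
  fix x :: "nat \<Rightarrow> int" and n
  assume *: "\<And>n. x (Suc n) mod int CARD('a) ^ n = x n"
  show "(- x (Suc n)) mod int CARD('a) ^ Suc n mod int CARD('a) ^ n
      = (- x n) mod int CARD('a) ^ n"
    unfolding mod_power_Suc_mod
    using mod_minus_eq[of "x (Suc n)" "int CARD('a) ^ n"] by (simp only: *)
qed

definition minus_zp :: "'a zp \<Rightarrow> 'a zp \<Rightarrow> 'a zp" where "minus_zp x y = x + (- y)"

instance
proof
  fix a b c :: "'a zp"
  have red: "x n mod int CARD('a) ^ n = x n"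
    if "\<forall>n. x (Suc n) mod int CARD('a) ^ n = x n" for x :: "nat \<Rightarrow> int" and n
    using that by (metis mod_mod_trivial)
  show "a + b + c = a + (b + c)"
    by transfer (simp add: fun_eq_iff mod_simps add.assoc)
  show "a + b = b + a" by transfer (simp add: add.commute)
  show "0 + a = a" by transfer (simp add: red)
  show "- a + a = 0" by transfer (simp add: mod_simps)
  show "a - b = a + - b" by (rule minus_zp_def)
  show "a * b * c = a * (b * c)"
    by transfer (simp add: fun_eq_iff mod_simps mult.assoc)
  show "a * b = b * a" by transfer (simp add: mult.commute)
  show "1 * a = a" by transfer (simp add: fun_eq_iff mod_simps red)
  show "(a + b) * c = a * c + b * c"
    by transfer (simp add: fun_eq_iff mod_simps distrib_right)
  have "(0 :: int) \<noteq> 1 mod int CARD('a) ^ 1"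
    using prime_gt_1_nat[OF prime_card[where 'a = 'a]] by simp
  then show "(0 :: 'a zp) \<noteq> 1" by transfer metis
qed

end

instance zp :: (prime_card) idom
proof
  fix a b :: "'a zp"
  let ?p = "int CARD('a)"
  note p = prime_card_int[where 'a = 'a]
  assume "a \<noteq> 0" "b \<noteq> 0"
  then obtain m k where "Rep_zp a m \<noteq> 0" "Rep_zp b k \<noteq> 0"
    by (metis Rep_zp_inject ext zero_zp.rep_eq)
  then have a: "\<not> ?p ^ m dvd Rep_zp a (m + k)" and b: "\<not> ?p ^ k dvd Rep_zp b (k + m)"
    by (auto simp: dvd_eq_mod_eq_0 Rep_zp_add_mod)
  have "\<not> ?p ^ (m + k) dvd Rep_zp a (m + k) * Rep_zp b (m + k)"
  proof
    assume d: "?p ^ (m + k) dvd Rep_zp a (m + k) * Rep_zp b (m + k)"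
    have nz: "Rep_zp a (m + k) \<noteq> 0" "Rep_zp b (m + k) \<noteq> 0"
      using a b by (auto simp: add.commute)
    have "m + k \<le> multiplicity ?p (Rep_zp a (m + k) * Rep_zp b (m + k))"
      using d nz p by (subst (asm) power_dvd_iff_le_multiplicity) auto
    also have "\<dots> = multiplicity ?p (Rep_zp a (m + k)) + multiplicity ?p (Rep_zp b (m + k))"
      using nz p by (simp add: prime_elem_multiplicity_mult_distrib)
    finally have "m \<le> multiplicity ?p (Rep_zp a (m + k)) \<or> k \<le> multiplicity ?p (Rep_zp b (m + k))"
      by linarith
    with a b show False by (auto simp: add.commute dest: multiplicity_dvd')
  qed
  then have "Rep_zp (a * b) (m + k) \<noteq> 0"
    by (simp add: times_zp.rep_eq dvd_eq_mod_eq_0)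
  then show "a * b \<noteq> 0" by (auto simp: zero_zp.rep_eq)
qed

text \<open>The \<open>p\<close>-adic topology: the cosets of \<open>p\<^sup>n\<int>\<^sub>p\<close> form a basis.\<close>

instantiation zp :: (prime_card) topological_space
begin

definition open_zp :: "'a zp set \<Rightarrow> bool" where
  "open_zp U \<longleftrightarrow> (\<forall>x\<in>U. \<exists>n. \<forall>y. Rep_zp y n = Rep_zp x n \<longrightarrow> y \<in> U)"

instance
proof
  show "open (UNIV :: 'a zp set)" by (simp add: open_zp_def)
next
  fix S T :: "'a zp set"
  assume S: "open S" and T: "open T"
  show "open (S \<inter> T)"
    unfolding open_zp_def
  proof
    fix x assume "x \<in> S \<inter> T"
    with S T obtain m k where m: "\<And>y. Rep_zp y m = Rep_zp x m \<Longrightarrow> y \<in> S"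
      and k: "\<And>y. Rep_zp y k = Rep_zp x k \<Longrightarrow> y \<in> T"
      unfolding open_zp_def by blast
    have "y \<in> S \<inter> T" if "Rep_zp y (m + k) = Rep_zp x (m + k)" for y
      using that m[of y] k[of y] Rep_zp_add_mod[of x m k] Rep_zp_add_mod[of y m k]
        Rep_zp_add_mod[of x k m] Rep_zp_add_mod[of y k m]
      by (simp add: add.commute)
    then show "\<exists>n. \<forall>y. Rep_zp y n = Rep_zp x n \<longrightarrow> y \<in> S \<inter> T" by blast
  qed
next
  fix K :: "'a zp set set"
  assume "\<forall>S\<in>K. open S"
  then show "open (\<Union>K)" unfolding open_zp_def by (meson Union_iff)
qed

end

definition haar :: "'p::prime_card zp measure" where
  "haar = (THE \<mu>. sets \<mu> = sets borel \<and> prob_space \<mu> \<and> (\<forall>c. distr \<mu> borel (\<lambda>x. c + x) = \<mu>))"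

type_synonym 'p qp = "'p zp fract"

definition of_zp :: "'p::prime_card zp \<Rightarrow> 'p qp" where
  "of_zp x = Fract x 1"

lemma of_zp_simps:
  "of_zp 0 = 0" "of_zp 1 = 1" "of_zp (x + y) = of_zp x + of_zp y" "of_zp (- x) = - of_zp x"
  "of_zp (x - y) = of_zp x - of_zp y" "of_zp (x * y) = of_zp x * of_zp y"
  by (simp_all add: of_zp_def Zero_fract_def One_fract_def)

quotient_type (overloaded) 'p qpzp = "'p::prime_card qp" / "\<lambda>x y. x - y \<in> range of_zp"
  morphisms qp_lift qpzp_of
proof (rule equivpI)
  show "reflp (\<lambda>x y :: 'p qp. x - y \<in> range of_zp)"
    by (rule reflpI) (metis diff_self of_zp_simps(1) rangeI)
  show "symp (\<lambda>x y :: 'p qp. x - y \<in> range of_zp)"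
    by (rule sympI) (metis (no_types, lifting) minus_diff_eq of_zp_simps(4) rangeE rangeI)
  show "transp (\<lambda>x y :: 'p qp. x - y \<in> range of_zp)"
  proof (rule transpI)
    fix x y z :: "'p qp"
    assume "x - y \<in> range of_zp" "y - z \<in> range of_zp"
    then obtain u v where "x - y = of_zp u" "y - z = of_zp v" by auto
    then have "x - z = of_zp (u + v)" by (simp add: of_zp_simps algebra_simps)
    then show "x - z \<in> range of_zp" by blast
  qed
qed

instantiation qpzp :: (prime_card) ab_group_add
begin

lift_definition zero_qpzp :: "'a qpzp" is 0 .

lift_definition plus_qpzp :: "'a qpzp \<Rightarrow> 'a qpzp \<Rightarrow> 'a qpzp" is "(+)"
proof -
  fix x y u v :: "'a qp"
  assume "x - y \<in> range of_zp" "u - v \<in> range of_zp"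
  then obtain r s where "x - y = of_zp r" "u - v = of_zp s" by auto
  then have "x + u - (y + v) = of_zp (r + s)" by (simp add: of_zp_simps algebra_simps)
  then show "x + u - (y + v) \<in> range of_zp" by blast
qed

lift_definition uminus_qpzp :: "'a qpzp \<Rightarrow> 'a qpzp" is uminus
proof -
  fix x y :: "'a qp"
  assume "x - y \<in> range of_zp"
  then obtain r where "x - y = of_zp r" by auto
  then have "- x - - y = of_zp (- r)" by (simp add: of_zp_simps algebra_simps)
  then show "- x - - y \<in> range of_zp" by blast
qed

definition minus_qpzp :: "'a qpzp \<Rightarrow> 'a qpzp \<Rightarrow> 'a qpzp" where "minus_qpzp x y = x + (- y)"

instance
proof
  fix a b c :: "'a qpzp"
  have 0: "0 \<in> range (of_zp :: 'a zp \<Rightarrow> 'a qp)" by (metis of_zp_simps(1) rangeI)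
  show "a + b + c = a + (b + c)" by transfer (simp add: 0 add.assoc)
  show "a + b = b + a" by transfer (simp add: 0)
  show "0 + a = a" by transfer (simp add: 0)
  show "- a + a = 0" by transfer (simp add: 0)
  show "a - b = a + - b" by (rule minus_qpzp_def)
qed

end

lift_definition zp_scale :: "'p::prime_card zp \<Rightarrow> 'p qpzp \<Rightarrow> 'p qpzp" is "\<lambda>r x. of_zp r * x"
proof -
  fix r :: "'p zp" and x y :: "'p qp"
  assume "x - y \<in> range of_zp"
  then obtain s where "x - y = of_zp s" by auto
  then have "of_zp r * x - of_zp r * y = of_zp (r * s)"
    by (simp add: of_zp_simps right_diff_distrib[symmetric])
  then show "of_zp r * x - of_zp r * y \<in> range of_zp" by blast
qed


section \<open>Groups with a pairing\<close>

text \<open>Groups are written multiplicatively, as in the group theory library.  The pairing is only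
  relevant on the carrier.\<close>

record ('a, 'p) paired_group = "'a monoid" +
  pairing :: "'a \<Rightarrow> 'a \<Rightarrow> 'p qpzp"

definition add_group :: "'a::ab_group_add monoid" where
  "add_group = \<lparr>carrier = UNIV, mult = (+), one = 0\<rparr>"

definition symmetric_pairing :: "('a, 'p::prime_card) paired_group \<Rightarrow> bool" where
  "symmetric_pairing G \<longleftrightarrow>
     (\<forall>x\<in>carrier G. \<forall>y\<in>carrier G. pairing G x y = pairing G y x) \<and>
     (\<forall>x\<in>carrier G. \<forall>y\<in>carrier G. \<forall>z\<in>carrier G.
        pairing G (x \<otimes>\<^bsub>G\<^esub> y) z = pairing G x z + pairing G y z)"

text \<open>A pairing is perfect if it induces a bijection from \<open>G\<close> to its dual
  \<open>Hom(G, \<rat>\<^sub>p/\<int>\<^sub>p)\<close>, whose elements are represented by extensional functions.\<close>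

definition perfect_pairing :: "('a, 'p::prime_card) paired_group \<Rightarrow> bool" where
  "perfect_pairing G \<longleftrightarrow>
     bij_betw (\<lambda>x. restrict (pairing G x) (carrier G)) (carrier G)
       (hom G add_group \<inter> extensional (carrier G))"

definition perfect_symmetric_p_group :: "('a, 'p::prime_card) paired_group \<Rightarrow> bool" where
  "perfect_symmetric_p_group G \<longleftrightarrow>
     comm_group G \<and> finite (carrier G) \<and> (\<exists>m. card (carrier G) = CARD('p) ^ m) \<and>
     symmetric_pairing G \<and> perfect_pairing G"

definition paired_iso :: "('a, 'p::prime_card) paired_group \<Rightarrow> ('b, 'p) paired_group \<Rightarrow> bool" where
  "paired_iso G H \<longleftrightarrow>
     (\<exists>f\<in>iso G H. \<forall>x\<in>carrier G. \<forall>y\<in>carrier G. pairing H (f x) (f y) = pairing G x y)"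

text \<open>Isomorphism classes are formed within the groups whose carrier is a set of natural numbers;
  every countable group has a representative there.\<close>

type_synonym 'p paired_class = "(nat, 'p) paired_group set"

definition iso_class :: "('a, 'p::prime_card) paired_group \<Rightarrow> 'p paired_class" where
  "iso_class G = {H. group H \<and> paired_iso G H}"

definition X_S :: "'p::prime_card paired_class set" where
  "X_S = iso_class ` {G :: (nat, 'p) paired_group. perfect_symmetric_p_group G}"

text \<open>The discrete \<open>\<sigma>\<close>-algebra on \<open>X_S\<close>, where random elements are allowed to lie outside
  \<open>X_S\<close> on a null set.\<close>

definition class_space :: "'p::prime_card paired_class measure" where
  "class_space = sigma UNIV (Pow X_S)"


section \<open>The kernel of a symmetric matrix\<close>

definition zp_mat_vec :: "'p::prime_card zp mat \<Rightarrow> 'p qpzp Matrix.vec \<Rightarrow> 'p qpzp Matrix.vec" where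
  "zp_mat_vec A v =
     Matrix.vec (dim_row A) (\<lambda>i. \<Sum>j<dim_col A. zp_scale (A $$ (i, j)) (vec_index v j))"

text \<open>Here \<open>qp_lift\<close> chooses a representative in \<open>\<rat>\<^sub>p\<close>; on the kernel the pairing does not
  depend on this choice.\<close>

definition ker_paired :: "'p::prime_card zp mat \<Rightarrow> ('p qpzp Matrix.vec, 'p) paired_group" where
  "ker_paired A =
     \<lparr>carrier = {v \<in> carrier_vec (dim_col A). zp_mat_vec A v = 0\<^sub>v (dim_row A)},
      mult = (+), one = 0\<^sub>v (dim_col A),
      pairing = (\<lambda>v w. qpzp_of (\<Sum>i<dim_row A. \<Sum>j<dim_col A.
        qp_lift (vec_index v i) * of_zp (A $$ (i, j)) * qp_lift (vec_index w j)))\<rparr>"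


section \<open>The random matrix\<close>

definition sym_haar :: "'w measure \<Rightarrow> (nat \<Rightarrow> nat \<Rightarrow> 'w \<Rightarrow> 'p::prime_card zp) \<Rightarrow> bool" where
  "sym_haar M a \<longleftrightarrow>
     prob_space M \<and>
     (\<forall>i j. \<forall>\<omega>\<in>space M. a j i \<omega> = a i j \<omega>) \<and>
     prob_space.indep_vars M (\<lambda>_. borel) (\<lambda>(i, j). a i j) {(i, j). i \<le> j} \<and>
     (\<forall>i j. i \<le> j \<longrightarrow> distr M borel (a i j) = haar)"

text \<open>Rows and columns are numbered from \<open>0\<close>.\<close>

definition corner :: "(nat \<Rightarrow> nat \<Rightarrow> 'w \<Rightarrow> 'a) \<Rightarrow> nat \<Rightarrow> 'w \<Rightarrow> 'a mat" where
  "corner a n \<omega> = mat n n (\<lambda>(i, j). a i j \<omega>)"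

definition ker_chain ::
    "(nat \<Rightarrow> nat \<Rightarrow> 'w \<Rightarrow> 'p::prime_card zp) \<Rightarrow> nat \<Rightarrow> 'w \<Rightarrow> 'p paired_class" where
  "ker_chain a n \<omega> = iso_class (ker_paired (corner a n \<omega>))"


section \<open>The operator \<open>\<Delta>\<^sub>S\<close>\<close>

text \<open>The pairing on \<open>G \<times> \<rat>\<^sub>p\<close> with parameter \<open>q\<close>.\<close>

definition ext_pairing ::
    "('a, 'p::prime_card) paired_group \<Rightarrow> 'p qp \<Rightarrow> 'a \<times> 'p qp \<Rightarrow> 'a \<times> 'p qp \<Rightarrow> 'p qpzp" where
  "ext_pairing G q x y = pairing G (fst x) (fst y) + qpzp_of (q * snd x * snd y)"

definition ext_perp ::
    "('a, 'p::prime_card) paired_group \<Rightarrow> 'a \<Rightarrow> 'p qp \<Rightarrow> ('a \<times> 'p qp) set" where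
  "ext_perp G g q = {y \<in> carrier (G \<times>\<times> add_group). ext_pairing G q (g, 1) y = 0}"

text \<open>The \<open>\<int>\<^sub>p\<close>-span of \<open>(g, 1)\<close>.  If \<open>G\<close> has order \<open>p\<^sup>m\<close>, a \<open>p\<close>-adic integer acts on \<open>G\<close>
  through its residue modulo \<open>p\<^sup>m\<close>.\<close>

definition ext_span :: "('a, 'p::prime_card) paired_group \<Rightarrow> 'a \<Rightarrow> ('a \<times> 'p qp) set" where
  "ext_span G g =
     range (\<lambda>r :: 'p zp.
       (g [^]\<^bsub>G\<^esub> Rep_zp r (multiplicity CARD('p) (card (carrier G))), of_zp r))"

text \<open>The group \<open>(g, 1)\<^sup>\<bottom>/(g, 1)\<close>; the pairing of two cosets is the common value of the pairings
  of their elements.\<close>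

definition delta_quotient ::
    "('a, 'p::prime_card) paired_group \<Rightarrow> 'a \<Rightarrow> 'p qp \<Rightarrow> (('a \<times> 'p qp) set, 'p) paired_group" where
  "delta_quotient G g q =
     (let Q = ((G \<times>\<times> add_group)\<lparr>carrier := ext_perp G g q\<rparr>) Mod ext_span G g
      in \<lparr>carrier = carrier Q, mult = mult Q, one = one Q,
          pairing = (\<lambda>A B. the_elem (case_prod (ext_pairing G q) ` (A \<times> B)))\<rparr>)"

text \<open>The parameter \<open>q\<close> is distributed according to the Haar measure on the coset
  \<open>- \<langle>g, g\<rangle>\<close> of \<open>\<int>\<^sub>p\<close>: it is a fixed element of the coset plus a Haar distributed \<open>z \<in> \<int>\<^sub>p\<close>.
  By invariance, the choice of that element is irrelevant.\<close>

definition Delta_S :: "('a, 'p::prime_card) paired_group \<Rightarrow> 'p paired_class measure" where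
  "Delta_S G =
     distr (uniform_count_measure (carrier G) \<Otimes>\<^sub>M haar) class_space
       (\<lambda>(g, z). iso_class (delta_quotient G g (qp_lift (- pairing G g g) + of_zp z)))"

end

theory Submission
  imports Defs
    "HOL-Algebra.Sylow"
    "Jordan_Normal_Form.Determinant"
begin

text \<open>Let \<open>A\<close> be the \<open>n \<times> n\<close> corner, \<open>b\<close> the part of the new column above the diagonal and \<open>c\<close> the new
  diagonal entry, with \<open>A\<close> non-singular, \<open>G = ker A\<close> and \<open>g \<in> G\<close> the class of \<open>A\<^sup>-\<^sup>1 b\<close>.  Put
  \<open>q = c - b\<^sup>T A\<^sup>-\<^sup>1 b\<close>, so that \<open>q \<equiv> - \<langle>g, g\<rangle>\<close> modulo \<open>\<int>\<^sub>p\<close>.  The map \<open>(h, t) \<mapsto> (h - t A\<^sup>-\<^sup>1 b, t)\<close> is an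
  isometry from \<open>(g, 1)\<^sup>\<bottom>/(g, 1)\<close>, formed with the parameter \<open>q\<close>, onto the kernel of the \<open>(n+1) \<times> (n+1)\<close>
  corner.  By translation invariance of the Haar measure in \<open>c\<close>, the parameter \<open>q\<close> is Haar
  distributed on its coset for every fixed \<open>b\<close>; by translation invariance in \<open>b\<close> along \<open>A V\<close>, where
  \<open>V\<close> runs through lifts of the elements of \<open>G\<close>, the element \<open>g\<close> is uniformly distributed on \<open>G\<close>.
  Both statements hold for each fixed \<open>A\<close>, and \<open>(b, c)\<close> is independent of \<open>A\<close>, hence of the past.
  A singular \<open>(n+1) \<times> (n+1)\<close> corner with non-singular \<open>A\<close> forces one value of \<open>c\<close>, given \<open>b\<close>, and
  therefore has probability zero.  Measurability holds because the isomorphism class of the kernel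
  is locally constant at non-singular matrices.\<close>

section \<open>Arithmetic of the p-adic integers\<close>

text \<open>Kernels consist of vectors over Q_p/Z_p, whereas \<open>Delta_S\<close> is evaluated on
  representatives carried by natural numbers. Computations therefore use lifts to Q_p, where
  equality in the kernel means that a difference is integral, and an isometry \<open>F\<close>
  carries them to the representative. The parameter q in \<open>Delta_S\<close> starts from a chosen
  lift of -<g,g>. The true value c - b^T A^-1 b differs from that lift by a p-adic integer depending
  on b, so c is integrated first, with b fixed. The law of g is never computed on its own. With
  \<open>D g\<close> the probability of the target event given g, the integral of D over the random
  column does not change when its argument is shifted by an element of G; summing over all shifts
  makes the integrand constant and leaves the average of D over G. The sigma-algebra of
  \<open>class_space\<close> is discrete only on \<open>X_S\<close>. Measurability thus concerns
  only subsets of \<open>X_S\<close>, where the class is locally constant. For a single history of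
  positive probability, the Markov property is a product formula for the measure of the history
  intersected with an event at the next time.\<close>

lemma zp_eqI: "(\<And>n. Rep_zp x n = Rep_zp y n) \<Longrightarrow> x = y"
  by (metis Rep_zp_inject ext)

lemma Rep_zp_nonneg: "0 \<le> Rep_zp (x :: 'p::prime_card zp) n"
  and Rep_zp_less: "Rep_zp (x :: 'p::prime_card zp) n < int CARD('p) ^ n"
proof -
  have "0 < int CARD('p) ^ n" by simp
  then show "0 \<le> Rep_zp x n" "Rep_zp x n < int CARD('p) ^ n"
    using pos_mod_sign[of "int CARD('p) ^ n" "Rep_zp x n"]
      pos_mod_bound[of "int CARD('p) ^ n" "Rep_zp x n"] by simp_all
qed

lemma Rep_zp_le_mod: "n \<le> m \<Longrightarrow> Rep_zp (x :: 'p::prime_card zp) m mod int CARD('p) ^ n = Rep_zp x n"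
  by (metis Rep_zp_add_mod le_Suc_ex)

lemma Rep_zp_of_nat: "Rep_zp (of_nat k :: 'p::prime_card zp) n = int k mod int CARD('p) ^ n"
  by (induction k) (simp_all add: zero_zp.rep_eq one_zp.rep_eq plus_zp.rep_eq mod_simps add.commute)

lemma Rep_zp_of_int: "Rep_zp (of_int k :: 'p::prime_card zp) n = k mod int CARD('p) ^ n"
  by (cases k rule: int_cases2) (simp_all add: Rep_zp_of_nat uminus_zp.rep_eq mod_simps)

lemma Rep_zp_diff: "Rep_zp (x - y :: 'p::prime_card zp) n = (Rep_zp x n - Rep_zp y n) mod int CARD('p) ^ n"
  unfolding minus_zp_def plus_zp.rep_eq uminus_zp.rep_eq mod_add_right_eq by simp

definition pz :: "'p::prime_card zp" where
  "pz = of_nat CARD('p)"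

lemma Rep_pz_power: "Rep_zp (pz ^ N :: 'p::prime_card zp) n = int CARD('p) ^ N mod int CARD('p) ^ n"
  unfolding pz_def of_nat_power[symmetric] Rep_zp_of_nat by simp

text \<open>Division by p^N is a shift of levels: if the residue at level N vanishes, every residue
  at level n + N is a multiple of p^N, and the quotients again form a compatible sequence.\<close>

lemma pz_power_dvd_iff: "(pz :: 'p::prime_card zp) ^ N dvd x \<longleftrightarrow> Rep_zp x N = 0"
proof
  assume "pz ^ N dvd x"
  then obtain y where "x = pz ^ N * y" unfolding dvd_def by blast
  then show "Rep_zp x N = 0" by (simp add: times_zp.rep_eq Rep_pz_power)
next
  let ?P = "int CARD('p)"
  assume 0: "Rep_zp x N = 0"
  define f where "f = (\<lambda>n. Rep_zp x (n + N) div ?P ^ N)"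
  have d: "Rep_zp x (n + N) = ?P ^ N * f n" for n
  proof -
    have "Rep_zp x (n + N) mod ?P ^ N = 0"
      using Rep_zp_add_mod[of x N n] unfolding 0 add.commute[of N n] .
    then have "?P ^ N dvd Rep_zp x (n + N)" by (rule mod_0_imp_dvd)
    then show ?thesis unfolding f_def by simp
  qed
  have "f (Suc n) mod ?P ^ n = f n" for n
  proof -
    have "?P ^ N * (f (Suc n) mod ?P ^ n) = (?P ^ N * f (Suc n)) mod (?P ^ N * ?P ^ n)"
      by (rule mult_mod_right)
    also have "\<dots> = Rep_zp x (Suc (n + N)) mod ?P ^ (n + N)"
      unfolding d[of "Suc n", symmetric] power_add[symmetric] add_Suc by (simp add: add.commute)
    also have "\<dots> = ?P ^ N * f n" unfolding Rep_zp_Suc_mod by (rule d)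
    finally show ?thesis by simp
  qed
  then have r: "Rep_zp (Abs_zp f :: 'p zp) = f" by (intro Abs_zp_inverse) simp
  have "x = pz ^ N * Abs_zp f"
  proof (rule zp_eqI)
    fix n
    show "Rep_zp x n = Rep_zp (pz ^ N * Abs_zp f :: 'p zp) n"
      unfolding times_zp.rep_eq Rep_pz_power r mod_mult_left_eq d[symmetric] Rep_zp_add_mod ..
  qed
  then show "pz ^ N dvd x" by simp
qed

lemma Rep_zp_eq_iff_dvd: "Rep_zp x N = Rep_zp (y :: 'p zp) N \<longleftrightarrow> (pz :: 'p::prime_card zp) ^ N dvd x - y"
  unfolding pz_power_dvd_iff Rep_zp_diff
  using mod_eq_dvd_iff[of "Rep_zp x N" "int CARD('p) ^ N" "Rep_zp y N"]
  unfolding Rep_zp_mod_self mod_eq_0_iff_dvd .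

text \<open>Truncation at level N. Wherever p^N acts as zero, only the integer part acts, so a
  p-adic scalar may be replaced by a natural number.\<close>

lemma zp_approx: "\<exists>y. x = of_int (Rep_zp x N) + (pz :: 'p::prime_card zp) ^ N * y"
proof -
  have "Rep_zp x N = Rep_zp (of_int (Rep_zp x N) :: 'p zp) N" unfolding Rep_zp_of_int Rep_zp_mod_self ..
  then have "pz ^ N dvd x - of_int (Rep_zp x N)" by (simp only: Rep_zp_eq_iff_dvd)
  then obtain y where "x - of_int (Rep_zp x N) = pz ^ N * y" unfolding dvd_def by blast
  then have "x = of_int (Rep_zp x N) + pz ^ N * y" by (simp add: algebra_simps)
  then show ?thesis by blast
qed

lemma zp_unit:
  assumes "Rep_zp (x :: 'p::prime_card zp) 1 \<noteq> 0"
  shows "\<exists>y. x * y = 1"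
proof -
  let ?P = "int CARD('p)"
  have p: "prime ?P" by (rule prime_card_int)
  have co: "coprime (Rep_zp x n) (?P ^ n)" for n
  proof (cases n)
    case (Suc k)
    have "Rep_zp x n mod ?P = Rep_zp x 1" using Rep_zp_add_mod[of x 1 k] Suc by simp
    then have "\<not> ?P dvd Rep_zp x n" using assms dvd_imp_mod_0[of ?P "Rep_zp x n"] by linarith
    then have "coprime ?P (Rep_zp x n)" using p by (simp add: prime_imp_coprime)
    then show ?thesis by (simp add: coprime_commute)
  qed simp
  have ex: "\<exists>y. y \<in> {0..<?P ^ n} \<and> [Rep_zp x n * y = 1] (mod ?P ^ n)" for n
  proof -
    obtain y where "[Rep_zp x n * y = 1] (mod ?P ^ n)" using cong_solve_coprime_int[OF co] by blast
    then have "[Rep_zp x n * (y mod ?P ^ n) = 1] (mod ?P ^ n)" by (simp add: cong_def mod_simps)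
    then show ?thesis by (intro exI[of _ "y mod ?P ^ n"]) simp
  qed
  \<comment> \<open>Inverses modulo p^n are unique in this range, so the separate choices are
    compatible with each other.\<close>
  define f where "f = (\<lambda>n. SOME y. y \<in> {0..<?P ^ n} \<and> [Rep_zp x n * y = 1] (mod ?P ^ n))"
  have f: "f n \<in> {0..<?P ^ n}" "[Rep_zp x n * f n = 1] (mod ?P ^ n)" for n
    using someI_ex[OF ex[of n]] unfolding f_def by blast+
  have "f (Suc n) mod ?P ^ n = f n" for n
  proof -
    have "[Rep_zp x (Suc n) * f (Suc n) = 1] (mod ?P ^ n)"
      using f(2)[of "Suc n"] by (rule cong_dvd_modulus) simp
    moreover have "[Rep_zp x (Suc n) = Rep_zp x n] (mod ?P ^ n)"
      by (simp add: cong_def Rep_zp_Suc_mod)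
    ultimately have "[Rep_zp x n * f (Suc n) = 1] (mod ?P ^ n)"
      by (metis cong_scalar_right cong_sym cong_trans)
    then have "[Rep_zp x n * f (Suc n) = Rep_zp x n * f n] (mod ?P ^ n)"
      using f(2)[of n] by (metis cong_sym cong_trans)
    then have "[f (Suc n) = f n] (mod ?P ^ n)" using co[of n] by (simp add: cong_mult_lcancel)
    then show ?thesis using f(1)[of n] by (simp add: cong_def)
  qed
  then have r: "Rep_zp (Abs_zp f :: 'p zp) = f" by (intro Abs_zp_inverse) simp
  have "x * Abs_zp f = 1"
    by (rule zp_eqI) (use f(2) in \<open>simp add: times_zp.rep_eq r one_zp.rep_eq cong_def\<close>)
  then show ?thesis by blast
qed

text \<open>Stripping off the largest power of p leaves a unit. In this form the lemma clears every
  denominator by a power of p.\<close>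

lemma zp_dvd_pz_power:
  assumes "(d :: 'p::prime_card zp) \<noteq> 0"
  shows "\<exists>N y. d * y = pz ^ N"
proof -
  have ex: "\<exists>n. Rep_zp d n \<noteq> 0"
    using assms zp_eqI[of d 0] by (auto simp: zero_zp.rep_eq)
  \<comment> \<open>The first level with a nonzero residue is one more than the valuation: level 0
    is always zero, and p^k divides \<open>d\<close> exactly for k < n.\<close>
  define n where "n = (LEAST n. Rep_zp d n \<noteq> 0)"
  have n: "Rep_zp d n \<noteq> 0" unfolding n_def using LeastI_ex[OF ex] .
  have "n \<noteq> 0" using n Rep_zp_less[of d 0] Rep_zp_nonneg[of d 0] by (cases n) auto
  then obtain k where k: "n = Suc k" using not0_implies_Suc by blast
  have "Rep_zp d k = 0" using not_less_Least[of k "\<lambda>n. Rep_zp d n \<noteq> 0"] k n_def by auto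
  then obtain u where u: "d = pz ^ k * u" by (metis pz_power_dvd_iff dvdE)
  have "Rep_zp u 1 \<noteq> 0"
  proof
    assume "Rep_zp u 1 = 0"
    then have "pz dvd u" using pz_power_dvd_iff[of 1 u] by simp
    then have "pz ^ k * pz dvd pz ^ k * u" by (rule mult_dvd_mono[OF dvd_refl])
    then have "pz ^ n dvd d" unfolding u k power_Suc2 .
    then show False using n by (simp add: pz_power_dvd_iff)
  qed
  then obtain y where "u * y = 1" using zp_unit by blast
  then have "pz ^ k * (u * y) = pz ^ k" by simp
  then have "d * y = pz ^ k" unfolding u mult.assoc .
  then show ?thesis by blast
qed

lemma pz_nonzero [simp]: "(pz :: 'p::prime_card zp) \<noteq> 0"
proof
  assume "(pz :: 'p zp) = 0"
  \<comment> \<open>Level 2 is the first that sees p, since p vanishes modulo p.\<close>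
  then have "Rep_zp (pz ^ 1 :: 'p zp) 2 = 0" by (simp add: zero_zp.rep_eq)
  moreover have "(0::int) < int CARD('p)" "int CARD('p) < int CARD('p) ^ 2"
    using prime_gt_1_int[OF prime_card_int[where 'a = 'p]] by (simp_all add: power2_eq_square)
  ultimately show False unfolding Rep_pz_power by simp
qed

lemma zp_eq_0_if_divisible:
  assumes "\<And>k. (pz :: 'p::prime_card zp) ^ k dvd x" shows "x = 0"
  using assms by (intro zp_eqI) (simp add: pz_power_dvd_iff zero_zp.rep_eq)

section \<open>The p-adic numbers modulo the p-adic integers\<close>

lemma inj_of_zp: "inj of_zp"
  by (auto simp: inj_def of_zp_def eq_fract)

lemma of_zp_eq_iff [simp]: "of_zp x = of_zp y \<longleftrightarrow> x = y"
  using inj_of_zp by (auto simp: inj_def)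

lemma of_zp_eq_0_iff [simp]: "of_zp x = 0 \<longleftrightarrow> x = 0"
  using of_zp_eq_iff[of x 0] by (simp only: of_zp_simps)

lemma of_zp_0_1 [simp]: "of_zp 0 = 0" "of_zp 1 = 1"
  by (rule of_zp_simps)+

lemma of_zp_power: "of_zp (x ^ n) = of_zp x ^ n"
  by (induction n) (simp_all add: of_zp_simps)

lemma of_zp_sum: "of_zp (\<Sum>i\<in>A. f i) = (\<Sum>i\<in>A. of_zp (f i))"
  by (induction A rule: infinite_finite_induct) (simp_all add: of_zp_simps)

lemma qp_denominator: "\<exists>N y. of_zp (pz ^ N) * (x :: 'p::prime_card qp) = of_zp y"
proof (cases x)
  case (Fract a b)
  obtain N y where "b * y = pz ^ N" using zp_dvd_pz_power Fract by blast
  then have "of_zp (pz ^ N) * x = of_zp (y * a)"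
    using Fract by (simp add: of_zp_def eq_fract ac_simps)
  then show ?thesis by blast
qed

lemma qpzp_of_eq_iff: "qpzp_of x = qpzp_of y \<longleftrightarrow> x - y \<in> range of_zp"
  by (rule qpzp.abs_eq_iff)

lemma qpzp_of_eq_0_iff: "qpzp_of x = 0 \<longleftrightarrow> x \<in> range of_zp"
  by (simp add: zero_qpzp.abs_eq qpzp_of_eq_iff)

lemma qpzp_of_lift [simp]: "qpzp_of (qp_lift v) = v"
  using Quotient3_abs_rep[OF Quotient3_qpzp] .

lemma qpzp_of_add: "qpzp_of (x + y) = qpzp_of x + qpzp_of y"
  by (simp add: plus_qpzp.abs_eq)

lemma qpzp_of_uminus: "qpzp_of (- x) = - qpzp_of x"
  by (simp add: uminus_qpzp.abs_eq)

lemma qpzp_of_0 [simp]: "qpzp_of 0 = 0"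
  by (simp add: zero_qpzp.abs_eq)

lemma qpzp_of_of_zp [simp]: "qpzp_of (of_zp x) = 0"
  by (simp add: qpzp_of_eq_0_iff)

lemma qpzp_of_sum: "qpzp_of (\<Sum>i\<in>A. f i) = (\<Sum>i\<in>A. qpzp_of (f i))"
  by (induction A rule: infinite_finite_induct) (simp_all add: qpzp_of_add)

lemma qpzp_of_scale: "qpzp_of (of_zp r * x) = zp_scale r (qpzp_of x)"
  by (simp add: zp_scale.abs_eq)

lemma qpzp_cases: obtains x where "v = qpzp_of x"
  by (metis qpzp_of_lift)

lemma zp_scale_add_left: "zp_scale (r + s) v = zp_scale r v + zp_scale s v"
  by (cases v rule: qpzp_cases)
    (simp add: qpzp_of_scale[symmetric] qpzp_of_add[symmetric] distrib_right of_zp_simps)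

lemma zp_scale_mult: "zp_scale (r * s) v = zp_scale r (zp_scale s v)"
  by (cases v rule: qpzp_cases)
    (simp add: qpzp_of_scale[symmetric] mult.assoc of_zp_simps)

lemma zp_scale_simps [simp]: "zp_scale 0 v = 0" "zp_scale 1 v = v" "zp_scale r 0 = 0"
proof -
  show "zp_scale r 0 = 0" using qpzp_of_scale[of r 0] by simp
  obtain x where v: "v = qpzp_of x" by (rule qpzp_cases)
  show "zp_scale 0 v = 0" "zp_scale 1 v = v"
    using qpzp_of_scale[of 0 x] qpzp_of_scale[of 1 x] by (simp_all add: v)
qed

text \<open>The p^N-torsion is p^-N Z_p / Z_p, and its classes are represented by k / p^N with 0
  \<le> k < p^N.\<close>

lemma finite_qpzp_torsion: "finite {v :: 'p::prime_card qpzp. zp_scale (pz ^ N) v = 0}"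
proof (rule finite_subset)
  show "finite ((\<lambda>k. qpzp_of (of_zp (of_int k) / of_zp (pz ^ N)) :: 'p qpzp) ` {0..<int CARD('p) ^ N})"
    by simp
  show "{v :: 'p qpzp. zp_scale (pz ^ N) v = 0} \<subseteq>
      (\<lambda>k. qpzp_of (of_zp (of_int k) / of_zp (pz ^ N))) ` {0..<int CARD('p) ^ N}"
  proof
    fix v :: "'p qpzp"
    assume v: "v \<in> {v. zp_scale (pz ^ N) v = 0}"
    obtain x where x: "v = qpzp_of x" by (rule qpzp_cases)
    have "qpzp_of (of_zp (pz ^ N) * x) = 0" using v by (simp only: qpzp_of_scale x mem_Collect_eq)
    then obtain y where y: "of_zp (pz ^ N) * x = of_zp y"
      unfolding qpzp_of_eq_0_iff by blast
    obtain z where z: "y = of_int (Rep_zp y N) + pz ^ N * z" using zp_approx by blast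
    have nz: "of_zp (pz ^ N) \<noteq> (0 :: 'p qp)" by simp
    have "x = of_zp y / of_zp (pz ^ N)" using y nz by (simp add: field_simps)
    also have "\<dots> = (of_zp (of_int (Rep_zp y N)) + of_zp (pz ^ N) * of_zp z) / of_zp (pz ^ N)"
      by (subst z) (simp only: of_zp_simps)
    also have "\<dots> = of_zp (of_int (Rep_zp y N)) / of_zp (pz ^ N) + of_zp z"
      using nz by (simp add: add_divide_distrib)
    finally have "v = qpzp_of (of_zp (of_int (Rep_zp y N)) / of_zp (pz ^ N))"
      by (simp add: x qpzp_of_add)
    then show "v \<in> (\<lambda>k. qpzp_of (of_zp (of_int k) / of_zp (pz ^ N))) ` {0..<int CARD('p) ^ N}"
      using Rep_zp_nonneg[of y N] Rep_zp_less[of y N] by auto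
  qed
qed

lemma zp_scale_Rep:
  assumes "zp_scale (pz ^ N) v = 0"
  shows "zp_scale r v = zp_scale (of_nat (nat (Rep_zp r N))) v"
proof -
  obtain y where "r = of_int (Rep_zp r N) + pz ^ N * y" using zp_approx by blast
  then have "zp_scale r v = zp_scale (of_int (Rep_zp r N) + y * pz ^ N) v"
    by (simp add: mult.commute)
  also have "\<dots> = zp_scale (of_int (Rep_zp r N)) v"
    by (simp add: zp_scale_add_left zp_scale_mult assms)
  finally have "zp_scale r v = zp_scale (of_int (Rep_zp r N)) v" .
  then show ?thesis using Rep_zp_nonneg[of r N] by (simp add: of_nat_nat)
qed

section \<open>The Haar measure\<close>

definition zp_cyl :: "nat \<Rightarrow> int \<Rightarrow> 'p::prime_card zp set" where
  "zp_cyl n r = {x. Rep_zp x n = r}"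

lemma open_zp_cyl: "open (zp_cyl n r)"
  by (auto simp: open_zp_def zp_cyl_def)

lemma zp_cyl_0: "zp_cyl 0 0 = (UNIV :: 'p::prime_card zp set)"
proof -
  have "Rep_zp x 0 = 0" for x :: "'p zp"
    using Rep_zp_less[of x 0] Rep_zp_nonneg[of x 0] by simp
  then show ?thesis by (simp add: zp_cyl_def)
qed

lemma zp_cyl_empty:
  assumes "r \<notin> {0..<int CARD('p) ^ n}" shows "zp_cyl n r = ({} :: 'p::prime_card zp set)"
  using assms Rep_zp_less[where 'p = 'p] Rep_zp_nonneg[where 'p = 'p] by (auto simp: zp_cyl_def)

text \<open>There are only countably many cylinders, so an open set is a countable union of those
  that it contains.\<close>

lemma sets_borel_zp:
  "sets (borel :: 'p::prime_card zp measure) = sigma_sets UNIV (range (\<lambda>(n, r). zp_cyl n r))"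
    (is "_ = sigma_sets _ ?C")
proof
  show "sigma_sets UNIV ?C \<subseteq> sets (borel :: 'p zp measure)"
    by (rule sets.sigma_sets_subset[of _ borel, simplified]) (auto intro: open_zp_cyl borel_open)
  have "U \<in> sigma_sets UNIV ?C" if "open U" for U :: "'p zp set"
  proof -
    have "U = \<Union>{C \<in> ?C. C \<subseteq> U}"
    proof
      show "U \<subseteq> \<Union>{C \<in> ?C. C \<subseteq> U}"
      proof
        fix x assume "x \<in> U"
        with that obtain n where "\<forall>y. Rep_zp y n = Rep_zp x n \<longrightarrow> y \<in> U"
          unfolding open_zp_def by blast
        then have "x \<in> zp_cyl n (Rep_zp x n)" "zp_cyl n (Rep_zp x n) \<subseteq> U"
          by (auto simp: zp_cyl_def)
        then show "x \<in> \<Union>{C \<in> ?C. C \<subseteq> U}" by blast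
      qed
    qed blast
    moreover have "countable {C \<in> ?C. C \<subseteq> U}" by (rule countable_subset[of _ ?C]) auto
    then have "\<Union>{C \<in> ?C. C \<subseteq> U} \<in> sigma_sets UNIV ?C"
      by (rule sigma_sets_UNION) (auto intro: sigma_sets.Basic)
    ultimately show ?thesis by simp
  qed
  then have "sigma_sets UNIV (Collect open) \<subseteq> sigma_sets UNIV ?C"
    by (intro sigma_sets_mono) auto
  then show "sets (borel :: 'p zp measure) \<subseteq> sigma_sets UNIV ?C"
    unfolding borel_def by simp
qed

text \<open>Two cylinders are nested or disjoint, the finer one having a single residue at the
  coarser level.\<close>

lemma Int_stable_zp_cyl: "Int_stable (range (\<lambda>(n, r). zp_cyl n r :: 'p::prime_card zp set))"
proof (rule Int_stableI)
  fix A B :: "'p zp set"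
  assume "A \<in> range (\<lambda>(n, r). zp_cyl n r)" "B \<in> range (\<lambda>(n, r). zp_cyl n r)"
  then obtain n r m s where A: "A = zp_cyl n r" and B: "B = zp_cyl m s" by auto
  have 0: "zp_cyl 0 1 = ({} :: 'p zp set)" by (rule zp_cyl_empty) simp
  have *: "zp_cyl n r \<inter> zp_cyl m s \<in> {zp_cyl m s, zp_cyl 0 1 :: 'p zp set}" if "n \<le> m" for n m r s
  proof (cases "s mod int CARD('p) ^ n = r")
    case True
    then have "zp_cyl m s \<subseteq> (zp_cyl n r :: 'p zp set)"
      using Rep_zp_le_mod[OF that, where 'p = 'p] by (auto simp: zp_cyl_def)
    then show ?thesis by auto
  next
    case False
    then have "zp_cyl n r \<inter> zp_cyl m s = ({} :: 'p zp set)"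
      using Rep_zp_le_mod[OF that, where 'p = 'p] by (auto simp: zp_cyl_def)
    then show ?thesis by (simp add: 0)
  qed
  have "A \<inter> B \<in> {A, B, zp_cyl 0 1}"
    using *[of n m r s] *[of m n s r] by (cases "n \<le> m") (auto simp: A B Int_commute)
  then show "A \<inter> B \<in> range (\<lambda>(n, r). zp_cyl n r)" unfolding A B by auto
qed

lemma zp_measure_eqI:
  fixes \<mu> \<nu> :: "'p::prime_card zp measure"
  assumes "sets \<mu> = sets borel" "sets \<nu> = sets borel" "prob_space \<mu>"
    and "\<And>n r. r \<in> {0..<int CARD('p) ^ n} \<Longrightarrow> emeasure \<mu> (zp_cyl n r) = emeasure \<nu> (zp_cyl n r)"
  shows "\<mu> = \<nu>"
proof (rule measure_eqI_generator_eq[where A = "\<lambda>_. zp_cyl 0 0" and \<Omega> = UNIV])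
  show "Int_stable (range (\<lambda>(n, r). zp_cyl n r :: 'p zp set))" by (rule Int_stable_zp_cyl)
  show "emeasure \<mu> X = emeasure \<nu> X" if "X \<in> range (\<lambda>(n, r). zp_cyl n r)" for X
    using that assms(4) zp_cyl_empty[where 'p = 'p] by auto (metis emeasure_empty)
  show "emeasure \<mu> (zp_cyl 0 0) \<noteq> \<infinity>"
    using prob_space.finite_measure[OF assms(3)] by (simp add: finite_measure.emeasure_finite)
  show "range (\<lambda>_. zp_cyl 0 0 :: 'p zp set) \<subseteq> range (\<lambda>(n, r). zp_cyl n r)" by auto
qed (simp_all add: assms sets_borel_zp zp_cyl_0)

lemma add_vimage_zp_cyl:
  "(\<lambda>x. c + x) -` zp_cyl n r = (if r \<in> {0..<int CARD('p) ^ n}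
     then zp_cyl n ((r - Rep_zp c n) mod int CARD('p) ^ n) else ({} :: 'p::prime_card zp set))"
proof -
  let ?q = "int CARD('p) ^ n"
  have *: "(Rep_zp c n + t) mod ?q = r \<longleftrightarrow> t = (r - Rep_zp c n) mod ?q"
    if "r \<in> {0..<?q}" "0 \<le> t" "t < ?q" for t
  proof
    assume "(Rep_zp c n + t) mod ?q = r"
    then have "(r - Rep_zp c n) mod ?q = (Rep_zp c n + t - Rep_zp c n) mod ?q"
      by (metis mod_diff_left_eq)
    then show "t = (r - Rep_zp c n) mod ?q" using that by simp
  next
    assume "t = (r - Rep_zp c n) mod ?q"
    then have "(Rep_zp c n + t) mod ?q = (Rep_zp c n + (r - Rep_zp c n)) mod ?q"
      by (metis mod_add_right_eq)
    then show "(Rep_zp c n + t) mod ?q = r" using that by simp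
  qed
  show ?thesis
  proof (cases "r \<in> {0..<?q}")
    case True
    then show ?thesis
      using *[OF True Rep_zp_nonneg Rep_zp_less] by (simp add: zp_cyl_def plus_zp.rep_eq vimage_def)
  next
    case False
    then show ?thesis using zp_cyl_empty[OF False] by (simp only: if_False vimage_empty)
  qed
qed

lemma measurable_zp_add [measurable]: "(\<lambda>x. c + x) \<in> measurable borel (borel :: 'p::prime_card zp measure)"
proof (rule measurable_sigma_sets[OF sets_borel_zp])
  fix y :: "'p zp set" assume "y \<in> range (\<lambda>(n, r). zp_cyl n r)"
  then show "(\<lambda>x. c + x) -` y \<inter> space borel \<in> sets borel"
    by (auto simp: add_vimage_zp_cyl intro!: borel_open open_zp_cyl)
qed auto

text \<open>The p^n cylinders of level n partition the space and are translates of one another, so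
  invariance forces equal masses. This is the uniqueness half for the Haar measure.\<close>

lemma measure_zp_cyl:
  fixes \<mu> :: "'p::prime_card zp measure"
  assumes sets: "sets \<mu> = sets borel" and "prob_space \<mu>"
    and inv: "\<And>c. distr \<mu> borel (\<lambda>x. c + x) = \<mu>" and r: "r \<in> {0..<int CARD('p) ^ n}"
  shows "emeasure \<mu> (zp_cyl n r) = ennreal (1 / real CARD('p) ^ n)"
proof -
  interpret prob_space \<mu> by fact
  let ?q = "int CARD('p) ^ n"
  have sp: "space \<mu> = UNIV" using sets_eq_imp_space_eq[OF sets] by simp
  have ms: "(\<lambda>x. c + x) \<in> measurable \<mu> borel" for c :: "'p zp"
    using measurable_zp_add by (simp cong: measurable_cong_sets add: sets)
  have mc: "zp_cyl n r \<in> sets \<mu>" for r by (simp add: sets borel_open open_zp_cyl)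
  have eq: "emeasure \<mu> (zp_cyl n s) = emeasure \<mu> (zp_cyl n 0)" if "s \<in> {0..<?q}" for s
  proof -
    have "emeasure \<mu> (zp_cyl n s) = emeasure (distr \<mu> borel (\<lambda>x. of_int s + x)) (zp_cyl n s)"
      by (simp add: inv)
    also have "\<dots> = emeasure \<mu> ((\<lambda>x. of_int s + x) -` zp_cyl n s)"
      using ms mc by (simp add: emeasure_distr sets[symmetric] sp)
    also have "(\<lambda>x. of_int s + x) -` zp_cyl n s = (zp_cyl n 0 :: 'p zp set)"
      using that by (simp add: add_vimage_zp_cyl Rep_zp_of_int)
    finally show ?thesis .
  qed
  have "1 = measure \<mu> (\<Union>s\<in>{0..<?q}. zp_cyl n s)"
  proof -
    have "(\<Union>s\<in>{0..<?q}. zp_cyl n s) = (UNIV :: 'p zp set)"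
      using Rep_zp_nonneg[where 'p = 'p] Rep_zp_less[where 'p = 'p] by (auto simp: zp_cyl_def)
    then show ?thesis using prob_space by (simp add: sp)
  qed
  also have "\<dots> = (\<Sum>s\<in>{0..<?q}. measure \<mu> (zp_cyl n s))"
    by (rule finite_measure_finite_Union) (use mc in \<open>auto simp: disjoint_family_on_def zp_cyl_def\<close>)
  also have "\<dots> = (\<Sum>s\<in>{0..<?q}. measure \<mu> (zp_cyl n 0))"
    by (rule sum.cong) (simp_all only: measure_def eq)
  also have "\<dots> = real CARD('p) ^ n * measure \<mu> (zp_cyl n 0)" by (simp add: nat_power_eq)
  finally have "measure \<mu> (zp_cyl n 0) = 1 / real CARD('p) ^ n" by (simp add: field_simps)
  then show ?thesis using eq[OF r] by (simp add: emeasure_eq_measure)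
qed

section \<open>Existence of the Haar measure through independent digits\<close>

definition digit_sum :: "int \<Rightarrow> nat \<Rightarrow> (nat \<Rightarrow> int) \<Rightarrow> int" where
  "digit_sum q n d = (\<Sum>k<n. d k * q ^ k)"

lemma digit_sum_range:
  assumes "\<And>k. d k \<in> {0..<q}" shows "digit_sum q n d \<in> {0..<q ^ n}"
proof (induction n)
  case (Suc n)
  have q: "0 < q ^ n" using assms[of 0] by simp
  have "d n * q ^ n \<le> (q - 1) * q ^ n" using assms[of n] q by (intro mult_right_mono) auto
  moreover have "0 \<le> d n * q ^ n" using assms[of n] q by simp
  ultimately show ?case using Suc by (simp add: digit_sum_def algebra_simps)
qed (simp add: digit_sum_def)

lemma digit_sum_Suc: "digit_sum q (Suc n) d = digit_sum q n d + d n * q ^ n"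
  by (simp add: digit_sum_def)

lemma digit_sum_mod:
  assumes "\<And>k. d k \<in> {0..<q}" shows "digit_sum q (Suc n) d mod q ^ n = digit_sum q n d"
  using digit_sum_range[of d q n] assms by (simp add: digit_sum_Suc)

text \<open>Uniqueness of the base-q expansion, with the digits as witnesses so that the preimage of
  a cylinder becomes a condition on the first n digits. The top digit is \<open>r div q ^ n\<close>,
  and the others come from \<open>r mod q ^ n\<close>.\<close>

lemma digit_sum_eq_iff:
  assumes "0 < q" "r \<in> {0..<q ^ n}"
  shows "\<exists>e. (\<forall>k<n. e k \<in> {0..<q}) \<and>
    (\<forall>d. (\<forall>k. d k \<in> {0..<q}) \<longrightarrow> (digit_sum q n d = r \<longleftrightarrow> (\<forall>k<n. d k = e k)))"
  using assms(2)
proof (induction n arbitrary: r)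
  case 0
  then show ?case by (simp add: digit_sum_def)
next
  case (Suc n)
  have q: "0 < q ^ n" using assms(1) by simp
  have "r mod q ^ n \<in> {0..<q ^ n}" using q by simp
  from Suc.IH[OF this] obtain e where e: "\<And>k. k < n \<Longrightarrow> e k \<in> {0..<q}"
    "\<And>d. (\<forall>k. d k \<in> {0..<q}) \<Longrightarrow> digit_sum q n d = r mod q ^ n \<longleftrightarrow> (\<forall>k<n. d k = e k)" by blast
  define e' where "e' = e(n := r div q ^ n)"
  have "r div q ^ n < q"
  proof (rule ccontr)
    assume "\<not> r div q ^ n < q"
    then have "q * q ^ n \<le> r div q ^ n * q ^ n" using q by (intro mult_right_mono) auto
    moreover have "r div q ^ n * q ^ n \<le> r"
      using mod_div_mult_eq[of r "q ^ n"] pos_mod_sign[OF q, of r] by linarith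
    ultimately show False using Suc.prems by simp
  qed
  then have n: "r div q ^ n \<in> {0..<q}" using Suc.prems q by (simp add: pos_imp_zdiv_nonneg_iff)
  have "e' k \<in> {0..<q}" if "k < Suc n" for k
    using that e(1)[of k] n by (auto simp: e'_def less_Suc_eq)
  moreover have "digit_sum q (Suc n) d = r \<longleftrightarrow> (\<forall>k<Suc n. d k = e' k)"
    if d: "\<forall>k. d k \<in> {0..<q}" for d
  proof -
    have rg: "digit_sum q n d \<in> {0..<q ^ n}" using digit_sum_range d by blast
    have "digit_sum q (Suc n) d = r \<longleftrightarrow> digit_sum q n d = r mod q ^ n \<and> d n = r div q ^ n"
    proof
      assume "digit_sum q (Suc n) d = r"
      then have "r = digit_sum q n d + d n * q ^ n" by (simp add: digit_sum_Suc)
      then show "digit_sum q n d = r mod q ^ n \<and> d n = r div q ^ n"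
        using rg q by (simp add: div_mult_self1[OF less_imp_neq[OF q, symmetric]] del: zero_less_power_eq)
    next
      assume "digit_sum q n d = r mod q ^ n \<and> d n = r div q ^ n"
      then show "digit_sum q (Suc n) d = r" by (simp add: digit_sum_Suc mod_div_mult_eq)
    qed
    also have "\<dots> \<longleftrightarrow> (\<forall>k<Suc n. d k = e' k)"
      using e(2)[OF d] by (auto simp: e'_def less_Suc_eq)
    finally show ?thesis .
  qed
  ultimately show ?case by blast
qed

definition zp_of_digits :: "(nat \<Rightarrow> int) \<Rightarrow> 'p::prime_card zp" where
  "zp_of_digits d = Abs_zp (\<lambda>n. digit_sum (int CARD('p)) n d)"

lemma Rep_zp_of_digits:
  assumes "\<And>k. d k \<in> {0..<int CARD('p)}"
  shows "Rep_zp (zp_of_digits d :: 'p::prime_card zp) n = digit_sum (int CARD('p)) n d"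
proof -
  have "\<forall>n. digit_sum (int CARD('p)) (Suc n) d mod int CARD('p) ^ n = digit_sum (int CARD('p)) n d"
    using digit_sum_mod[of d "int CARD('p)"] assms by blast
  then show ?thesis unfolding zp_of_digits_def by (simp add: Abs_zp_inverse)
qed

text \<open>The measure is the law of a series with independent uniform digits. A cylinder of level
  n fixes exactly n digits, so its mass is p^-n whatever its residue; a translation pulls cylinders
  back to cylinders of the same level, hence preserves the measure on a generator.\<close>

lemma haar_exists:
  "\<exists>\<mu> :: 'p::prime_card zp measure. sets \<mu> = sets borel \<and> prob_space \<mu> \<and> (\<forall>c. distr \<mu> borel (\<lambda>x. c + x) = \<mu>)"
proof -
  let ?p = "int CARD('p)"
  define U where "U = uniform_count_measure {0..<?p}"
  define D where "D = PiM (UNIV :: nat set) (\<lambda>_. U)"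
  have p0: "0 < ?p" by simp
  interpret U: prob_space U unfolding U_def by (rule prob_space_uniform_count_measure) auto
  interpret P: product_prob_space "\<lambda>_. U" "UNIV :: nat set" ..
  have spD: "d \<in> space D \<Longrightarrow> d k \<in> {0..<?p}" for d k
    by (auto simp: D_def U_def space_PiM space_uniform_count_measure PiE_iff)
  have spU: "space U = {0..<?p}" "sets U = Pow {0..<?p}"
    by (auto simp: U_def space_uniform_count_measure sets_uniform_count_measure)
  define \<nu> where "\<nu> = distr D borel (zp_of_digits :: _ \<Rightarrow> 'p zp)"
  have pre: "\<exists>e. (\<forall>k<n. e k \<in> {0..<?p}) \<and>
      (zp_of_digits -` (zp_cyl n r :: 'p zp set) :: (nat \<Rightarrow> int) set) \<inter> space D = {d \<in> space D. \<forall>k<n. d k = e k}"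
    if r: "r \<in> {0..<?p ^ n}" for n r
  proof -
    obtain e where e: "\<forall>k<n. e k \<in> {0..<?p}"
      "\<And>d. (\<forall>k. d k \<in> {0..<?p}) \<Longrightarrow> digit_sum ?p n d = r \<longleftrightarrow> (\<forall>k<n. d k = e k)"
      using digit_sum_eq_iff[OF p0 r] by blast
    have "((zp_of_digits d :: 'p zp) \<in> zp_cyl n r) = (\<forall>k<n. d k = e k)" if "d \<in> space D" for d
      using spD[OF that] e(2)[of d] Rep_zp_of_digits[where 'p = 'p and d = d and n = n]
      by (simp add: zp_cyl_def)
    then show ?thesis using e(1) by (intro exI[of _ e]) blast
  qed
  \<comment> \<open>Written as a cylinder set of the infinite product, whose measure is a finite
    product of one-digit probabilities.\<close>
  have emb: "{d \<in> space D. \<forall>k<n. d k = e k} = P.emb UNIV {..<n} (PiE {..<n} (\<lambda>k. {e k}))"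
    if "\<forall>k<n. e k \<in> {0..<?p}" for n e
  proof -
    have "restrict d {..<n} \<in> PiE {..<n} (\<lambda>k. {e k}) \<longleftrightarrow> (\<forall>k<n. d k = e k)" for d :: "nat \<Rightarrow> int"
      by (auto simp: PiE_iff)
    then show ?thesis by (auto simp: D_def prod_emb_def space_PiM)
  qed
  have mes: "zp_of_digits \<in> measurable D (borel :: 'p zp measure)"
  proof (rule measurable_sigma_sets[OF sets_borel_zp])
    fix y :: "'p zp set" assume "y \<in> range (\<lambda>(n, r). zp_cyl n r)"
    then obtain n r where y: "y = zp_cyl n r" by auto
    show "zp_of_digits -` y \<inter> space D \<in> sets D"
    proof (cases "r \<in> {0..<?p ^ n}")
      case True
      obtain e where e: "\<forall>k<n. e k \<in> {0..<?p}"
        "zp_of_digits -` y \<inter> space D = {d \<in> space D. \<forall>k<n. d k = e k}"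
        using pre[OF True] y by blast
      have "P.emb UNIV {..<n} (PiE {..<n} (\<lambda>k. {e k})) \<in> sets D"
        unfolding D_def using e(1) by (intro sets_PiM_I) (auto simp: spU)
      then show ?thesis using e(2) emb[OF e(1)] by simp
    qed (simp add: y zp_cyl_empty)
  qed auto
  have cyl: "emeasure \<nu> (zp_cyl n r) = ennreal (1 / real CARD('p)) ^ n" if r: "r \<in> {0..<?p ^ n}" for n r
  proof -
    obtain e where e: "\<forall>k<n. e k \<in> {0..<?p}"
      "(zp_of_digits -` (zp_cyl n r :: 'p zp set) :: (nat \<Rightarrow> int) set) \<inter> space D = {d \<in> space D. \<forall>k<n. d k = e k}"
      using pre[OF r] by blast
    have "emeasure \<nu> (zp_cyl n r) = emeasure D (P.emb UNIV {..<n} (PiE {..<n} (\<lambda>k. {e k})))"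
      using mes e(2) by (simp add: \<nu>_def emeasure_distr borel_open open_zp_cyl emb[OF e(1)])
    also have "\<dots> = (\<Prod>k<n. emeasure U {e k})"
      unfolding D_def using e(1) by (intro P.emeasure_PiM_emb) (auto simp: spU)
    also have "\<dots> = (\<Prod>k<n. ennreal (1 / real CARD('p)))"
      using e(1) by (intro prod.cong) (auto simp: U_def emeasure_uniform_count_measure)
    finally show ?thesis by simp
  qed
  have pr: "prob_space \<nu>"
    unfolding \<nu>_def by (rule prob_space.prob_space_distr[OF _ mes]) (unfold D_def, rule P.prob_space_axioms)
  have "distr \<nu> borel (\<lambda>x. c + x) = \<nu>" for c
  proof (rule sym, rule zp_measure_eqI[OF _ _ pr])
    fix n r assume r: "r \<in> {0..<?p ^ n}"
    have "emeasure (distr \<nu> borel (\<lambda>x. c + x)) (zp_cyl n r) = emeasure \<nu> ((\<lambda>x. c + x) -` zp_cyl n r)"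
      using measurable_zp_add[of c] by (subst emeasure_distr) (auto simp: \<nu>_def borel_open open_zp_cyl)
    also have "\<dots> = emeasure \<nu> (zp_cyl n ((r - Rep_zp c n) mod ?p ^ n))"
      using r by (simp add: add_vimage_zp_cyl)
    also have "\<dots> = emeasure \<nu> (zp_cyl n r)" by (subst (1 2) cyl) (use r in auto)
    finally show "emeasure \<nu> (zp_cyl n r) = emeasure (distr \<nu> borel (\<lambda>x. c + x)) (zp_cyl n r)" ..
  qed (auto simp: \<nu>_def)
  then show ?thesis using pr by (intro exI[of _ \<nu>]) (simp add: \<nu>_def)
qed

text \<open>\<open>haar\<close> is a definite description, so its properties become available only
  after existence and uniqueness are combined.\<close>

lemma haar_props:
  "sets haar = sets (borel :: 'p::prime_card zp measure) \<and> prob_space (haar :: 'p zp measure) \<and>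
   (\<forall>c. distr haar borel (\<lambda>x. c + x) = (haar :: 'p zp measure))"
  unfolding haar_def
proof (rule theI')
  obtain \<mu> :: "'p zp measure" where m: "sets \<mu> = sets borel" "prob_space \<mu>" "\<And>c. distr \<mu> borel (\<lambda>x. c + x) = \<mu>"
    using haar_exists by blast
  have "\<nu> = \<mu>" if n: "sets \<nu> = sets borel \<and> prob_space \<nu> \<and> (\<forall>c. distr \<nu> borel (\<lambda>x. c + x) = \<nu>)" for \<nu>
    by (rule zp_measure_eqI) (use n m in \<open>auto simp: measure_zp_cyl\<close>)
  then show "\<exists>!\<mu> :: 'p zp measure. sets \<mu> = sets borel \<and> prob_space \<mu> \<and> (\<forall>c. distr \<mu> borel (\<lambda>x. c + x) = \<mu>)"
    using m by (intro ex1I[of _ \<mu>]) auto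
qed

lemma sets_haar [simp, measurable_cong]: "sets haar = sets (borel :: 'p::prime_card zp measure)"
  and prob_space_haar: "prob_space (haar :: 'p zp measure)"
  and distr_haar_add: "distr haar borel (\<lambda>x. c + x) = (haar :: 'p zp measure)"
  using haar_props[where 'p = 'p] by auto

lemma space_haar [simp]: "space haar = (UNIV :: 'p::prime_card zp set)"
  using sets_eq_imp_space_eq[OF sets_haar] by simp

lemma emeasure_haar_cyl:
  "r \<in> {0..<int CARD('p) ^ n} \<Longrightarrow> emeasure haar (zp_cyl n r :: 'p::prime_card zp set) = ennreal (1 / real CARD('p) ^ n)"
  by (rule measure_zp_cyl) (simp_all add: prob_space_haar distr_haar_add)

lemma zp_singleton_borel: "{x :: 'p::prime_card zp} \<in> sets borel"
proof -
  have "{x} = (\<Inter>n. zp_cyl n (Rep_zp x n))" by (auto simp: zp_cyl_def intro: zp_eqI)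
  also have "\<dots> \<in> sets borel" by (intro sets.countable_INT) (auto intro: borel_open open_zp_cyl)
  finally show ?thesis .
qed

text \<open>A point lies in cylinders of mass p^-n for every n. The absence of atoms makes the one
  exceptional value of a new diagonal entry negligible.\<close>

lemma emeasure_haar_singleton: "emeasure haar {x :: 'p::prime_card zp} = 0"
proof -
  have "emeasure haar {x} \<le> ennreal (1 / real CARD('p) ^ n)" for n
  proof -
    have "emeasure haar {x} \<le> emeasure haar (zp_cyl n (Rep_zp x n) :: 'p zp set)"
      by (intro emeasure_mono) (simp_all add: borel_open open_zp_cyl, simp add: zp_cyl_def)
    then show ?thesis
      using emeasure_haar_cyl[of "Rep_zp x n" n, where 'p = 'p] Rep_zp_nonneg[of x n] Rep_zp_less[of x n] by simp
  qed
  moreover have "(\<lambda>n. ennreal (1 / real CARD('p) ^ n)) \<longlonglongrightarrow> ennreal 0"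
  proof (rule tendsto_ennrealI)
    have "1 < real CARD('p)" using prime_gt_1_nat[OF prime_card[where 'a = 'p]] by simp
    then show "(\<lambda>n. 1 / real CARD('p) ^ n) \<longlonglongrightarrow> 0"
      using LIMSEQ_inverse_realpow_zero[of "real CARD('p)"] by (simp add: inverse_eq_divide power_one_over)
  qed
  ultimately have "emeasure haar {x} \<le> ennreal 0" by (intro LIMSEQ_le_const) auto
  then show ?thesis by simp
qed

section \<open>Kernels of symmetric matrices\<close>

text \<open>With the matrix as a function of two indices, all corners belong to the same
  \<open>m\<close> and differ only in \<open>n\<close>.\<close>

definition ker_fun :: "(nat \<Rightarrow> nat \<Rightarrow> 'p::prime_card zp) \<Rightarrow> nat \<Rightarrow> ('p qpzp Matrix.vec, 'p) paired_group" where
  "ker_fun m n = ker_paired (mat n n (\<lambda>(i, j). m i j))"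

definition qvec :: "nat \<Rightarrow> (nat \<Rightarrow> 'p::prime_card qp) \<Rightarrow> 'p qpzp Matrix.vec" where
  "qvec n V = Matrix.vec n (\<lambda>i. qpzp_of (V i))"

definition integral_qp :: "'p::prime_card qp \<Rightarrow> bool" where
  "integral_qp x \<longleftrightarrow> x \<in> range of_zp"

lemma integral_qpE: "integral_qp x \<Longrightarrow> (\<And>r. x = of_zp r \<Longrightarrow> thesis) \<Longrightarrow> thesis"
  by (auto simp: integral_qp_def)

lemma integral_of_zp [simp]: "integral_qp (of_zp x)"
  by (simp add: integral_qp_def)

lemma integral_qp_0_1 [simp]: "integral_qp (0 :: 'p::prime_card qp)" "integral_qp (1 :: 'p::prime_card qp)"
  using integral_of_zp[of "0 :: 'p zp"] integral_of_zp[of "1 :: 'p zp"] by simp_all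

lemma integral_qp_add [intro]: "integral_qp x \<Longrightarrow> integral_qp y \<Longrightarrow> integral_qp (x + y)"
  and integral_qp_diff [intro]: "integral_qp x \<Longrightarrow> integral_qp y \<Longrightarrow> integral_qp (x - y)"
  and integral_qp_mult [intro]: "integral_qp x \<Longrightarrow> integral_qp y \<Longrightarrow> integral_qp (x * y)"
  and integral_qp_uminus [intro]: "integral_qp x \<Longrightarrow> integral_qp (- x)"
  by (auto elim!: integral_qpE simp flip: of_zp_simps)

lemma integral_qp_sum [intro]: "(\<And>i. i \<in> A \<Longrightarrow> integral_qp (f i)) \<Longrightarrow> integral_qp (\<Sum>i\<in>A. f i)"
  by (induction A rule: infinite_finite_induct) auto

lemma integral_qp_sum_mult:
  assumes "\<And>i. i < n \<Longrightarrow> integral_qp (f i)" "\<And>i. i < n \<Longrightarrow> integral_qp (g i)"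
  shows "integral_qp (\<Sum>i<n. f i * g i)"
  using assms by (intro integral_qp_sum integral_qp_mult) simp_all

lemma qpzp_of_eq_iff_integral: "qpzp_of x = qpzp_of y \<longleftrightarrow> integral_qp (x - y)"
  by (simp add: integral_qp_def qpzp_of_eq_iff)

lemma qpzp_of_eq_0_iff_integral: "qpzp_of x = 0 \<longleftrightarrow> integral_qp x"
  by (simp add: integral_qp_def qpzp_of_eq_0_iff)

lemma qvec_index [simp]: "i < n \<Longrightarrow> vec_index (qvec n V) i = qpzp_of (V i)" "dim_vec (qvec n V) = n"
  by (simp_all add: qvec_def)

lemma qvec_carrier [simp]: "qvec n V \<in> carrier_vec n"
  by (simp add: qvec_def)

lemma qvec_lift: "v \<in> carrier_vec n \<Longrightarrow> qvec n (\<lambda>i. qp_lift (vec_index v i)) = v"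
  by (intro eq_vecI) auto

lemma qvec_eq_iff: "qvec n V = qvec n W \<longleftrightarrow> (\<forall>i<n. integral_qp (V i - W i))"
  by (auto simp: vec_eq_iff qpzp_of_eq_iff_integral)

lemma qvec_add: "qvec n V + qvec n W = qvec n (\<lambda>i. V i + W i)"
  by (intro eq_vecI) (auto simp: qpzp_of_add)

lemma qvec_zero: "0\<^sub>v n = qvec n (\<lambda>_. 0)"
  by (intro eq_vecI) auto

definition mv :: "(nat \<Rightarrow> nat \<Rightarrow> 'p::prime_card zp) \<Rightarrow> nat \<Rightarrow> (nat \<Rightarrow> 'p qp) \<Rightarrow> nat \<Rightarrow> 'p qp" where
  "mv m n V i = (\<Sum>j<n. of_zp (m i j) * V j)"

lemma mv_add: "mv m n (\<lambda>j. V j + W j) i = mv m n V i + mv m n W i"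
  by (simp add: mv_def distrib_left sum.distrib)

lemma mv_diff: "mv m n (\<lambda>j. V j - W j) i = mv m n V i - mv m n W i"
  by (simp add: mv_def right_diff_distrib sum_subtractf)

lemma mv_scale: "mv m n (\<lambda>j. c * V j) i = c * mv m n V i"
  by (simp add: mv_def sum_distrib_left mult.left_commute)

lemma mv_sum: "mv m n (\<lambda>j. \<Sum>k\<in>A. f k j) i = (\<Sum>k\<in>A. mv m n (f k) i)"
  by (simp add: mv_def sum_distrib_left) (rule sum.swap)

lemma mv_integral: "(\<And>i. i < n \<Longrightarrow> integral_qp (V i)) \<Longrightarrow> integral_qp (mv m n V i)"
  unfolding mv_def by (intro integral_qp_sum integral_qp_mult) auto

lemma mv_sym:
  assumes "\<And>i j. m i j = m j i"
  shows "(\<Sum>i<n. V i * mv m n W i) = (\<Sum>i<n. W i * mv m n V i)"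
proof -
  have "(\<Sum>i<n. V i * mv m n W i) = (\<Sum>i<n. \<Sum>j<n. W j * (of_zp (m i j) * V i))"
    unfolding mv_def sum_distrib_left by (intro sum.cong refl) (simp add: ac_simps)
  also have "\<dots> = (\<Sum>j<n. \<Sum>i<n. W j * (of_zp (m j i) * V i))"
    by (subst sum.swap) (simp add: assms[of _ "_ :: nat"] cong: sum.cong)
  finally show ?thesis by (simp add: mv_def sum_distrib_left)
qed

lemma qvec_in_ker_iff: "qvec n V \<in> carrier (ker_fun m n) \<longleftrightarrow> (\<forall>i<n. integral_qp (mv m n V i))"
proof -
  have "vec_index (zp_mat_vec (mat n n (\<lambda>(i, j). m i j)) (qvec n V)) i = qpzp_of (mv m n V i)"
    if "i < n" for i
    using that by (simp add: zp_mat_vec_def mv_def qpzp_of_sum qpzp_of_scale)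
  then show ?thesis
    by (auto simp: ker_fun_def ker_paired_def vec_eq_iff qpzp_of_eq_0_iff_integral zp_mat_vec_def)
qed

lemma ker_carrier_vec: "v \<in> carrier (ker_fun m n) \<Longrightarrow> v \<in> carrier_vec n"
  by (simp add: ker_fun_def ker_paired_def)

lemma ker_cases:
  assumes "v \<in> carrier (ker_fun m n)"
  obtains V where "v = qvec n V" "\<And>i. i < n \<Longrightarrow> integral_qp (mv m n V i)"
  using assms qvec_lift[OF ker_carrier_vec[OF assms]] qvec_in_ker_iff by metis

lemma ker_ops [simp]: "mult (ker_fun m n) = (+)" "one (ker_fun m n) = 0\<^sub>v n"
  by (simp_all add: ker_fun_def ker_paired_def)

text \<open>The lifts chosen by \<open>qp_lift\<close> differ from V and W by integral vectors,
  which changes the form by three sums. Symmetry moves the matrix of the second sum onto V; each sum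
  then multiplies an integral difference by an integral image.\<close>

lemma ker_pairing:
  assumes sym: "\<And>i j. m i j = m j i"
    and V: "\<And>i. i < n \<Longrightarrow> integral_qp (mv m n V i)" and W: "\<And>i. i < n \<Longrightarrow> integral_qp (mv m n W i)"
  shows "pairing (ker_fun m n) (qvec n V) (qvec n W) = qpzp_of (\<Sum>i<n. V i * mv m n W i)"
proof -
  define V' W' where "V' = (\<lambda>i. qp_lift (vec_index (qvec n V) i))" and "W' = (\<lambda>i. qp_lift (vec_index (qvec n W) i))"
  have dV: "integral_qp (V' i - V i)" and dW: "integral_qp (W' i - W i)" if "i < n" for i
    using that by (simp_all add: V'_def W'_def qpzp_of_eq_iff_integral[symmetric])
  have "pairing (ker_fun m n) (qvec n V) (qvec n W) = qpzp_of (\<Sum>i<n. V' i * mv m n W' i)"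
    by (simp add: ker_fun_def ker_paired_def V'_def W'_def mv_def sum_distrib_left mult.assoc)
  also have "(\<Sum>i<n. V' i * mv m n W' i) - (\<Sum>i<n. V i * mv m n W i)
      = (\<Sum>i<n. (V' i - V i) * mv m n W i) + (\<Sum>i<n. V i * mv m n (\<lambda>j. W' j - W j) i)
        + (\<Sum>i<n. (V' i - V i) * mv m n (\<lambda>j. W' j - W j) i)"
    by (simp add: mv_diff sum.distrib[symmetric] sum_subtractf[symmetric] algebra_simps)
  moreover have "(\<Sum>i<n. V i * mv m n (\<lambda>j. W' j - W j) i) = (\<Sum>i<n. (W' i - W i) * mv m n V i)"
    by (rule mv_sym[OF sym])
  moreover have "integral_qp (\<Sum>i<n. (V' i - V i) * mv m n W i)"
    "integral_qp (\<Sum>i<n. (W' i - W i) * mv m n V i)"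
    by (rule integral_qp_sum_mult[OF dV W] integral_qp_sum_mult[OF dW V]; assumption)+
  moreover have "integral_qp (\<Sum>i<n. (V' i - V i) * mv m n (\<lambda>j. W' j - W j) i)"
    by (rule integral_qp_sum_mult[OF dV mv_integral[OF dW]])
  ultimately show ?thesis by (simp add: qpzp_of_eq_iff_integral integral_qp_add)
qed

lemma ker_comm_group: "comm_group (ker_fun m n)"
proof (rule comm_groupI)
  fix x y assume x: "x \<in> carrier (ker_fun m n)" and y: "y \<in> carrier (ker_fun m n)"
  obtain V where V: "x = qvec n V" "\<And>i. i < n \<Longrightarrow> integral_qp (mv m n V i)" using ker_cases[OF x] by blast
  obtain W where W: "y = qvec n W" "\<And>i. i < n \<Longrightarrow> integral_qp (mv m n W i)" using ker_cases[OF y] by blast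
  show "x \<otimes>\<^bsub>ker_fun m n\<^esub> y \<in> carrier (ker_fun m n)"
    using V(2) W(2) by (auto simp: V(1) W(1) qvec_add qvec_in_ker_iff mv_add)
  show "x \<otimes>\<^bsub>ker_fun m n\<^esub> y = y \<otimes>\<^bsub>ker_fun m n\<^esub> x"
    by (simp add: V(1) W(1) qvec_add add.commute)
next
  show "\<one>\<^bsub>ker_fun m n\<^esub> \<in> carrier (ker_fun m n)"
    by (auto simp: qvec_zero qvec_in_ker_iff mv_def)
next
  fix x y z assume "x \<in> carrier (ker_fun m n)" "y \<in> carrier (ker_fun m n)" "z \<in> carrier (ker_fun m n)"
  then show "x \<otimes>\<^bsub>ker_fun m n\<^esub> y \<otimes>\<^bsub>ker_fun m n\<^esub> z = x \<otimes>\<^bsub>ker_fun m n\<^esub> (y \<otimes>\<^bsub>ker_fun m n\<^esub> z)"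
    by (simp add: ker_carrier_vec[of _ m n] assoc_add_vec[of _ n])
next
  fix x assume x: "x \<in> carrier (ker_fun m n)"
  then show "\<one>\<^bsub>ker_fun m n\<^esub> \<otimes>\<^bsub>ker_fun m n\<^esub> x = x" by (simp add: ker_carrier_vec)
  obtain V where V: "x = qvec n V" "\<And>i. i < n \<Longrightarrow> integral_qp (mv m n V i)" using ker_cases[OF x] by blast
  have "mv m n (\<lambda>i. - V i) i = - mv m n V i" for i by (simp add: mv_def sum_negf)
  then have "qvec n (\<lambda>i. - V i) \<in> carrier (ker_fun m n)"
    using V(2) by (auto simp: qvec_in_ker_iff)
  moreover have "qvec n (\<lambda>i. - V i) \<otimes>\<^bsub>ker_fun m n\<^esub> x = \<one>\<^bsub>ker_fun m n\<^esub>"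
    by (simp add: V(1) qvec_add qvec_zero)
  ultimately show "\<exists>y\<in>carrier (ker_fun m n). y \<otimes>\<^bsub>ker_fun m n\<^esub> x = \<one>\<^bsub>ker_fun m n\<^esub>" by blast
qed

lemma ker_nat_pow: "qvec n V [^]\<^bsub>ker_fun m n\<^esub> (k::nat) = qvec n (\<lambda>i. of_zp (of_nat k) * V i)"
proof (induction k)
  case 0
  then show ?case by (simp add: qvec_zero)
next
  case (Suc k)
  have "qvec n V [^]\<^bsub>ker_fun m n\<^esub> Suc k = qvec n (\<lambda>i. of_zp (of_nat k) * V i) + qvec n V"
    using Suc by simp
  then show ?case by (simp add: qvec_add of_zp_simps algebra_simps)
qed

lemma ker_symmetric_pairing:
  assumes sym: "\<And>i j. m i j = m j i"
  shows "symmetric_pairing (ker_fun m n)"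
  unfolding symmetric_pairing_def
proof (intro conjI ballI)
  fix x y assume x: "x \<in> carrier (ker_fun m n)" and y: "y \<in> carrier (ker_fun m n)"
  obtain V where V: "x = qvec n V" "\<And>i. i < n \<Longrightarrow> integral_qp (mv m n V i)" using ker_cases[OF x] by blast
  obtain W where W: "y = qvec n W" "\<And>i. i < n \<Longrightarrow> integral_qp (mv m n W i)" using ker_cases[OF y] by blast
  show "pairing (ker_fun m n) x y = pairing (ker_fun m n) y x"
    using ker_pairing[OF sym V(2) W(2)] ker_pairing[OF sym W(2) V(2)]
      mv_sym[OF sym, where V = V and W = W and n = n] by (simp only: V(1) W(1))
  fix z assume z: "z \<in> carrier (ker_fun m n)"
  obtain U where U: "z = qvec n U" "\<And>i. i < n \<Longrightarrow> integral_qp (mv m n U i)" using ker_cases[OF z] by blast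
  have "integral_qp (mv m n (\<lambda>i. V i + W i) i)" if "i < n" for i
    using V(2) W(2) that by (auto simp: mv_add)
  then show "pairing (ker_fun m n) (x \<otimes>\<^bsub>ker_fun m n\<^esub> y) z = pairing (ker_fun m n) x z + pairing (ker_fun m n) y z"
    using V(2) W(2) U(2)
    by (simp add: V(1) W(1) U(1) qvec_add ker_pairing[OF sym] qpzp_of_add[symmetric] sum.distrib distrib_right)
qed

section \<open>Non-singular matrices\<close>

text \<open>Injectivity on Z_p^n, a form that can be tested directly against elements of the kernel
  group and against null vectors of a larger corner.\<close>

definition nonsing :: "(nat \<Rightarrow> nat \<Rightarrow> 'p::prime_card zp) \<Rightarrow> nat \<Rightarrow> bool" where
  "nonsing m n \<longleftrightarrow> (\<forall>v. (\<forall>i<n. (\<Sum>j<n. m i j * v j) = 0) \<longrightarrow> (\<forall>i<n. v i = 0))"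

text \<open>The adjugate inverts the matrix up to its determinant, and the determinant divides a
  power of p. Multiplying the adjugate by the complementary factor \<open>u\<close> leaves that
  power as the only denominator.\<close>

lemma nonsing_integral_inverse:
  fixes m :: "nat \<Rightarrow> nat \<Rightarrow> 'p::prime_card zp"
  assumes "nonsing m n"
  shows "\<exists>b N. (\<forall>i k. i < n \<longrightarrow> k < n \<longrightarrow> (\<Sum>j<n. m i j * b j k) = (if i = k then pz ^ N else 0)) \<and>
    (\<forall>i k. i < n \<longrightarrow> k < n \<longrightarrow> (\<Sum>j<n. b i j * m j k) = (if i = k then pz ^ N else 0))"
proof -
  let ?A = "mat n n (\<lambda>(i, j). m i j)"
  have A: "?A \<in> carrier_mat n n" by simp
  have "det ?A \<noteq> 0"
  proof
    assume "det ?A = 0"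
    then obtain v where v: "v \<in> carrier_vec n" "v \<noteq> 0\<^sub>v n" "?A *\<^sub>v v = 0\<^sub>v n"
      using det_0_iff_vec_prod_zero[OF A] by blast
    have "(\<Sum>j<n. m i j * vec_index v j) = 0" if "i < n" for i
    proof -
      have "vec_index (?A *\<^sub>v v) i = 0" using v(3) that by simp
      then show ?thesis using that v(1) by (simp add: scalar_prod_def atLeast0LessThan)
    qed
    then have "\<forall>i<n. vec_index v i = 0" using assms unfolding nonsing_def by blast
    then have "v = 0\<^sub>v n" using v(1) by (intro eq_vecI) auto
    then show False using v(2) by simp
  qed
  then obtain N u where u: "det ?A * u = pz ^ N" using zp_dvd_pz_power by blast
  let ?B = "adj_mat ?A"
  have B: "?B \<in> carrier_mat n n" and AB: "?A * ?B = det ?A \<cdot>\<^sub>m 1\<^sub>m n" and BA: "?B * ?A = det ?A \<cdot>\<^sub>m 1\<^sub>m n"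
    using adj_mat[OF A] by auto
  show ?thesis
  proof (intro exI[of _ "\<lambda>i j. ?B $$ (i, j) * u"] exI[of _ N] conjI allI impI)
    fix i k assume i: "i < n" and k: "k < n"
    have "(?A * ?B) $$ (i, k) = (\<Sum>j<n. m i j * ?B $$ (j, k))"
      using i k B by (simp add: scalar_prod_def atLeast0LessThan)
    moreover have "(?A * ?B) $$ (i, k) = (if i = k then det ?A else 0)"
      using i k unfolding AB by simp
    ultimately have "(\<Sum>j<n. m i j * ?B $$ (j, k)) * u = (if i = k then det ?A else 0) * u" by simp
    then show "(\<Sum>j<n. m i j * (?B $$ (j, k) * u)) = (if i = k then pz ^ N else 0)"
      using u by (simp add: sum_distrib_right mult.assoc split: if_splits)
    have "(?B * ?A) $$ (i, k) = (\<Sum>j<n. ?B $$ (i, j) * m j k)"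
      using i k B by (simp add: scalar_prod_def atLeast0LessThan)
    moreover have "(?B * ?A) $$ (i, k) = (if i = k then det ?A else 0)"
      using i k unfolding BA by simp
    ultimately have "(\<Sum>j<n. ?B $$ (i, j) * m j k) * u = (if i = k then det ?A else 0) * u" by simp
    then show "(\<Sum>j<n. ?B $$ (i, j) * u * m j k) = (if i = k then pz ^ N else 0)"
      using u by (simp add: sum_distrib_right mult.assoc mult.commute[of u] split: if_splits)
  qed
qed

text \<open>\<open>C\<close> is A^-1 over Q_p. The exponent \<open>N\<close> of a common denominator
  is carried along because p^N then also annihilates the kernel.\<close>

definition qp_inverse :: "(nat \<Rightarrow> nat \<Rightarrow> 'p::prime_card zp) \<Rightarrow> nat \<Rightarrow> (nat \<Rightarrow> nat \<Rightarrow> 'p qp) \<Rightarrow> nat \<Rightarrow> bool" where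
  "qp_inverse m n C N \<longleftrightarrow>
     (\<forall>i<n. \<forall>k<n. mv m n (\<lambda>j. C j k) i = (if i = k then 1 else 0)) \<and>
     (\<forall>V. \<forall>i<n. (\<Sum>j<n. C i j * mv m n V j) = V i) \<and>
     (\<forall>i<n. \<forall>j<n. integral_qp (of_zp (pz ^ N) * C i j))"

lemma nonsing_qp_inverse:
  fixes m :: "nat \<Rightarrow> nat \<Rightarrow> 'p::prime_card zp"
  assumes "nonsing m n"
  shows "\<exists>C N. qp_inverse m n C N"
proof -
  obtain b N where b:
    "\<And>i k. i < n \<Longrightarrow> k < n \<Longrightarrow> (\<Sum>j<n. m i j * b j k) = (if i = k then pz ^ N else 0)"
    "\<And>i k. i < n \<Longrightarrow> k < n \<Longrightarrow> (\<Sum>j<n. b i j * m j k) = (if i = k then pz ^ N else 0)"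
    using nonsing_integral_inverse[OF assms] by blast
  let ?q = "of_zp (pz ^ N) :: 'p qp"
  have q: "?q \<noteq> 0" by simp
  define C where "C = (\<lambda>i j. of_zp (b i j) / ?q)"
  have qC: "?q * C i j = of_zp (b i j)" for i j using q by (simp add: C_def)
  have "mv m n (\<lambda>j. C j k) i = (if i = k then 1 else 0)" if "i < n" "k < n" for i k
  proof -
    have "?q * mv m n (\<lambda>j. C j k) i = of_zp (\<Sum>j<n. m i j * b j k)"
      unfolding mv_scale[symmetric] qC by (simp add: mv_def of_zp_sum of_zp_simps)
    also have "\<dots> = ?q * (if i = k then 1 else 0)" unfolding b(1)[OF that] by simp
    finally show ?thesis by (rule mult_left_cancel[OF q, THEN iffD1])
  qed
  moreover have "(\<Sum>j<n. C i j * mv m n V j) = V i" if i: "i < n" for V i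
  proof -
    have "?q * (\<Sum>j<n. C i j * mv m n V j) = (\<Sum>j<n. \<Sum>k<n. of_zp (b i j) * (of_zp (m j k) * V k))"
      by (simp only: sum_distrib_left mult.assoc[symmetric] qC mv_def)
    also have "\<dots> = (\<Sum>k<n. of_zp (\<Sum>j<n. b i j * m j k) * V k)"
      by (subst sum.swap) (simp add: of_zp_sum of_zp_simps sum_distrib_right mult.assoc)
    also have "\<dots> = (\<Sum>k<n. if k = i then ?q * V i else 0)"
      by (rule sum.cong) (simp_all add: b(2)[OF i])
    also have "\<dots> = ?q * V i" using i by simp
    finally show ?thesis by (rule mult_left_cancel[OF q, THEN iffD1])
  qed
  moreover have "integral_qp (?q * C i j)" for i j by (simp add: qC)
  ultimately have "qp_inverse m n C N" unfolding qp_inverse_def by blast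
  then show ?thesis by blast
qed

text \<open>V = C (A V) with A V integral, so the denominator of C bounds that of V.\<close>

lemma qp_inverse_torsion:
  assumes C: "qp_inverse m n C N" and V: "\<And>i. i < n \<Longrightarrow> integral_qp (mv m n V i)" and i: "i < n"
  shows "integral_qp (of_zp (pz ^ N) * V i)"
proof -
  have "V i = (\<Sum>j<n. C i j * mv m n V j)" using C i by (simp add: qp_inverse_def)
  then have "of_zp (pz ^ N) * V i = (\<Sum>j<n. of_zp (pz ^ N) * C i j * mv m n V j)"
    by (simp add: sum_distrib_left mult.assoc)
  moreover have "integral_qp (of_zp (pz ^ N) * C i j)" if "j < n" for j
    using C i that by (auto simp: qp_inverse_def)
  then have "integral_qp (\<Sum>j<n. of_zp (pz ^ N) * C i j * mv m n V j)"
    using V by (rule integral_qp_sum_mult)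
  ultimately show ?thesis by simp
qed

lemma finite_ker:
  assumes C: "qp_inverse m n C N" shows "finite (carrier (ker_fun m n))"
proof (rule finite_subset)
  let ?T = "{v :: 'a qpzp. zp_scale (pz ^ N) v = 0}"
  show "finite (Matrix.vec n ` PiE {..<n} (\<lambda>_. ?T))"
    by (intro finite_imageI finite_PiE finite_qpzp_torsion) simp
  show "carrier (ker_fun m n) \<subseteq> Matrix.vec n ` PiE {..<n} (\<lambda>_. ?T)"
  proof
    fix v assume v: "v \<in> carrier (ker_fun m n)"
    obtain V where V: "v = qvec n V" "\<And>i. i < n \<Longrightarrow> integral_qp (mv m n V i)" using ker_cases[OF v] by blast
    have "zp_scale (pz ^ N) (qpzp_of (V i)) = 0" if "i < n" for i
      using qp_inverse_torsion[OF C V(2) that] by (simp add: qpzp_of_scale[symmetric] qpzp_of_eq_0_iff_integral)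
    moreover have "v = Matrix.vec n (restrict (\<lambda>i. qpzp_of (V i)) {..<n})"
      by (rule eq_vecI) (auto simp: V(1))
    ultimately show "v \<in> Matrix.vec n ` PiE {..<n} (\<lambda>_. ?T)" by auto
  qed
qed

section \<open>Order and perfectness of the kernel\<close>

text \<open>Another prime q dividing the order would give, by Sylow's theorem with exponent 1, a
  subgroup of order q; the order of its elements divides both q and p^N.\<close>

lemma (in group) card_power_if_exponent:
  assumes fin: "finite (carrier G)" and p: "prime (p::nat)"
    and e: "\<And>x. x \<in> carrier G \<Longrightarrow> x [^] (p ^ N) = \<one>"
  shows "\<exists>k. card (carrier G) = p ^ k"
proof -
  have c0: "card (carrier G) \<noteq> 0" using card_0_eq[OF fin] one_closed by blast
  have nu: "\<not> is_unit p" using p not_prime_unit by blast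
  define k where "k = multiplicity p (card (carrier G))"
  define t where "t = card (carrier G) div p ^ k"
  have t: "card (carrier G) = p ^ k * t" "\<not> p dvd t"
    using dvd_mult_div_cancel[OF multiplicity_dvd[of p "card (carrier G)"]] multiplicity_decompose[OF c0 nu]
    unfolding k_def t_def by (simp, blast)
  have "t = 1"
  proof (rule ccontr)
    assume "t \<noteq> 1"
    then obtain q where q: "prime q" "q dvd t" using prime_factor_nat by blast
    then have "q \<noteq> p" using t(2) by auto
    have "q dvd order G" using t(1) q(2) unfolding order_def by (metis dvd_mult)
    then obtain s where s: "order G = q ^ 1 * s" unfolding dvd_def power_one_right by blast
    obtain H where H: "subgroup H G" "card H = q ^ 1"
      using sylow_thm[OF q(1) group_axioms s fin] by blast
    have "1 < card H" using H(2) q(1) prime_gt_1_nat by simp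
    then have "\<not> H \<subseteq> {\<one>}" using card_mono[of "{\<one>}" H] by auto
    then obtain x where x: "x \<in> H" "x \<noteq> \<one>" by blast
    have xG: "x \<in> carrier G" using subgroup.mem_carrier[OF H(1) x(1)] .
    interpret H: group "G\<lparr>carrier := H\<rparr>" using H(1) by (rule subgroup_imp_group)
    have "x [^]\<^bsub>G\<lparr>carrier := H\<rparr>\<^esub> order (G\<lparr>carrier := H\<rparr>) = \<one>"
      using H.pow_order_eq_1[of x] x(1) by simp
    then have "x [^] q = \<one>" using H(2) nat_pow_consistent[of x q H] by (simp add: order_def)
    then have "ord x dvd q" by (rule iffD1[OF pow_eq_id[OF xG]])
    moreover have "ord x dvd p ^ N" by (rule iffD1[OF pow_eq_id[OF xG] e[OF xG]])
    moreover have "coprime q (p ^ N)" using q(1) p \<open>q \<noteq> p\<close> by (simp add: primes_coprime)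
    ultimately have "ord x = 1" using coprime_common_divisor[of q "p ^ N" "ord x"] by simp
    then show False using x(2) ord_eq_1[OF xG] by simp
  qed
  then show ?thesis using t(1) by auto
qed

lemma ker_exponent:
  fixes m :: "nat \<Rightarrow> nat \<Rightarrow> 'p::prime_card zp"
  assumes C: "qp_inverse m n C N" and x: "x \<in> carrier (ker_fun m n)"
  shows "x [^]\<^bsub>ker_fun m n\<^esub> (CARD('p) ^ N) = \<one>\<^bsub>ker_fun m n\<^esub>"
proof -
  obtain V where V: "x = qvec n V" "\<And>i. i < n \<Longrightarrow> integral_qp (mv m n V i)" using ker_cases[OF x] by blast
  have "of_nat (CARD('p) ^ N) = (pz ^ N :: 'p zp)" by (simp add: pz_def)
  then show ?thesis
    using qp_inverse_torsion[OF C V(2)] by (simp add: V(1) ker_nat_pow qvec_zero qvec_eq_iff del: of_nat_power)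
qed

text \<open>A homomorphism is only assumed additive. Since p^N kills the kernel and hence all
  values, each p-adic scalar acts on both sides through the same natural number, which makes the
  homomorphism Z_p-linear.\<close>

lemma hom_ker_linear:
  fixes m :: "nat \<Rightarrow> nat \<Rightarrow> 'p::prime_card zp" and \<phi> :: "'p qpzp Matrix.vec \<Rightarrow> 'p qpzp"
  assumes C: "qp_inverse m n C N" and \<phi>: "\<phi> \<in> hom (ker_fun m n) add_group"
    and W: "\<And>j i. j \<in> J \<Longrightarrow> i < n \<Longrightarrow> integral_qp (mv m n (W j) i)"
  shows "\<phi> (qvec n (\<lambda>i. \<Sum>j\<in>J. of_zp (r j) * W j i)) = (\<Sum>j\<in>J. zp_scale (r j) (\<phi> (qvec n (W j))))"
proof -
  let ?K = "ker_fun m n"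
  interpret K: comm_group ?K by (rule ker_comm_group)
  have add: "\<phi> (x + y) = \<phi> x + \<phi> y" if "x \<in> carrier ?K" "y \<in> carrier ?K" for x y
    using hom_mult[OF \<phi> that] by (simp add: add_group_def)
  have zero: "\<phi> (0\<^sub>v n) = 0" using add[OF K.one_closed K.one_closed] by simp
  have pow: "\<phi> (x [^]\<^bsub>?K\<^esub> k) = zp_scale (of_nat k) (\<phi> x)" if "x \<in> carrier ?K" for x and k :: nat
    using that K.nat_pow_closed[OF that] add[OF K.nat_pow_closed[OF that] that]
    by (induction k) (simp_all add: zero add zp_scale_add_left add.commute)
  have scale: "\<phi> (qvec n (\<lambda>i. of_zp r * V i)) = zp_scale r (\<phi> (qvec n V))"
    if V: "\<And>i. i < n \<Longrightarrow> integral_qp (mv m n V i)" for r V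
  proof -
    have x: "qvec n V \<in> carrier ?K" using V by (simp add: qvec_in_ker_iff)
    define k where "k = nat (Rep_zp r N)"
    obtain y where y: "r = of_int (Rep_zp r N) + pz ^ N * y" using zp_approx by blast
    have "of_int (Rep_zp r N) = (of_nat k :: 'p zp)" using Rep_zp_nonneg[of r N] by (simp add: k_def of_nat_nat)
    then have r: "r - of_nat k = y * pz ^ N" using y by (simp add: algebra_simps)
    have "qvec n (\<lambda>i. of_zp r * V i) = qvec n V [^]\<^bsub>?K\<^esub> k"
      unfolding ker_nat_pow qvec_eq_iff left_diff_distrib[symmetric] of_zp_simps(5)[symmetric] r of_zp_simps(6) mult.assoc
      using qp_inverse_torsion[OF C V] by auto
    moreover have "zp_scale (pz ^ N) (\<phi> (qvec n V)) = 0"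
      using pow[OF x, of "CARD('p) ^ N"] ker_exponent[OF C x] zero by (simp add: pz_def)
    then have "zp_scale r (\<phi> (qvec n V)) = zp_scale (of_nat k) (\<phi> (qvec n V))"
      unfolding k_def by (rule zp_scale_Rep)
    ultimately show ?thesis using pow[OF x, of k] by simp
  qed
  have in_sum: "qvec n (\<lambda>i. \<Sum>j\<in>J. of_zp (r j) * W j i) \<in> carrier ?K"
    if "\<And>j i. j \<in> J \<Longrightarrow> i < n \<Longrightarrow> integral_qp (mv m n (W j) i)" for J
    unfolding qvec_in_ker_iff mv_sum mv_scale using that by (intro allI impI integral_qp_sum) auto
  show ?thesis using W
  proof (induction J rule: infinite_finite_induct)
    case (insert j J)
    have 1: "qvec n (\<lambda>i. of_zp (r j) * W j i) \<in> carrier ?K"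
      unfolding qvec_in_ker_iff mv_scale using insert.prems by auto
    have 2: "qvec n (\<lambda>i. \<Sum>j\<in>J. of_zp (r j) * W j i) \<in> carrier ?K" using insert.prems by (intro in_sum) auto
    have "\<phi> (qvec n (\<lambda>i. \<Sum>j\<in>insert j J. of_zp (r j) * W j i))
        = \<phi> (qvec n (\<lambda>i. of_zp (r j) * W j i) + qvec n (\<lambda>i. \<Sum>j\<in>J. of_zp (r j) * W j i))"
      using insert.hyps by (simp add: qvec_add)
    then show ?case using insert by (simp add: add[OF 1 2] scale)
  qed (simp_all add: zero flip: qvec_zero)
qed

text \<open>The columns of \<open>A\<^sup>-\<^sup>1\<close> lie in the kernel and pair with \<open>v\<close> to the coordinates of \<open>v\<close>, so they
  recover \<open>v\<close> from its pairings and represent every homomorphism.\<close>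

lemma ker_perfect_pairing:
  fixes m :: "nat \<Rightarrow> nat \<Rightarrow> 'p::prime_card zp"
  assumes sym: "\<And>i j. m i j = m j i" and C: "qp_inverse m n C N"
  shows "perfect_pairing (ker_fun m n)"
proof -
  let ?K = "ker_fun m n"
  let ?f = "\<lambda>x. restrict (pairing ?K x) (carrier ?K)"
  interpret K: comm_group ?K by (rule ker_comm_group)
  have sp: "symmetric_pairing ?K" using sym by (rule ker_symmetric_pairing)
  have inv: "mv m n (\<lambda>j. C j k) i = (if i = k then 1 else 0)" if "i < n" "k < n" for i k
    using C that by (simp add: qp_inverse_def)
  have cK: "integral_qp (mv m n (\<lambda>j. C j k) i)" if "i < n" "k < n" for i k
    using inv[OF that] by auto
  have pc: "pairing ?K (qvec n V) (qvec n (\<lambda>j. C j k)) = qpzp_of (V k)"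
    if V: "\<And>i. i < n \<Longrightarrow> integral_qp (mv m n V i)" and k: "k < n" for V k
  proof -
    have "(\<Sum>i<n. V i * mv m n (\<lambda>j. C j k) i) = (\<Sum>i<n. if i = k then V k else 0)"
      using k by (intro sum.cong) (auto simp: inv)
    then show ?thesis using ker_pairing[OF sym V cK[OF _ k]] k by simp
  qed
  have "inj_on ?f (carrier ?K)"
  proof (rule inj_onI)
    fix x y assume x: "x \<in> carrier ?K" and y: "y \<in> carrier ?K" and eq: "?f x = ?f y"
    obtain V where V: "x = qvec n V" "\<And>i. i < n \<Longrightarrow> integral_qp (mv m n V i)" using ker_cases[OF x] by blast
    obtain W where W: "y = qvec n W" "\<And>i. i < n \<Longrightarrow> integral_qp (mv m n W i)" using ker_cases[OF y] by blast
    have "qpzp_of (V k) = qpzp_of (W k)" if k: "k < n" for k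
    proof -
      have "qvec n (\<lambda>j. C j k) \<in> carrier ?K" using cK[OF _ k] by (simp add: qvec_in_ker_iff)
      then have "pairing ?K x (qvec n (\<lambda>j. C j k)) = pairing ?K y (qvec n (\<lambda>j. C j k))"
        using fun_cong[OF eq, of "qvec n (\<lambda>j. C j k)"] by simp
      then show ?thesis using pc[OF V(2) k] pc[OF W(2) k] by (simp add: V(1) W(1))
    qed
    then show "x = y" unfolding V(1) W(1) by (intro eq_vecI) auto
  qed
  moreover have "?f ` carrier ?K = hom ?K add_group \<inter> extensional (carrier ?K)"
  proof
    show "?f ` carrier ?K \<subseteq> hom ?K add_group \<inter> extensional (carrier ?K)"
    proof
      fix h assume "h \<in> ?f ` carrier ?K"
      then obtain x where x: "x \<in> carrier ?K" and h: "h = ?f x" by blast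
      have "pairing ?K x (y \<otimes>\<^bsub>?K\<^esub> z) = pairing ?K x y + pairing ?K x z"
        if "y \<in> carrier ?K" "z \<in> carrier ?K" for y z
        using sp x that K.m_closed[OF that] unfolding symmetric_pairing_def by metis
      then show "h \<in> hom ?K add_group \<inter> extensional (carrier ?K)"
        unfolding h using K.m_closed by (auto simp: hom_def add_group_def)
    qed
    show "hom ?K add_group \<inter> extensional (carrier ?K) \<subseteq> ?f ` carrier ?K"
    proof
      fix \<phi> :: "'p qpzp Matrix.vec \<Rightarrow> 'p qpzp"
      assume "\<phi> \<in> hom ?K add_group \<inter> extensional (carrier ?K)"
      then have \<phi>: "\<phi> \<in> hom ?K add_group" and ext: "\<phi> \<in> extensional (carrier ?K)" by auto
      define V where "V = (\<lambda>k. qp_lift (\<phi> (qvec n (\<lambda>j. C j k))))"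
      have lin: "\<phi> (qvec n (\<lambda>i. \<Sum>j<n. of_zp (r j) * C i j)) = (\<Sum>j<n. zp_scale (r j) (qpzp_of (V j)))" for r
        using hom_ker_linear[OF C \<phi>, of "{..<n}" "\<lambda>k j. C j k" r] cK by (simp add: V_def)
      have hz: "\<phi> (qvec n (\<lambda>_. 0)) = 0" using hom_ker_linear[OF C \<phi>, of "{}"] by simp
      \<comment> \<open>The i-th entry of A V is the value of \<open>\<phi>\<close> at the
        combination of the columns of A^-1 with coefficients from row i of A. By symmetry of A this
        combination is the i-th unit vector, which is zero modulo Z_p.\<close>
      have Vin: "integral_qp (mv m n V i)" if i: "i < n" for i
      proof -
        have "qpzp_of (mv m n V i) = \<phi> (qvec n (\<lambda>k. \<Sum>j<n. of_zp (m i j) * C k j))"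
          by (simp add: lin mv_def qpzp_of_sum qpzp_of_scale)
        also have "qvec n (\<lambda>k. \<Sum>j<n. of_zp (m i j) * C k j) = qvec n (\<lambda>_. 0)"
          unfolding qvec_eq_iff
        proof (intro allI impI)
          fix k assume k: "k < n"
          have "(\<Sum>j<n. C k j * mv m n (\<lambda>l. if l = i then 1 else 0) j) = (if k = i then 1 else 0)"
            using C k by (simp add: qp_inverse_def)
          moreover have "mv m n (\<lambda>l. if l = i then 1 else 0) j = of_zp (m i j)" for j
            using i sym[of i j] by (simp add: mv_def if_distrib[of "\<lambda>x. _ * x"] cong: if_cong)
          ultimately have "(\<Sum>j<n. of_zp (m i j) * C k j) = (if k = i then 1 else 0)"
            by (simp add: mult.commute)
          then show "integral_qp ((\<Sum>j<n. of_zp (m i j) * C k j) - 0)" by auto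
        qed
        finally show ?thesis by (simp add: hz qpzp_of_eq_0_iff_integral)
      qed
      \<comment> \<open>The vector A W is integral, and W = A^-1 (A W) exhibits \<open>w\<close> as
        an integral combination of the columns, where \<open>\<phi>\<close> is known by
        linearity.\<close>
      have "\<phi> w = pairing ?K (qvec n V) w" if w: "w \<in> carrier ?K" for w
      proof -
        obtain W where W: "w = qvec n W" "\<And>i. i < n \<Longrightarrow> integral_qp (mv m n W i)" using ker_cases[OF w] by blast
        have "\<forall>i. \<exists>r. i < n \<longrightarrow> mv m n W i = of_zp r" using W(2) by (auto simp: integral_qp_def)
        then obtain r where r: "\<And>i. i < n \<Longrightarrow> mv m n W i = of_zp (r i)" by metis
        have "pairing ?K (qvec n V) w = qpzp_of (\<Sum>i<n. V i * mv m n W i)"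
          unfolding W(1) by (rule ker_pairing[OF sym Vin W(2)])
        also have "\<dots> = (\<Sum>i<n. zp_scale (r i) (qpzp_of (V i)))"
          by (simp add: r qpzp_of_sum qpzp_of_scale[symmetric] mult.commute)
        also have "\<dots> = \<phi> (qvec n (\<lambda>i. \<Sum>j<n. of_zp (r j) * C i j))" by (rule lin[symmetric])
        also have "qvec n (\<lambda>i. \<Sum>j<n. of_zp (r j) * C i j) = w"
        proof -
          have "(\<Sum>j<n. of_zp (r j) * C i j) = W i" if "i < n" for i
          proof -
            have "(\<Sum>j<n. C i j * mv m n W j) = W i" using C that by (simp add: qp_inverse_def)
            then show ?thesis by (simp add: r mult.commute)
          qed
          then show ?thesis unfolding W(1) by (intro eq_vecI) auto
        qed
        finally show ?thesis ..
      qed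
      then have "\<phi> = ?f (qvec n V)"
        using ext by (auto simp: fun_eq_iff extensional_def restrict_def)
      moreover have "qvec n V \<in> carrier ?K" using Vin by (simp add: qvec_in_ker_iff)
      ultimately show "\<phi> \<in> ?f ` carrier ?K" by blast
    qed
  qed
  ultimately show ?thesis unfolding perfect_pairing_def bij_betw_def by blast
qed

lemma ker_perfect_symmetric_p_group:
  fixes m :: "nat \<Rightarrow> nat \<Rightarrow> 'p::prime_card zp"
  assumes sym: "\<And>i j. m i j = m j i" and ns: "nonsing m n"
  shows "perfect_symmetric_p_group (ker_fun m n)"
proof -
  obtain C N where C: "qp_inverse m n C N" using nonsing_qp_inverse[OF ns] by blast
  interpret K: comm_group "ker_fun m n" by (rule ker_comm_group)
  have "\<exists>k. card (carrier (ker_fun m n)) = CARD('p) ^ k"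
    using finite_ker[OF C] prime_card ker_exponent[OF C] by (rule K.card_power_if_exponent)
  then show ?thesis unfolding perfect_symmetric_p_group_def
    using K.comm_group_axioms finite_ker[OF C] ker_symmetric_pairing[of m n, OF sym] ker_perfect_pairing[OF sym C] by blast
qed

section \<open>Isomorphism classes\<close>

lemma paired_iso_refl: "paired_iso G G"
  unfolding paired_iso_def by (intro bexI[of _ "\<lambda>x. x"]) (auto simp: iso_set_refl)

lemma paired_iso_sym:
  assumes "group G" "paired_iso G H" shows "paired_iso H G"
proof -
  interpret group G by fact
  obtain f where f: "f \<in> iso G H" "\<And>x y. x \<in> carrier G \<Longrightarrow> y \<in> carrier G \<Longrightarrow> pairing H (f x) (f y) = pairing G x y"
    using assms(2) unfolding paired_iso_def by blast
  let ?g = "inv_into (carrier G) f"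
  have b: "f ` carrier G = carrier H" using f(1) by (simp add: iso_def bij_betw_def)
  have "?g x \<in> carrier G \<and> f (?g x) = x" if "x \<in> carrier H" for x
    using that b by (metis f_inv_into_f inv_into_into)
  then have "\<forall>x\<in>carrier H. \<forall>y\<in>carrier H. pairing G (?g x) (?g y) = pairing H x y"
    using f(2) by metis
  then show ?thesis unfolding paired_iso_def using iso_set_sym[OF f(1)] by blast
qed

lemma paired_iso_trans:
  assumes "paired_iso G H" "paired_iso H I" shows "paired_iso G I"
proof -
  obtain f where f: "f \<in> iso G H" "\<And>x y. x \<in> carrier G \<Longrightarrow> y \<in> carrier G \<Longrightarrow> pairing H (f x) (f y) = pairing G x y"
    using assms(1) unfolding paired_iso_def by blast
  obtain g where g: "g \<in> iso H I" "\<And>x y. x \<in> carrier H \<Longrightarrow> y \<in> carrier H \<Longrightarrow> pairing I (g x) (g y) = pairing H x y"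
    using assms(2) unfolding paired_iso_def by blast
  have fH: "f x \<in> carrier H" if "x \<in> carrier G" for x
    using f(1) that by (auto simp: iso_def hom_def)
  have "(g \<circ> f) \<in> iso G I" using f(1) g(1) by (rule iso_set_trans)
  moreover have "\<forall>x\<in>carrier G. \<forall>y\<in>carrier G. pairing I ((g \<circ> f) x) ((g \<circ> f) y) = pairing G x y"
    using f(2) g(2) fH by simp
  ultimately show ?thesis unfolding paired_iso_def by blast
qed

lemma iso_class_eqI:
  assumes "group G" "paired_iso G H" shows "iso_class G = iso_class H"
  unfolding iso_class_def
  using paired_iso_trans[OF assms(2)] paired_iso_trans[OF paired_iso_sym[OF assms]] by blast

text \<open>Because \<open>G\<close> is carried by natural numbers it belongs to its own class, so
  it can be recovered from the class.\<close>

lemma iso_class_eq_imp_paired_iso: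
  fixes G :: "(nat, 'p::prime_card) paired_group"
  assumes "iso_class K = iso_class G" "group G" shows "paired_iso K G"
proof -
  have "G \<in> iso_class G" using assms(2) paired_iso_refl by (simp add: iso_class_def)
  then show ?thesis using assms(1) by (auto simp: iso_class_def)
qed

text \<open>Extensional functions merely count each homomorphism once. Stated for arbitrary
  homomorphisms, perfectness is easily transported along an isomorphism.\<close>

lemma perfect_pairing_iff:
  assumes "group G" and sp: "symmetric_pairing G"
  shows "perfect_pairing G \<longleftrightarrow>
    (\<forall>x\<in>carrier G. \<forall>y\<in>carrier G. (\<forall>z\<in>carrier G. pairing G x z = pairing G y z) \<longrightarrow> x = y) \<and>
    (\<forall>\<phi>\<in>hom G add_group. \<exists>x\<in>carrier G. \<forall>z\<in>carrier G. \<phi> z = pairing G x z)" (is "_ \<longleftrightarrow> ?i \<and> ?s")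
proof -
  interpret group G by fact
  let ?f = "\<lambda>x. restrict (pairing G x) (carrier G)"
  have eq: "?f x = ?f y \<longleftrightarrow> (\<forall>z\<in>carrier G. pairing G x z = pairing G y z)" for x y
    by (auto simp: fun_eq_iff restrict_def)
  have hom: "?f x \<in> hom G add_group" if x: "x \<in> carrier G" for x
  proof -
    have "pairing G x (y \<otimes>\<^bsub>G\<^esub> z) = pairing G x y + pairing G x z" if "y \<in> carrier G" "z \<in> carrier G" for y z
      using sp x that m_closed[OF that] unfolding symmetric_pairing_def by metis
    then show ?thesis by (auto simp: hom_def add_group_def)
  qed
  have inj: "inj_on ?f (carrier G) \<longleftrightarrow> ?i" by (simp add: inj_on_def eq)
  have "(?f ` carrier G = hom G add_group \<inter> extensional (carrier G)) \<longleftrightarrow> ?s"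
  proof
    assume L: "?f ` carrier G = hom G add_group \<inter> extensional (carrier G)"
    show ?s
    proof
      fix \<phi> assume \<phi>: "\<phi> \<in> hom G (add_group :: 'b qpzp monoid)"
      then have "restrict \<phi> (carrier G) \<in> hom G add_group" by (auto simp: hom_def)
      then have "restrict \<phi> (carrier G) \<in> ?f ` carrier G" unfolding L by auto
      then obtain x where "x \<in> carrier G" "restrict \<phi> (carrier G) = ?f x" by blast
      then show "\<exists>x\<in>carrier G. \<forall>z\<in>carrier G. \<phi> z = pairing G x z"
        by (intro bexI[of _ x]) (auto simp: fun_eq_iff restrict_def split: if_splits)
    qed
  next
    assume R: ?s
    show "?f ` carrier G = hom G add_group \<inter> extensional (carrier G)"
    proof
      show "?f ` carrier G \<subseteq> hom G add_group \<inter> extensional (carrier G)" using hom by auto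
      show "hom G add_group \<inter> extensional (carrier G) \<subseteq> ?f ` carrier G"
      proof
        fix \<phi> :: "'a \<Rightarrow> 'b qpzp" assume \<phi>: "\<phi> \<in> hom G add_group \<inter> extensional (carrier G)"
        then obtain x where "x \<in> carrier G" "\<forall>z\<in>carrier G. \<phi> z = pairing G x z" using R by blast
        moreover have "\<phi> = ?f x" using calculation \<phi> by (auto simp: fun_eq_iff extensional_def)
        ultimately show "\<phi> \<in> ?f ` carrier G" by blast
      qed
    qed
  qed
  then show ?thesis unfolding perfect_pairing_def bij_betw_def inj by simp
qed

lemma perfect_symmetric_p_group_iso:
  assumes G: "perfect_symmetric_p_group G" and H: "comm_group H" and iso: "paired_iso G H"
  shows "perfect_symmetric_p_group H"
proof -
  interpret G: comm_group G using G by (simp add: perfect_symmetric_p_group_def)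
  interpret H: comm_group H by fact
  obtain f where f: "f \<in> iso G H" "\<And>x y. x \<in> carrier G \<Longrightarrow> y \<in> carrier G \<Longrightarrow> pairing H (f x) (f y) = pairing G x y"
    using iso unfolding paired_iso_def by blast
  have b: "bij_betw f (carrier G) (carrier H)" and fh: "f \<in> hom G H" using f(1) by (simp_all add: iso_def)
  have im: "carrier H = f ` carrier G" using b by (simp add: bij_betw_def)
  have mult: "f x \<otimes>\<^bsub>H\<^esub> f y = f (x \<otimes>\<^bsub>G\<^esub> y)" if "x \<in> carrier G" "y \<in> carrier G" for x y
    using hom_mult[OF fh that] by simp
  have spG: "symmetric_pairing G" using G by (simp add: perfect_symmetric_p_group_def)
  have spH: "symmetric_pairing H"
    unfolding symmetric_pairing_def im
  proof (intro conjI ballI; elim imageE; hypsubst)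
    fix x y assume x: "x \<in> carrier G" "y \<in> carrier G"
    show "pairing H (f x) (f y) = pairing H (f y) (f x)"
      using spG x unfolding symmetric_pairing_def f(2)[OF x] f(2)[OF x(2,1)] by blast
    fix z assume z: "z \<in> carrier G"
    show "pairing H (f x \<otimes>\<^bsub>H\<^esub> f y) (f z) = pairing H (f x) (f z) + pairing H (f y) (f z)"
      using spG x z G.m_closed[OF x]
      unfolding symmetric_pairing_def mult[OF x] f(2)[OF G.m_closed[OF x] z] f(2)[OF x(1) z] f(2)[OF x(2) z]
      by blast
  qed
  have pG: "perfect_pairing G" using G by (simp add: perfect_symmetric_p_group_def)
  have iG: "\<And>x y. x \<in> carrier G \<Longrightarrow> y \<in> carrier G \<Longrightarrow> (\<forall>z\<in>carrier G. pairing G x z = pairing G y z) \<Longrightarrow> x = y"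
    and sG: "\<And>\<phi>. \<phi> \<in> hom G add_group \<Longrightarrow> \<exists>x\<in>carrier G. \<forall>z\<in>carrier G. \<phi> z = pairing G x z"
    using pG unfolding perfect_pairing_iff[OF G.group_axioms spG] by blast+
  have "perfect_pairing H"
    unfolding perfect_pairing_iff[OF H.group_axioms spH]
  proof (intro conjI ballI impI)
    fix x' y' assume "x' \<in> carrier H" "y' \<in> carrier H" and e: "\<forall>z\<in>carrier H. pairing H x' z = pairing H y' z"
    then obtain x y where "x \<in> carrier G" "y \<in> carrier G" "x' = f x" "y' = f y" unfolding im by blast
    moreover have "\<forall>z\<in>carrier G. pairing G x z = pairing G y z"
      using e calculation f(2) unfolding im by force
    ultimately show "x' = y'" using iG by blast
  next
    fix \<phi> assume p: "\<phi> \<in> hom H (add_group :: 'b qpzp monoid)"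
    then have "\<phi> \<circ> f \<in> hom G add_group" using hom_compose[OF fh p] by simp
    then obtain x where x: "x \<in> carrier G" "\<forall>z\<in>carrier G. (\<phi> \<circ> f) z = pairing G x z" using sG by blast
    then have "\<forall>z\<in>carrier H. \<phi> z = pairing H (f x) z" unfolding im by (simp add: f(2))
    then show "\<exists>x\<in>carrier H. \<forall>z\<in>carrier H. \<phi> z = pairing H x z" using x(1) unfolding im by blast
  qed
  moreover have "finite (carrier H)" "card (carrier H) = card (carrier G)"
    using G b bij_betw_finite[OF b] bij_betw_same_card[OF b] by (simp_all add: perfect_symmetric_p_group_def)
  ultimately show ?thesis using G H spH by (simp add: perfect_symmetric_p_group_def)
qed

text \<open>The structure is copied to an initial segment of the natural numbers by an enumeration
  of the finite carrier.\<close>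

lemma iso_class_in_X_S:
  assumes G: "perfect_symmetric_p_group G" shows "iso_class G \<in> X_S"
proof -
  interpret G: comm_group G using G by (simp add: perfect_symmetric_p_group_def)
  obtain f :: "'a \<Rightarrow> nat" where f: "bij_betw f (carrier G) {0..<card (carrier G)}"
    using ex_bij_betw_finite_nat[of "carrier G"] G by (auto simp: perfect_symmetric_p_group_def)
  define g where "g = inv_into (carrier G) f"
  have gf: "g (f x) = x" if "x \<in> carrier G" for x
    using f that by (simp add: g_def bij_betw_def)
  define H :: "(nat, 'b) paired_group" where
    "H = \<lparr>carrier = f ` carrier G, mult = (\<lambda>x y. f (g x \<otimes>\<^bsub>G\<^esub> g y)), one = f \<one>\<^bsub>G\<^esub>,
          pairing = (\<lambda>x y. pairing G (g x) (g y))\<rparr>"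
  have "f \<in> iso G H"
    using f by (auto simp: iso_def hom_def H_def gf bij_betw_def)
  moreover have "monoid H" by (rule monoidI) (auto simp: H_def gf G.m_assoc)
  ultimately have H: "comm_group H" and "paired_iso G H"
    using G.iso_imp_comm_group[of H] unfolding is_iso_def paired_iso_def
    by (blast, intro bexI[of _ f]) (auto simp: H_def gf)
  then have "perfect_symmetric_p_group H" "iso_class G = iso_class H"
    using perfect_symmetric_p_group_iso[OF G H] iso_class_eqI[OF G.group_axioms] by blast+
  then show ?thesis unfolding X_S_def by blast
qed

lemma iso_class_in_X_SE:
  assumes "iso_class K \<in> X_S"
  obtains G :: "(nat, 'p::prime_card) paired_group"
  where "perfect_symmetric_p_group G" "paired_iso (K :: ('a, 'p) paired_group) G"
proof -
  obtain G :: "(nat, 'p) paired_group" where G: "perfect_symmetric_p_group G" "iso_class K = iso_class G"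
    using assms unfolding X_S_def by blast
  moreover have "group G" using G(1) by (simp add: perfect_symmetric_p_group_def comm_group_def)
  ultimately show thesis using that iso_class_eq_imp_paired_iso by blast
qed

section \<open>Non-singularity and the kernel\<close>

text \<open>If A v = 0, then v / p^k lies in the kernel for every k. A kernel of order p^M forces
  p^M v / p^k to be integral, so p^M v is divisible by all powers of p and vanishes.\<close>

lemma nonsing_if_iso_class:
  fixes m :: "nat \<Rightarrow> nat \<Rightarrow> 'p::prime_card zp"
  assumes "iso_class (ker_fun m n) \<in> X_S"
  shows "nonsing m n"
  unfolding nonsing_def
proof (intro allI impI)
  let ?K = "ker_fun m n"
  interpret K: comm_group ?K by (rule ker_comm_group)
  fix v j assume v: "\<forall>i<n. (\<Sum>j<n. m i j * v j) = 0" and j: "j < n"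
  obtain G :: "(nat, 'p) paired_group" where G: "perfect_symmetric_p_group G" "paired_iso ?K G"
    using iso_class_in_X_SE[OF assms] by blast
  obtain f where "bij_betw f (carrier ?K) (carrier G)" using G(2) by (auto simp: paired_iso_def iso_def)
  from bij_betw_same_card[OF this] obtain M where M: "card (carrier ?K) = CARD('p) ^ M"
    using G(1) by (auto simp: perfect_symmetric_p_group_def)
  have "pz ^ k dvd pz ^ M * v j" for k
  proof -
    let ?q = "of_zp (pz ^ k) :: 'p qp"
    define V where "V = (\<lambda>j. of_zp (v j) / ?q)"
    have q: "?q \<noteq> 0" by simp
    have "mv m n V i = 0" if "i < n" for i
    proof -
      have "?q * mv m n V i = of_zp (\<Sum>j<n. m i j * v j)"
        unfolding mv_scale[symmetric] using q by (simp add: V_def mv_def of_zp_sum of_zp_simps(6))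
      then show ?thesis using v that q by simp
    qed
    then have "qvec n V \<in> carrier ?K" by (simp add: qvec_in_ker_iff)
    then have "qvec n V [^]\<^bsub>?K\<^esub> (CARD('p) ^ M) = \<one>\<^bsub>?K\<^esub>"
      using K.pow_order_eq_1[of "qvec n V"] M by (simp add: order_def)
    then have "integral_qp (of_zp (pz ^ M) * V j)"
      using j by (simp add: ker_nat_pow qvec_zero qvec_eq_iff pz_def)
    then obtain s where "of_zp (pz ^ M) * V j = of_zp s" by (rule integral_qpE)
    then have "of_zp (pz ^ M) * of_zp (v j) = ?q * of_zp s"
      using q by (simp add: V_def field_simps)
    then have "pz ^ M * v j = pz ^ k * s" unfolding of_zp_simps(6)[symmetric] of_zp_eq_iff .
    then show ?thesis by simp
  qed
  then have "pz ^ M * v j = 0" by (rule zp_eq_0_if_divisible)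
  then show "v j = 0" by simp
qed

lemma iso_class_ker_in_X_S_iff:
  assumes "\<And>i j. m i j = m j i"
  shows "iso_class (ker_fun m n) \<in> X_S \<longleftrightarrow> nonsing m n"
  using nonsing_if_iso_class iso_class_in_X_S ker_perfect_symmetric_p_group[of m n, OF assms] by blast

text \<open>A kernel vector with last entry \<open>t \<noteq> 0\<close> forces \<open>c = b\<^sup>T A\<^sup>-\<^sup>1 b\<close>, stated here without
  denominators.\<close>

lemma singular_corner:
  fixes m :: "nat \<Rightarrow> nat \<Rightarrow> 'p::prime_card zp"
  assumes ns: "nonsing m n" and s: "\<not> nonsing m (Suc n)"
    and b: "\<And>i k. i < n \<Longrightarrow> k < n \<Longrightarrow> (\<Sum>j<n. b i j * m j k) = (if i = k then pz ^ N else 0)"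
  shows "pz ^ N * m n n = (\<Sum>j<n. m n j * (\<Sum>i<n. b j i * m i n))"
proof -
  obtain v where v: "\<And>i. i < Suc n \<Longrightarrow> (\<Sum>j<n. m i j * v j) + m i n * v n = 0" and nz: "\<exists>i<Suc n. v i \<noteq> 0"
    using s unfolding nonsing_def by auto
  have "v n \<noteq> 0"
  proof
    assume 0: "v n = 0"
    then have "\<forall>i<n. (\<Sum>j<n. m i j * v j) = 0" using v by simp
    then have "\<forall>i<n. v i = 0" using ns unfolding nonsing_def by blast
    then show False using nz 0 by (auto simp: less_Suc_eq)
  qed
  have pv: "pz ^ N * v k = - v n * (\<Sum>i<n. b k i * m i n)" if k: "k < n" for k
  proof -
    have "(\<Sum>i<n. b k i * (\<Sum>j<n. m i j * v j)) = (\<Sum>j<n. (\<Sum>i<n. b k i * m i j) * v j)"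
      unfolding sum_distrib_left sum_distrib_right by (subst sum.swap) (simp add: mult.assoc)
    also have "\<dots> = (\<Sum>j<n. if j = k then pz ^ N * v k else 0)"
      by (rule sum.cong) (simp_all add: b[OF k])
    also have "\<dots> = pz ^ N * v k" using k by simp
    finally have "pz ^ N * v k = (\<Sum>i<n. b k i * (\<Sum>j<n. m i j * v j))" ..
    also have "\<dots> = (\<Sum>i<n. b k i * (- (m i n * v n)))"
    proof (rule sum.cong[OF refl])
      fix i assume "i \<in> {..<n}"
      then have "(\<Sum>j<n. m i j * v j) = - (m i n * v n)" using v[of i] by (simp add: eq_neg_iff_add_eq_0)
      then show "b k i * (\<Sum>j<n. m i j * v j) = b k i * (- (m i n * v n))" by (rule arg_cong)
    qed
    also have "\<dots> = - v n * (\<Sum>i<n. b k i * m i n)"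
      by (simp add: sum_distrib_left sum_negf ac_simps)
    finally show ?thesis .
  qed
  have "0 = pz ^ N * ((\<Sum>j<n. m n j * v j) + m n n * v n)" using v by simp
  also have "\<dots> = (\<Sum>j<n. m n j * (pz ^ N * v j)) + pz ^ N * m n n * v n"
    by (simp add: distrib_left sum_distrib_left ac_simps)
  also have "(\<Sum>j<n. m n j * (pz ^ N * v j)) = - v n * (\<Sum>j<n. m n j * (\<Sum>i<n. b j i * m i n))"
    unfolding sum_distrib_left[of "- v n"]
    by (rule sum.cong) (simp_all add: pv mult.left_commute[of _ "v n"])
  finally have "v n * (pz ^ N * m n n) = v n * (\<Sum>j<n. m n j * (\<Sum>i<n. b j i * m i n))"
    by (simp add: ac_simps)
  then show ?thesis using \<open>v n \<noteq> 0\<close> by simp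
qed

text \<open>The formula of \<open>singular_corner\<close> determines the last diagonal entry from
  all the others, and one integral inverse of the common smaller corner serves both
  matrices.\<close>

lemma singular_corner_unique:
  fixes m m' :: "nat \<Rightarrow> nat \<Rightarrow> 'p::prime_card zp"
  assumes "nonsing m n" "\<not> nonsing m (Suc n)" "\<not> nonsing m' (Suc n)"
    and eq: "\<And>i j. (i, j) \<noteq> (n, n) \<Longrightarrow> m' i j = m i j"
  shows "m' n n = m n n"
proof -
  obtain b N where b: "\<And>i k. i < n \<Longrightarrow> k < n \<Longrightarrow> (\<Sum>j<n. b i j * m j k) = (if i = k then pz ^ N else 0)"
    using nonsing_integral_inverse[OF assms(1)] by blast
  have "(\<Sum>j<n. m' i j * v j) = (\<Sum>j<n. m i j * v j)" if "i < n" for i v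
    using that by (intro sum.cong) (auto simp: eq)
  then have "nonsing m' n" using assms(1) by (simp add: nonsing_def)
  moreover have "(\<Sum>j<n. b i j * m' j k) = (if i = k then pz ^ N else 0)" if "i < n" "k < n" for i k
    unfolding b[OF that, symmetric] by (intro sum.cong) (auto simp: eq)
  ultimately have "pz ^ N * m' n n = (\<Sum>j<n. m' n j * (\<Sum>i<n. b j i * m' i n))"
    using assms(3) by (intro singular_corner)
  also have "\<dots> = (\<Sum>j<n. m n j * (\<Sum>i<n. b j i * m i n))" by (intro sum.cong refl) (simp add: eq)
  also have "\<dots> = pz ^ N * m n n" using singular_corner[OF assms(1,2) b] ..
  finally show ?thesis by simp
qed

section \<open>Local constancy of the kernel\<close>

text \<open>Supplies the exponent from which the descent in \<open>ker_locally_constant\<close>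
  starts.\<close>

lemma common_denominator: "\<exists>k. \<forall>i<n::nat. integral_qp (of_zp (pz ^ k) * U i)"
proof (induction n)
  case (Suc n)
  then obtain k where k: "\<And>i. i < n \<Longrightarrow> integral_qp (of_zp (pz ^ k) * U i)" by blast
  obtain l y where l: "of_zp (pz ^ l) * U n = of_zp y" using qp_denominator by blast
  have "integral_qp (of_zp (pz ^ (k + l)) * U i)" if "i < Suc n" for i
  proof (cases "i = n")
    case True
    have "of_zp (pz ^ (k + l)) * U n = of_zp (pz ^ k) * (of_zp (pz ^ l) * U n)"
      by (simp add: power_add of_zp_simps(6))
    then show ?thesis using l True by (auto simp: integral_qp_mult)
  next
    case False
    have "of_zp (pz ^ (k + l)) * U i = of_zp (pz ^ l) * (of_zp (pz ^ k) * U i)"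
      by (simp add: power_add of_zp_simps(6))
    moreover have "integral_qp (of_zp (pz ^ k) * U i)" using k[of i] that False by simp
    ultimately show ?thesis by (simp only: integral_qp_mult integral_of_zp)
  qed
  then show ?case by blast
qed simp

text \<open>If \<open>p\<^sup>N\<close> kills the kernel of \<open>A\<close>, then \<open>L = 2 N + 1\<close> works: the perturbation vanishes on \<open>p\<^sup>N\<close>-torsion
  and does not change the pairing there, and the kernel of the perturbed matrix is again
  \<open>p\<^sup>N\<close>-torsion because \<open>U = p\<^sup>N V\<close> satisfies \<open>U = r + p T U\<close> with integral \<open>r\<close> and \<open>T\<close>.\<close>

lemma ker_locally_constant:
  fixes m :: "nat \<Rightarrow> nat \<Rightarrow> 'p::prime_card zp"
  assumes sym: "\<And>i j. m i j = m j i" and ns: "nonsing m n"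
  shows "\<exists>L. \<forall>m'. (\<forall>i j. m' i j = m' j i) \<longrightarrow> (\<forall>i<n. \<forall>j<n. Rep_zp (m' i j) L = Rep_zp (m i j) L) \<longrightarrow>
    iso_class (ker_fun m' n) = iso_class (ker_fun m n)"
proof -
  obtain C N where C: "qp_inverse m n C N" using nonsing_qp_inverse[OF ns] by blast
  let ?q = "of_zp pz :: 'p qp"
  have pw: "of_zp (pz ^ k) = ?q ^ k" for k by (rule of_zp_power)
  have C1: "(\<Sum>j<n. C i j * mv m n V j) = V i" if "i < n" for V i using C that by (simp add: qp_inverse_def)
  have C2: "integral_qp (?q ^ N * C i j)" if "i < n" "j < n" for i j using C that by (simp add: qp_inverse_def pw)
  have tors: "integral_qp (?q ^ N * V i)" if "\<And>i. i < n \<Longrightarrow> integral_qp (mv m n V i)" "i < n" for V i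
    using qp_inverse_torsion[OF C that] by (simp add: pw)
  have qpow: "integral_qp (?q ^ k)" for k unfolding pw[symmetric] by simp
  show ?thesis
  proof (intro exI[of _ "N + Suc N"] allI impI)
    fix m' :: "nat \<Rightarrow> nat \<Rightarrow> 'p zp"
    assume sym': "\<forall>i j. m' i j = m' j i" and cl: "\<forall>i<n. \<forall>j<n. Rep_zp (m' i j) (N + Suc N) = Rep_zp (m i j) (N + Suc N)"
    have sym': "\<And>i j. m' i j = m' j i" using sym' by blast
    have "\<forall>i j. \<exists>x. i < n \<longrightarrow> j < n \<longrightarrow> m' i j - m i j = pz ^ (N + Suc N) * x"
      using cl unfolding Rep_zp_eq_iff_dvd dvd_def by blast
    then obtain x where x: "\<And>i j. i < n \<Longrightarrow> j < n \<Longrightarrow> m' i j - m i j = pz ^ (N + Suc N) * x i j" by metis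
    \<comment> \<open>The factor p^(2N+1) of the perturbation is shared out: one p^N clears the
      vector, the other clears A^-1 or the second argument of the pairing, and the remaining p
      drives the descent below.\<close>
    have mv': "mv m' n V i = mv m n V i + ?q * ?q ^ N * mv x n (\<lambda>j. ?q ^ N * V j) i" if i: "i < n" for V i
    proof -
      have "of_zp (m' i j) * V j = of_zp (m i j) * V j + ?q * ?q ^ N * (of_zp (x i j) * (?q ^ N * V j))" if "j < n" for j
      proof -
        have "m' i j = m i j + pz ^ (N + Suc N) * x i j" using x[OF i that] by (simp add: algebra_simps)
        then have "of_zp (m' i j) = of_zp (m i j) + ?q ^ (N + Suc N) * of_zp (x i j)"
          by (simp only: of_zp_simps pw)
        then show ?thesis by (simp add: power_add algebra_simps)
      qed
      then show ?thesis by (simp add: mv_def sum.distrib sum_distrib_left)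
    qed
    have int_x: "integral_qp (?q * ?q ^ N * mv x n U i)" if "\<And>i. i < n \<Longrightarrow> integral_qp (U i)" for U i
      using mv_integral[OF that] qpow[of 1] qpow[of N] by (auto intro!: integral_qp_mult)
    have tors': "integral_qp (?q ^ N * V i)" if V: "\<And>i. i < n \<Longrightarrow> integral_qp (mv m' n V i)" and i: "i < n" for V i
    proof -
      define U where "U = (\<lambda>i. ?q ^ N * V i)"
      have step: "integral_qp (U i + ?q * (?q ^ N * (\<Sum>j<n. ?q ^ N * C i j * mv x n U j)))" if i: "i < n" for i
      proof -
        have "V i = (\<Sum>j<n. C i j * mv m n V j)" using C1[OF i] ..
        also have "\<dots> = (\<Sum>j<n. C i j * (mv m' n V j - ?q * ?q ^ N * mv x n U j))"
          by (rule sum.cong) (simp_all add: mv' U_def)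
        finally have "U i = ?q ^ N * (\<Sum>j<n. C i j * (mv m' n V j - ?q * ?q ^ N * mv x n U j))"
          by (simp add: U_def)
        also have "\<dots> = (\<Sum>j<n. ?q ^ N * C i j * mv m' n V j)
            - ?q * (?q ^ N * (\<Sum>j<n. ?q ^ N * C i j * mv x n U j))"
          by (simp add: sum_distrib_left right_diff_distrib sum_subtractf ac_simps)
        finally show ?thesis using integral_qp_sum_mult[OF C2[OF i] V] by simp
      qed
      obtain k where "\<forall>i<n. integral_qp (?q ^ k * U i)" using common_denominator[of n U] by (auto simp: pw)
      \<comment> \<open>Descent on the exponent in place of inverting 1 + p T: if p^(k+1) U is
        integral, the extra p in the relation for U makes p^k U integral.\<close>
      then have "\<forall>i<n. integral_qp (U i)"
      proof (induction k)
        case (Suc k)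
        have "integral_qp (?q ^ k * U i)" if i: "i < n" for i
        proof -
          have h: "integral_qp (?q ^ Suc k * mv x n U l)" for l
            unfolding mv_scale[symmetric] using Suc.prems by (intro mv_integral) blast
          have B: "integral_qp (?q ^ N * (\<Sum>j<n. ?q ^ N * C i j * (?q ^ Suc k * mv x n U j)))"
            by (rule integral_qp_mult[OF qpow integral_qp_sum_mult[OF C2[OF i] h]])
          have A: "integral_qp (?q ^ k * (U i + ?q * (?q ^ N * (\<Sum>j<n. ?q ^ N * C i j * mv x n U j))))"
            by (rule integral_qp_mult[OF qpow step[OF i]])
          have "?q ^ k * U i = ?q ^ k * (U i + ?q * (?q ^ N * (\<Sum>j<n. ?q ^ N * C i j * mv x n U j)))
              - ?q ^ N * (\<Sum>j<n. ?q ^ N * C i j * (?q ^ Suc k * mv x n U j))"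
            by (simp add: distrib_left sum_distrib_left ac_simps)
          then show ?thesis using integral_qp_diff[OF A B] by simp
        qed
        then show ?case using Suc.IH by blast
      qed simp
      then show ?thesis using i by (simp add: U_def)
    qed
    have iff: "(\<forall>i<n. integral_qp (mv m' n V i)) \<longleftrightarrow> (\<forall>i<n. integral_qp (mv m n V i))" for V
    proof
      assume V: "\<forall>i<n. integral_qp (mv m' n V i)"
      show "\<forall>i<n. integral_qp (mv m n V i)"
      proof (intro allI impI)
        fix i assume i: "i < n"
        have "mv m n V i = mv m' n V i - ?q * ?q ^ N * mv x n (\<lambda>j. ?q ^ N * V j) i" using mv'[OF i] by simp
        moreover have "integral_qp (?q * ?q ^ N * mv x n (\<lambda>j. ?q ^ N * V j) i)"
          using V by (intro int_x tors') auto
        ultimately show "integral_qp (mv m n V i)" using V i by (auto intro: integral_qp_diff)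
      qed
    next
      assume V: "\<forall>i<n. integral_qp (mv m n V i)"
      show "\<forall>i<n. integral_qp (mv m' n V i)"
      proof (intro allI impI)
        fix i assume i: "i < n"
        have "integral_qp (?q * ?q ^ N * mv x n (\<lambda>j. ?q ^ N * V j) i)"
          using V by (intro int_x tors) auto
        then show "integral_qp (mv m' n V i)" unfolding mv'[OF i] using V i by (auto intro: integral_qp_add)
      qed
    qed
    have sub: "v \<in> carrier (ker_fun m' n) \<longleftrightarrow> v \<in> carrier (ker_fun m n)" if "v \<in> carrier_vec n" for v
      using qvec_lift[OF that] iff qvec_in_ker_iff by metis
    have carr: "carrier (ker_fun m' n) = carrier (ker_fun m n)"
      using sub ker_carrier_vec[of _ m n] ker_carrier_vec[of _ m' n] by blast
    have pair: "pairing (ker_fun m' n) v w = pairing (ker_fun m n) v w"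
      if v: "v \<in> carrier (ker_fun m n)" and w: "w \<in> carrier (ker_fun m n)" for v w
    proof -
      obtain V where V: "v = qvec n V" "\<And>i. i < n \<Longrightarrow> integral_qp (mv m n V i)" using ker_cases[OF v] by blast
      obtain W where W: "w = qvec n W" "\<And>i. i < n \<Longrightarrow> integral_qp (mv m n W i)" using ker_cases[OF w] by blast
      have "integral_qp (?q * (\<Sum>i<n. (?q ^ N * V i) * mv x n (\<lambda>j. ?q ^ N * W j) i))"
      proof (rule integral_qp_mult)
        show "integral_qp (\<Sum>i<n. (?q ^ N * V i) * mv x n (\<lambda>j. ?q ^ N * W j) i)"
          by (rule integral_qp_sum_mult[OF tors[OF V(2)] mv_integral[OF tors[OF W(2)]]])
      qed simp
      also have "?q * (\<Sum>i<n. (?q ^ N * V i) * mv x n (\<lambda>j. ?q ^ N * W j) i)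
          = (\<Sum>i<n. V i * mv m' n W i) - (\<Sum>i<n. V i * mv m n W i)"
        by (simp add: mv' sum_distrib_left sum_subtractf[symmetric] algebra_simps)
      finally have "qpzp_of (\<Sum>i<n. V i * mv m' n W i) = qpzp_of (\<Sum>i<n. V i * mv m n W i)"
        by (simp add: qpzp_of_eq_iff_integral)
      moreover have "integral_qp (mv m' n V i)" "integral_qp (mv m' n W i)" if "i < n" for i
        using iff V(2) W(2) that by blast+
      ultimately show ?thesis
        unfolding V(1) W(1) using ker_pairing[of m n V W, OF sym V(2) W(2)] ker_pairing[of m' n V W, OF sym'] by simp
    qed
    have "paired_iso (ker_fun m' n) (ker_fun m n)"
      unfolding paired_iso_def
    \<comment> \<open>Both kernels have the same carrier and operations, and their pairings agree
      there, so the identity is the isometry.\<close>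
    proof (rule bexI[of _ "\<lambda>x. x"])
      show "(\<lambda>x. x) \<in> iso (ker_fun m' n) (ker_fun m n)"
        by (auto simp: iso_def hom_def carr bij_betw_def)
    qed (simp add: carr pair)
    then show "iso_class (ker_fun m' n) = iso_class (ker_fun m n)"
      using iso_class_eqI comm_group.axioms(2)[OF ker_comm_group] by blast
  qed
qed

section \<open>Adding a row and a column\<close>

lemma comm_group_add_group: "comm_group (add_group :: 'a::ab_group_add monoid)"
  by (rule comm_groupI) (auto simp: add_group_def algebra_simps intro: exI[of _ "- _"] add.left_inverse)

lemma group_add_group: "group (add_group :: 'a::ab_group_add monoid)"
  using comm_group_add_group by (rule comm_group.axioms(2))

lemma add_group_simps [simp]: "carrier add_group = UNIV" "mult add_group = (+)" "one add_group = 0"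
  by (simp_all add: add_group_def)

section \<open>The isometry for one fixed enlarged matrix\<close>

context
  fixes m :: "nat \<Rightarrow> nat \<Rightarrow> 'p::prime_card zp" and n :: nat
    and G :: "('a, 'p) paired_group" and F :: "'a \<Rightarrow> 'p qpzp Matrix.vec"
    and g :: 'a and \<gamma> :: "nat \<Rightarrow> 'p qp" and q :: "'p qp"
  assumes sym: "\<And>i j. m i j = m j i"
    and G: "perfect_symmetric_p_group G"
    and F: "F \<in> iso G (ker_fun m n)"
    and F_pairing: "\<And>x y. x \<in> carrier G \<Longrightarrow> y \<in> carrier G \<Longrightarrow> pairing (ker_fun m n) (F x) (F y) = pairing G x y"
    and g: "g \<in> carrier G" and F_g: "F g = qvec n \<gamma>"
    and mv_\<gamma>: "\<And>i. i < n \<Longrightarrow> mv m n \<gamma> i = of_zp (m i n)"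
    and q: "q = of_zp (m n n) - (\<Sum>i<n. of_zp (m n i) * \<gamma> i)"
begin

text \<open>Lifts are chosen separately for each element, so \<open>lft\<close> is additive only up
  to integral vectors; additivity holds for \<open>coord_vec\<close>, after reduction. In the
  hypotheses \<open>\<gamma>\<close> is A^-1 b and \<open>q\<close> is the Schur complement of A in
  the enlarged matrix.\<close>

private definition "lft h i = qp_lift (vec_index (F h) i)"

text \<open>In the coordinates \<open>(g, 1)\<^sup>\<bottom>/(g, 1) \<rightarrow> ker\<close>, the element \<open>(h, t)\<close> becomes \<open>(h - t A\<^sup>-\<^sup>1 b, t)\<close>, where
  \<open>b\<close> is the new column and \<open>g\<close> is the class of \<open>A\<^sup>-\<^sup>1 b\<close>.\<close>

private definition "coord x i = (if i < n then lft (fst x) i - snd x * \<gamma> i else snd x)"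

private definition "coord_vec x = qvec (Suc n) (coord x)"

private lemma G_comm: "comm_group G"
  using G by (simp add: perfect_symmetric_p_group_def)

private lemma G_group: "group G"
  using G_comm by (rule comm_group.axioms(2))

private lemma ker_group: "group (ker_fun m n')"
  using ker_comm_group by (rule comm_group.axioms(2))

private lemma F_closed: "h \<in> carrier G \<Longrightarrow> F h \<in> carrier (ker_fun m n)"
  using F by (auto simp: iso_def hom_def)

private lemma F_lft: "h \<in> carrier G \<Longrightarrow> F h = qvec n (lft h)"
  unfolding lft_def using qvec_lift[OF ker_carrier_vec[OF F_closed]] by simp

private lemma mv_lft:
  assumes "h \<in> carrier G" "i < n" shows "integral_qp (mv m n (lft h) i)"
  using F_closed[OF assms(1)] assms(2) unfolding F_lft[OF assms(1)] qvec_in_ker_iff by blast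

private lemma mv_\<gamma>_integral: "i < n \<Longrightarrow> integral_qp (mv m n \<gamma> i)"
  by (simp add: mv_\<gamma>)

private lemma G_pairing:
  assumes "h \<in> carrier G" "h' \<in> carrier G"
  shows "pairing G h h' = qpzp_of (\<Sum>i<n. lft h i * mv m n (lft h') i)"
  unfolding F_pairing[OF assms, symmetric] F_lft[OF assms(1)] F_lft[OF assms(2)]
  by (rule ker_pairing[of m, OF sym mv_lft[OF assms(1)] mv_lft[OF assms(2)]])

private lemma G_pairing_g:
  assumes "h \<in> carrier G"
  shows "pairing G g h = qpzp_of (\<Sum>i<n. lft h i * mv m n \<gamma> i)"
proof -
  have "pairing G g h = pairing (ker_fun m n) (qvec n \<gamma>) (qvec n (lft h))"
    using F_pairing[OF g assms] by (simp only: F_g F_lft[OF assms])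
  also have "\<dots> = qpzp_of (\<Sum>i<n. \<gamma> i * mv m n (lft h) i)"
    by (rule ker_pairing[of m, OF sym mv_\<gamma>_integral mv_lft[OF assms]])
  also have "(\<Sum>i<n. \<gamma> i * mv m n (lft h) i) = (\<Sum>i<n. lft h i * mv m n \<gamma> i)"
    by (rule mv_sym[of m, OF sym])
  finally show ?thesis .
qed

text \<open>A applied to -t A^-1 b cancels the contribution t b of the new column.\<close>

private lemma mv_coord_less:
  assumes "i < n" shows "mv m (Suc n) (coord (h, t)) i = mv m n (lft h) i"
proof -
  have "mv m (Suc n) (coord (h, t)) i = mv m n (\<lambda>j. lft h j - t * \<gamma> j) i + of_zp (m i n) * t"
    by (simp add: mv_def coord_def)
  also have "\<dots> = mv m n (lft h) i"
    by (simp add: mv_diff mv_scale mv_\<gamma>[OF assms])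
  finally show ?thesis .
qed

private lemma mv_coord_last:
  "mv m (Suc n) (coord (h, t)) n = (\<Sum>i<n. lft h i * mv m n \<gamma> i) + q * t"
proof -
  have "mv m (Suc n) (coord (h, t)) n = (\<Sum>j<n. of_zp (m n j) * (lft h j - t * \<gamma> j)) + of_zp (m n n) * t"
    by (simp add: mv_def coord_def)
  also have "\<dots> = (\<Sum>j<n. of_zp (m n j) * lft h j) + q * t"
    unfolding q by (simp add: right_diff_distrib left_diff_distrib sum_subtractf sum_distrib_left ac_simps)
  also have "(\<Sum>j<n. of_zp (m n j) * lft h j) = (\<Sum>i<n. lft h i * mv m n \<gamma> i)"
    by (rule sum.cong) (simp_all add: mv_\<gamma> sym[of n] mult.commute)
  finally show ?thesis .
qed

private lemma ext_pairing_g: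
  assumes "h \<in> carrier G"
  shows "ext_pairing G q (g, 1) (h, t) = qpzp_of (mv m (Suc n) (coord (h, t)) n)"
  by (simp add: ext_pairing_def G_pairing_g[OF assms] mv_coord_last qpzp_of_add)

text \<open>The first n kernel equations hold for every h in G, and the last one is orthogonality to
  (g, 1).\<close>

private lemma coord_in_ker_iff:
  assumes "h \<in> carrier G"
  shows "(h, t) \<in> ext_perp G g q \<longleftrightarrow> coord_vec (h, t) \<in> carrier (ker_fun m (Suc n))"
  using assms mv_lft[OF assms]
  by (auto simp: ext_perp_def ext_pairing_g qpzp_of_eq_0_iff_integral coord_vec_def qvec_in_ker_iff
      less_Suc_eq mv_coord_less)

private lemma ext_perp_carrier: "(h, t) \<in> ext_perp G g q \<Longrightarrow> h \<in> carrier G"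
  by (auto simp: ext_perp_def)

text \<open>Completing the square: the mixed terms t \<gamma>^T A h' cancel by symmetry, and the
  last coordinate contributes only q t t'.\<close>

private lemma ker_pairing_coord:
  assumes x: "(h, t) \<in> ext_perp G g q" and y: "(h', t') \<in> ext_perp G g q"
  shows "pairing (ker_fun m (Suc n)) (coord_vec (h, t)) (coord_vec (h', t')) = ext_pairing G q (h, t) (h', t')"
proof -
  have h: "h \<in> carrier G" "h' \<in> carrier G" using x y ext_perp_carrier by blast+
  have c: "integral_qp (mv m (Suc n) (coord (h, t)) i)" "integral_qp (mv m (Suc n) (coord (h', t')) i)" if "i < Suc n" for i
    using x y that unfolding coord_in_ker_iff[OF h(1)] coord_in_ker_iff[OF h(2)] coord_vec_def qvec_in_ker_iff by blast+
  have "(\<Sum>i<Suc n. coord (h, t) i * mv m (Suc n) (coord (h', t')) i)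
      = (\<Sum>i<n. (lft h i - t * \<gamma> i) * mv m n (lft h') i) + t * ((\<Sum>i<n. lft h' i * mv m n \<gamma> i) + q * t')"
    by (simp add: mv_coord_less mv_coord_last coord_def)
  also have "(\<Sum>i<n. (lft h i - t * \<gamma> i) * mv m n (lft h') i)
      = (\<Sum>i<n. lft h i * mv m n (lft h') i) - t * (\<Sum>i<n. \<gamma> i * mv m n (lft h') i)"
    by (simp add: left_diff_distrib sum_subtractf sum_distrib_left mult.assoc)
  also have "(\<Sum>i<n. \<gamma> i * mv m n (lft h') i) = (\<Sum>i<n. lft h' i * mv m n \<gamma> i)"
    by (rule mv_sym[of m, OF sym])
  finally have "(\<Sum>i<Suc n. coord (h, t) i * mv m (Suc n) (coord (h', t')) i)
      = (\<Sum>i<n. lft h i * mv m n (lft h') i) + q * t * t'"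
    by (simp add: algebra_simps)
  moreover have "pairing (ker_fun m (Suc n)) (qvec (Suc n) (coord (h, t))) (qvec (Suc n) (coord (h', t')))
      = qpzp_of (\<Sum>i<Suc n. coord (h, t) i * mv m (Suc n) (coord (h', t')) i)"
    by (rule ker_pairing[of m, OF sym c(1) c(2)])
  ultimately show ?thesis
    by (simp only: coord_vec_def ext_pairing_def G_pairing[OF h] qpzp_of_add fst_conv snd_conv)
qed

private lemma coord_vec_add:
  assumes "h \<in> carrier G" "h' \<in> carrier G"
  shows "coord_vec (h \<otimes>\<^bsub>G\<^esub> h', t + t') = coord_vec (h, t) + coord_vec (h', t')"
proof -
  interpret G: group G by (rule G_group)
  have "F (h \<otimes>\<^bsub>G\<^esub> h') = F h + F h'" using F assms by (auto simp: iso_def hom_def)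
  then have "qvec n (lft (h \<otimes>\<^bsub>G\<^esub> h')) = qvec n (\<lambda>i. lft h i + lft h' i)"
    using assms by (simp add: F_lft[symmetric] qvec_add[symmetric])
  then have "integral_qp (lft (h \<otimes>\<^bsub>G\<^esub> h') i - (lft h i + lft h' i))" if "i < n" for i
    using that by (simp add: qvec_eq_iff)
  then show ?thesis
    unfolding coord_vec_def qvec_add qvec_eq_iff
    by (auto simp: coord_def algebra_simps)
qed

private lemma F_pow_g: "F (g [^]\<^bsub>G\<^esub> (k::nat)) = qvec n (\<lambda>i. of_zp (of_nat k) * \<gamma> i)"
proof -
  interpret h: group_hom G "ker_fun m n" F
    using G_group ker_group F by (simp add: group_hom_def group_hom_axioms_def iso_def)
  show ?thesis using h.hom_nat_pow[OF g, of k] by (simp add: F_g ker_nat_pow)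
qed

text \<open>Multiplying the lift by a p-adic integer agrees with the action through residues in
  \<open>ext_span\<close>, because the order of G annihilates the class of
  \<open>\<gamma>\<close>.\<close>

private lemma multiple_of_\<gamma>:
  defines "M \<equiv> multiplicity CARD('p) (card (carrier G))"
  shows "qvec n (\<lambda>i. of_zp r * \<gamma> i) = F (g [^]\<^bsub>G\<^esub> nat (Rep_zp r M))"
proof -
  interpret G: group G by (rule G_group)
  obtain l where l: "card (carrier G) = CARD('p) ^ l" using G by (auto simp: perfect_symmetric_p_group_def)
  have M: "M = l" unfolding M_def l using prime_card[where 'a = 'p] by simp
  have "g [^]\<^bsub>G\<^esub> (CARD('p) ^ l) = \<one>\<^bsub>G\<^esub>" using G.pow_order_eq_1[OF g] l by (simp add: order_def)
  then have "F \<one>\<^bsub>G\<^esub> = qvec n (\<lambda>i. of_zp (pz ^ l) * \<gamma> i)" using F_pow_g[of "CARD('p) ^ l"] by (simp add: pz_def)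
  moreover have "F \<one>\<^bsub>G\<^esub> = qvec n (\<lambda>_. 0)" using F_pow_g[of 0] by simp
  ultimately have "qvec n (\<lambda>i. of_zp (pz ^ l) * \<gamma> i) = qvec n (\<lambda>_. 0)" by simp
  then have tors: "integral_qp (of_zp (pz ^ l) * \<gamma> i)" if "i < n" for i
    using that by (simp add: qvec_eq_iff)
  obtain y where y: "r = of_int (Rep_zp r l) + pz ^ l * y" using zp_approx by blast
  have "of_int (Rep_zp r l) = (of_nat (nat (Rep_zp r l)) :: 'p zp)" using Rep_zp_nonneg[of r l] by (simp add: of_nat_nat)
  then have r: "r - of_nat (nat (Rep_zp r l)) = y * pz ^ l" using y by (simp add: algebra_simps)
  have "integral_qp (of_zp r * \<gamma> i - of_zp (of_nat (nat (Rep_zp r l))) * \<gamma> i)" if "i < n" for i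
    unfolding left_diff_distrib[symmetric] of_zp_simps(5)[symmetric] r of_zp_simps(6) mult.assoc
    using tors[OF that] by (rule integral_qp_mult[OF integral_of_zp])
  then show ?thesis unfolding M F_pow_g qvec_eq_iff by blast
qed

text \<open>The coordinates are integral exactly when t is a p-adic integer and h is the class of t
  \<gamma>, that is, when (h, t) is t times (g, 1).\<close>

private lemma coord_vec_0_iff:
  "(h, t) \<in> ext_perp G g q \<and> coord_vec (h, t) = 0\<^sub>v (Suc n) \<longleftrightarrow> (h, t) \<in> ext_span G g"
proof
  assume L: "(h, t) \<in> ext_perp G g q \<and> coord_vec (h, t) = 0\<^sub>v (Suc n)"
  then have h: "h \<in> carrier G" using ext_perp_carrier by blast
  have W: "integral_qp (coord (h, t) i)" if "i < Suc n" for i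
    using L that by (simp add: coord_vec_def qvec_zero qvec_eq_iff)
  obtain r where r: "t = of_zp r" using W[of n] by (auto simp: coord_def elim: integral_qpE)
  have "integral_qp (lft h i - of_zp r * \<gamma> i)" if "i < n" for i
    using W[of i] that by (simp add: coord_def r)
  then have "F h = qvec n (\<lambda>i. of_zp r * \<gamma> i)" unfolding F_lft[OF h] qvec_eq_iff by blast
  then have "F h = F (g [^]\<^bsub>G\<^esub> nat (Rep_zp r (multiplicity CARD('p) (card (carrier G)))))"
    unfolding multiple_of_\<gamma> .
  moreover interpret G: group G by (rule G_group)
  have "inj_on F (carrier G)" using F by (simp add: iso_def bij_betw_def)
  ultimately have "h = g [^]\<^bsub>G\<^esub> nat (Rep_zp r (multiplicity CARD('p) (card (carrier G))))"
    using h g by (simp add: inj_on_eq_iff)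
  then have "h = g [^]\<^bsub>G\<^esub> Rep_zp r (multiplicity CARD('p) (card (carrier G)))"
    using Rep_zp_nonneg[of r "multiplicity CARD('p) (card (carrier G))"] by (metis int_pow_int nat_0_le)
  then show "(h, t) \<in> ext_span G g" unfolding ext_span_def r by blast
next
  interpret G: group G by (rule G_group)
  assume "(h, t) \<in> ext_span G g"
  then obtain r where t: "t = of_zp r"
    and h': "h = g [^]\<^bsub>G\<^esub> Rep_zp r (multiplicity CARD('p) (card (carrier G)))"
    by (auto simp: ext_span_def)
  have h2: "h = g [^]\<^bsub>G\<^esub> nat (Rep_zp r (multiplicity CARD('p) (card (carrier G))))"
    unfolding h' using Rep_zp_nonneg[of r "multiplicity CARD('p) (card (carrier G))"]
    by (metis int_pow_int nat_0_le)
  then have h: "h \<in> carrier G" using g by simp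
  have "qvec n (lft h) = qvec n (\<lambda>i. of_zp r * \<gamma> i)"
    unfolding multiple_of_\<gamma> h2[symmetric] by (rule F_lft[OF h, symmetric])
  then have "integral_qp (coord (h, t) i)" for i
    by (auto simp: coord_def t qvec_eq_iff)
  then have "coord_vec (h, t) = 0\<^sub>v (Suc n)"
    by (simp add: coord_vec_def qvec_zero qvec_eq_iff)
  moreover have "0\<^sub>v (Suc n) \<in> carrier (ker_fun m (Suc n))"
    using monoid.one_closed[OF group.is_monoid[OF ker_group]] by simp
  ultimately show "(h, t) \<in> ext_perp G g q \<and> coord_vec (h, t) = 0\<^sub>v (Suc n)"
    by (simp add: coord_in_ker_iff[OF h])
qed

section \<open>The quotient through the first isomorphism theorem\<close>

private definition "E = (G \<times>\<times> add_group)\<lparr>carrier := ext_perp G g q\<rparr>"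

private lemma group_E: "group E"
proof -
  interpret P: group "G \<times>\<times> (add_group :: 'p qp monoid)" using G_group group_add_group by (rule DirProd_group)
  interpret G: group G by (rule G_group)
  have sp: "symmetric_pairing G" using G by (simp add: perfect_symmetric_p_group_def)
  have "pairing G g (x \<otimes>\<^bsub>G\<^esub> y) = pairing G g x + pairing G g y" if "x \<in> carrier G" "y \<in> carrier G" for x y
    using sp g that G.m_closed[OF that] unfolding symmetric_pairing_def by metis
  then have "ext_pairing G q (g, 1) \<in> hom (G \<times>\<times> add_group) add_group"
    by (auto simp: hom_def ext_pairing_def qpzp_of_add distrib_left)
  then interpret h: group_hom "G \<times>\<times> add_group" add_group "ext_pairing G q (g, 1)"
    using P.group_axioms group_add_group by (simp add: group_hom_def group_hom_axioms_def)
  have "ext_perp G g q = kernel (G \<times>\<times> add_group) add_group (ext_pairing G q (g, 1))"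
    by (simp add: ext_perp_def kernel_def)
  then show ?thesis unfolding E_def using P.subgroup_imp_group[OF h.subgroup_kernel] by simp
qed

private lemma coord_vec_group_hom: "group_hom E (ker_fun m (Suc n)) coord_vec"
proof -
  have "coord_vec \<in> hom E (ker_fun m (Suc n))"
    unfolding hom_def
  proof (intro CollectI conjI funcsetI ballI)
    fix x assume "x \<in> carrier E"
    then show "coord_vec x \<in> carrier (ker_fun m (Suc n))"
      using coord_in_ker_iff ext_perp_carrier by (cases x) (auto simp: E_def)
    fix y assume "y \<in> carrier E"
    with \<open>x \<in> carrier E\<close> show "coord_vec (x \<otimes>\<^bsub>E\<^esub> y) = coord_vec x \<otimes>\<^bsub>ker_fun m (Suc n)\<^esub> coord_vec y"
      using ext_perp_carrier by (cases x; cases y) (auto simp: E_def coord_vec_add)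
  qed
  then show ?thesis using group_E ker_group by (simp add: group_hom_def group_hom_axioms_def)
qed

private lemma kernel_coord_vec: "kernel E (ker_fun m (Suc n)) coord_vec = ext_span G g"
proof -
  have "x \<in> kernel E (ker_fun m (Suc n)) coord_vec \<longleftrightarrow> x \<in> ext_span G g" for x
    using coord_vec_0_iff[of "fst x" "snd x"] by (simp add: kernel_def E_def)
  then show ?thesis by blast
qed

private lemma coord_vec_surj: "coord_vec ` carrier E = carrier (ker_fun m (Suc n))"
proof
  show "coord_vec ` carrier E \<subseteq> carrier (ker_fun m (Suc n))"
    using coord_vec_group_hom by (auto simp: group_hom_def group_hom_axioms_def hom_def)
  show "carrier (ker_fun m (Suc n)) \<subseteq> coord_vec ` carrier E"
  proof
    fix v assume v: "v \<in> carrier (ker_fun m (Suc n))"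
    obtain V where V: "v = qvec (Suc n) V" "\<And>i. i < Suc n \<Longrightarrow> integral_qp (mv m (Suc n) V i)"
      using ker_cases[OF v] by blast
    \<comment> \<open>The inverse change of coordinates: adding back the multiple of A^-1 b turns
      the first n entries into an element of the old kernel.\<close>
    define U where "U = (\<lambda>i. V i + V n * \<gamma> i)"
    have "mv m n U i = mv m (Suc n) V i" if "i < n" for i
      unfolding U_def mv_add mv_scale mv_\<gamma>[OF that] by (simp add: mv_def mult.commute)
    then have "qvec n U \<in> carrier (ker_fun m n)" using V(2) by (simp add: qvec_in_ker_iff)
    moreover have "F ` carrier G = carrier (ker_fun m n)" using F by (simp add: iso_def bij_betw_def)
    ultimately obtain h where h: "h \<in> carrier G" "F h = qvec n U" by (metis imageE)
    have "integral_qp (lft h i - U i)" if "i < n" for i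
      using h F_lft[OF h(1)] that by (simp add: qvec_eq_iff)
    then have c: "coord_vec (h, V n) = v"
      unfolding V(1) coord_vec_def qvec_eq_iff by (auto simp: coord_def U_def less_Suc_eq algebra_simps)
    then have "(h, V n) \<in> carrier E" using v by (simp add: E_def coord_in_ker_iff[OF h(1)])
    then show "v \<in> coord_vec ` carrier E" using c by blast
  qed
qed

text \<open>\<open>coord_vec\<close> is constant on cosets of its kernel and preserves the pairing,
  so the image collected by \<open>the_elem\<close> in \<open>delta_quotient\<close> is a singleton,
  and the isomorphism induced on the quotient is an isometry.\<close>

lemma paired_iso_delta_quotient: "paired_iso (delta_quotient G g q) (ker_fun m (Suc n))"
proof -
  let ?K = "ker_fun m (Suc n)" and ?D = "delta_quotient G g q"
  let ?Q = "E Mod kernel E ?K coord_vec" and ?f = "\<lambda>X. the_elem (coord_vec ` X)"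
  interpret h: group_hom E ?K coord_vec by (rule coord_vec_group_hom)
  have D: "carrier ?D = carrier ?Q" "mult ?D = mult ?Q"
    unfolding kernel_coord_vec by (simp_all add: delta_quotient_def Let_def E_def)
  have "?f \<in> iso ?Q ?K" by (rule h.FactGroup_iso_set[OF coord_vec_surj])
  then have "?f \<in> iso ?D ?K" by (simp add: iso_def hom_def D)
  moreover have "pairing ?K (?f A) (?f B) = pairing ?D A B" if A: "A \<in> carrier ?D" and B: "B \<in> carrier ?D" for A B
  proof -
    have coset: "\<exists>v. A \<noteq> {} \<and> (\<forall>a\<in>A. a \<in> ext_perp G g q \<and> coord_vec a = v)" if A: "A \<in> carrier ?D" for A
    proof -
      have "A \<in> (\<Union>a\<in>carrier E. {kernel E ?K coord_vec #>\<^bsub>E\<^esub> a})"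
        using A by (simp only: D FactGroup_def RCOSETS_def partial_object.simps)
      then obtain x where x: "x \<in> carrier E" "A = kernel E ?K coord_vec #>\<^bsub>E\<^esub> x" by (elim UN_E singletonE)
      have cE: "carrier E = ext_perp G g q" by (simp add: E_def)
      have "a \<in> ext_perp G g q \<and> coord_vec a = coord_vec x" if "a \<in> A" for a
      proof -
        obtain k where k: "k \<in> kernel E ?K coord_vec" "a = k \<otimes>\<^bsub>E\<^esub> x" using \<open>a \<in> A\<close> x(2) by (auto simp: r_coset_def)
        then have "k \<in> carrier E" "coord_vec k = \<one>\<^bsub>?K\<^esub>" by (simp_all add: kernel_def)
        then show ?thesis
          using k(2) x(1) h.hom_mult[of k x] h.hom_closed[OF x(1)] h.H.l_one h.G.m_closed cE by metis
      qed
      moreover have "x \<in> A" unfolding x(2) by (rule h.G.rcos_self[OF x(1) h.subgroup_kernel])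
      ultimately show ?thesis by (intro exI[of _ "coord_vec x"]) blast
    qed
    obtain v where v: "A \<noteq> {}" "\<And>a. a \<in> A \<Longrightarrow> a \<in> ext_perp G g q" "\<And>a. a \<in> A \<Longrightarrow> coord_vec a = v"
      using coset[OF A] by blast
    obtain w where w: "B \<noteq> {}" "\<And>a. a \<in> B \<Longrightarrow> a \<in> ext_perp G g q" "\<And>a. a \<in> B \<Longrightarrow> coord_vec a = w"
      using coset[OF B] by blast
    have fA: "coord_vec ` A = {v}" "coord_vec ` B = {w}"
      using v(1,3) w(1,3) by (simp_all add: image_constant_conv cong: image_cong)
    have c: "case_prod (ext_pairing G q) (a, b) = pairing ?K v w" if "a \<in> A" "b \<in> B" for a b
    proof -
      have "pairing ?K (coord_vec a) (coord_vec b) = ext_pairing G q a b"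
        using ker_pairing_coord[of "fst a" "snd a" "fst b" "snd b"] v(2)[OF that(1)] w(2)[OF that(2)]
        by (simp only: prod.collapse)
      then show ?thesis by (simp only: v(3)[OF that(1)] w(3)[OF that(2)] case_prod_conv)
    qed
    have "case_prod (ext_pairing G q) ` (A \<times> B) = {pairing ?K v w}"
    proof (rule equalityI; rule subsetI)
      fix z assume "z \<in> case_prod (ext_pairing G q) ` (A \<times> B)"
      then obtain a b where "a \<in> A" "b \<in> B" "z = case_prod (ext_pairing G q) (a, b)" by blast
      then show "z \<in> {pairing ?K v w}" using c by simp
    next
      fix z assume "z \<in> {pairing ?K v w}"
      moreover obtain x y where xy: "x \<in> A" "y \<in> B" using v(1) w(1) by blast
      ultimately have "z = case_prod (ext_pairing G q) (x, y)" using c[OF xy] by simp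
      then show "z \<in> case_prod (ext_pairing G q) ` (A \<times> B)" using xy by blast
    qed
    then show ?thesis by (simp add: fA delta_quotient_def Let_def)
  qed
  ultimately show ?thesis unfolding paired_iso_def by (intro bexI[of _ ?f] ballI)
qed

lemma iso_class_delta_quotient: "iso_class (delta_quotient G g q) = iso_class (ker_fun m (Suc n))"
proof -
  interpret h: group_hom E "ker_fun m (Suc n)" coord_vec by (rule coord_vec_group_hom)
  let ?Q = "E Mod kernel E (ker_fun m (Suc n)) coord_vec"
  have "group ?Q" by (rule normal.factorgroup_is_group[OF h.normal_kernel])
  moreover have "carrier (delta_quotient G g q) = carrier ?Q" "mult (delta_quotient G g q) = mult ?Q"
     "one (delta_quotient G g q) = one ?Q"
    unfolding kernel_coord_vec by (simp_all add: delta_quotient_def Let_def E_def)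
  ultimately have "group (delta_quotient G g q)"
    by (simp add: group_def group_axioms_def monoid_def Units_def)
  then show ?thesis using paired_iso_delta_quotient by (rule iso_class_eqI)
qed

end

section \<open>The law of a corner\<close>

lemma class_space_simps [simp]:
  "space (class_space :: 'p::prime_card paired_class measure) = UNIV"
  "sets (class_space :: 'p paired_class measure) = sigma_sets UNIV (Pow X_S)"
  by (simp_all add: class_space_def)

lemma X_S_subset_in_class_space: "B \<subseteq> X_S \<Longrightarrow> B \<in> sets class_space"
  by (auto intro: sigma_sets.Basic)

lemma X_S_compl_in_class_space: "- X_S \<in> sets (class_space :: 'p::prime_card paired_class measure)"
  using sets.compl_sets[OF X_S_subset_in_class_space[OF order_refl]] by (simp add: Compl_eq_Diff_UNIV del: class_space_simps(2))

text \<open>Every point of the product space becomes a symmetric matrix, so symmetry holds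
  identically and not just on the range of the random entries.\<close>

definition sym_ext :: "(nat \<times> nat \<Rightarrow> 'b) \<Rightarrow> nat \<Rightarrow> nat \<Rightarrow> 'b" where
  "sym_ext x i j = x (min i j, max i j)"

lemma sym_ext_sym: "sym_ext x i j = sym_ext x j i"
  by (simp add: sym_ext_def min.commute max.commute)

text \<open>The chain as a function on the space of matrix entries, where iterated integrals are
  available.\<close>

definition ker_class :: "nat \<Rightarrow> (nat \<times> nat \<Rightarrow> 'p::prime_card zp) \<Rightarrow> 'p paired_class" where
  "ker_class n x = iso_class (ker_fun (sym_ext x) n)"

definition upper :: "nat \<Rightarrow> (nat \<times> nat) set" where
  "upper n = {(i, j). i \<le> j \<and> j < n}"

definition last_col :: "nat \<Rightarrow> (nat \<times> nat) set" where
  "last_col n = (\<lambda>i. (i, n)) ` {..<n}"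

lemma finite_upper [simp]: "finite (upper n)" "finite (last_col n)"
  by (rule finite_subset[of _ "{..<n} \<times> {..<n}"]) (auto simp: upper_def last_col_def)

lemma upper_Suc: "upper (Suc n) = insert (n, n) (upper n \<union> last_col n)"
  by (auto simp: upper_def last_col_def less_Suc_eq)

lemma upper_disjoint: "upper n \<inter> last_col n = {}" "(n, n) \<notin> upper n \<union> last_col n"
  by (auto simp: upper_def last_col_def)

lemma upper_mono: "i \<le> n \<Longrightarrow> upper i \<subseteq> upper n"
  by (auto simp: upper_def)

lemma ker_fun_cong:
  assumes "\<And>i j. i < n \<Longrightarrow> j < n \<Longrightarrow> m i j = m' i j"
  shows "ker_fun m n = ker_fun m' n"
proof -
  have "mat n n (\<lambda>(i, j). m i j) = mat n n (\<lambda>(i, j). m' i j)" using assms by (intro eq_matI) auto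
  then show ?thesis by (simp add: ker_fun_def)
qed

lemma sym_ext_cong:
  assumes "\<And>z. z \<in> upper n \<Longrightarrow> x z = y z" "i < n" "j < n"
  shows "sym_ext x i j = sym_ext y i j"
  unfolding sym_ext_def using assms by (intro assms(1)) (auto simp: upper_def)

lemma ker_class_cong:
  assumes "\<And>z. z \<in> upper n \<Longrightarrow> x z = y z"
  shows "ker_class n x = ker_class n y"
  unfolding ker_class_def using sym_ext_cong[OF assms] by (subst ker_fun_cong) auto

lemma ker_class_in_X_S_iff: "ker_class n x \<in> X_S \<longleftrightarrow> nonsing (sym_ext x) n"
  unfolding ker_class_def by (rule iso_class_ker_in_X_S_iff) (rule sym_ext_sym)

text \<open>The generating sets of \<open>class_space\<close> lie in \<open>X_S\<close>, so only
  non-singular matrices occur in their preimages. By local constancy such a preimage is a union of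
  boxes with one common level for all entries, and these boxes form a countable family.\<close>

lemma measurable_ker_class:
  assumes fin: "finite I" and sub: "upper n \<subseteq> I"
  shows "(ker_class n :: _ \<Rightarrow> 'p::prime_card paired_class) \<in> measurable (PiM I (\<lambda>_. borel)) class_space"
proof (rule measurable_sigma_sets[where \<Omega> = UNIV and A = "Pow X_S"])
  let ?M = "PiM I (\<lambda>_. borel :: 'p zp measure)"
  fix B :: "'p paired_class set" assume B: "B \<in> Pow X_S"
  define S where "S = ker_class n -` B \<inter> space ?M"
  define C where "C = (\<lambda>L r. PiE I (\<lambda>z. zp_cyl L (r z) :: 'p zp set))"
  define \<C> where "\<C> = (\<Union>L. C L ` PiE I (\<lambda>_. {0..<int CARD('p) ^ L}))"
  have "countable \<C>"
    unfolding \<C>_def by (intro countable_UN countableI_type countable_finite finite_imageI finite_PiE fin) auto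
  have C_sets: "A \<in> sets ?M" if "A \<in> \<C>" for A
    using that fin by (auto simp: \<C>_def C_def intro!: sets_PiM_I_finite borel_open open_zp_cyl)
  have eq: "S = \<Union>{A \<in> \<C>. A \<subseteq> S}"
  proof
    show "S \<subseteq> \<Union>{A \<in> \<C>. A \<subseteq> S}"
    proof
      fix x assume x: "x \<in> S"
      then have "ker_class n x \<in> X_S" using B by (auto simp: S_def)
      then have "nonsing (sym_ext x) n" by (simp add: ker_class_in_X_S_iff)
      from ker_locally_constant[of "sym_ext x", OF sym_ext_sym this]
      obtain L where L: "\<And>m'. (\<forall>i j. m' i j = m' j i) \<Longrightarrow> (\<forall>i<n. \<forall>j<n. Rep_zp (m' i j) L = Rep_zp (sym_ext x i j) L) \<Longrightarrow>
          iso_class (ker_fun m' n) = iso_class (ker_fun (sym_ext x) n)" by blast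
      define r where "r = restrict (\<lambda>z. Rep_zp (x z) L) I"
      have "r \<in> PiE I (\<lambda>_. {0..<int CARD('p) ^ L})"
        using Rep_zp_nonneg[where 'p = 'p] Rep_zp_less[where 'p = 'p] by (auto simp: r_def)
      then have "C L r \<in> \<C>" by (auto simp: \<C>_def)
      moreover have "C L r \<subseteq> S"
      proof
        fix y assume y: "y \<in> C L r"
        then have y': "y \<in> space ?M" by (auto simp: C_def space_PiM PiE_iff)
        have "Rep_zp (sym_ext y i j) L = Rep_zp (sym_ext x i j) L" if "i < n" "j < n" for i j
        proof -
          have "(min i j, max i j) \<in> I" using that sub by (auto simp: upper_def)
          then show ?thesis using y by (auto simp: C_def PiE_iff zp_cyl_def r_def sym_ext_def)
        qed
        then have "ker_class n y = ker_class n x"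
          unfolding ker_class_def by (intro L allI impI) (auto simp: sym_ext_sym)
        then show "y \<in> S" using x y' by (simp add: S_def)
      qed
      moreover have "x \<in> C L r"
        using x by (auto simp: S_def C_def r_def zp_cyl_def space_PiM PiE_iff)
      ultimately show "x \<in> \<Union>{A \<in> \<C>. A \<subseteq> S}" by blast
    qed
  qed blast
  have "\<Union>{A \<in> \<C>. A \<subseteq> S} \<in> sets ?M"
    using C_sets by (intro sets.countable_Union countable_subset[OF _ \<open>countable \<C>\<close>]) auto
  then show "ker_class n -` B \<inter> space ?M \<in> sets ?M" unfolding S_def[symmetric] eq[symmetric] .
qed auto

lemma sets_PiM_haar [simp, measurable_cong]:
  "sets (PiM I (\<lambda>_. haar)) = sets (PiM I (\<lambda>_. borel :: 'p::prime_card zp measure))"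
  by (intro sets_PiM_cong) auto

lemma measurable_ker_class_haar [measurable]:
  assumes "finite I" "upper n \<subseteq> I"
  shows "ker_class n \<in> measurable (PiM I (\<lambda>_. haar :: 'p::prime_card zp measure)) class_space"
  unfolding measurable_cong_sets[OF sets_PiM_haar refl] by (rule measurable_ker_class[OF assms])

interpretation haar: prob_space "haar :: 'p::prime_card zp measure"
  by (rule prob_space_haar)

interpretation haar_prod: product_prob_space "\<lambda>_. haar :: 'p::prime_card zp measure" I for I :: "'i set"
  by standard

section \<open>Translation invariance and iterated integrals over the entries\<close>

lemma nn_integral_haar_add:
  assumes "f \<in> borel_measurable (borel :: 'p::prime_card zp measure)"
  shows "(\<integral>\<^sup>+ z. f (c + z) \<partial>haar) = (\<integral>\<^sup>+ z. f z \<partial>haar)"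
proof -
  have m: "(\<lambda>z. c + z) \<in> measurable haar (borel :: 'p zp measure)"
    using measurable_zp_add by (simp cong: measurable_cong_sets)
  have "(\<integral>\<^sup>+ z. f z \<partial>haar) = (\<integral>\<^sup>+ z. f z \<partial>distr haar borel (\<lambda>z. c + z))" by (simp add: distr_haar_add)
  then show ?thesis using nn_integral_distr[OF m, of f] assms by simp
qed

text \<open>Invariance is checked on boxes, where the measure factors. The restriction to I keeps
  the translate among the extensional functions that form the product space.\<close>

lemma nn_integral_PiM_haar_add:
  fixes w :: "'i \<Rightarrow> 'p::prime_card zp"
  assumes I: "finite I" and f: "f \<in> borel_measurable (PiM I (\<lambda>_. haar :: 'p zp measure))"
  shows "(\<integral>\<^sup>+ y. f (\<lambda>i\<in>I. w i + y i) \<partial>PiM I (\<lambda>_. haar)) = (\<integral>\<^sup>+ y. f y \<partial>PiM I (\<lambda>_. haar))"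
proof -
  let ?P = "PiM I (\<lambda>_. haar :: 'p zp measure)" and ?t = "\<lambda>y. \<lambda>i\<in>I. w i + y i"
  have ad: "(\<lambda>z. c + z) \<in> measurable haar haar" for c :: "'p zp"
    using measurable_zp_add by (simp cong: measurable_cong_sets)
  have t: "?t \<in> measurable ?P ?P"
  proof (rule measurable_restrict)
    fix i assume "i \<in> I"
    then have "(\<lambda>y. y i) \<in> measurable ?P haar" by (rule measurable_component_singleton)
    then show "(\<lambda>y. w i + y i) \<in> measurable ?P haar" by (rule measurable_compose[OF _ ad])
  qed
  have "distr ?P ?P ?t = ?P"
  proof (rule haar_prod.PiM_eqI[OF I])
    fix A :: "'i \<Rightarrow> 'p zp set" assume A: "\<And>i. i \<in> I \<Longrightarrow> A i \<in> sets haar"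
    have pre: "?t -` PiE I A \<inter> space ?P = PiE I (\<lambda>i. (\<lambda>z. w i + z) -` A i \<inter> space haar)"
      by (auto simp: space_PiM PiE_iff)
    have "emeasure (distr ?P ?P ?t) (PiE I A) = emeasure ?P (?t -` PiE I A \<inter> space ?P)"
      by (rule emeasure_distr[OF t]) (use I A in \<open>intro sets_PiM_I_finite, auto\<close>)
    also have "\<dots> = (\<Prod>i\<in>I. emeasure haar ((\<lambda>z. w i + z) -` A i \<inter> space haar))"
      unfolding pre by (intro haar_prod.emeasure_PiM I measurable_sets[OF ad] A)
    also have "\<dots> = (\<Prod>i\<in>I. emeasure (distr haar borel (\<lambda>z. w i + z)) (A i))"
      using A ad by (intro prod.cong refl emeasure_distr[symmetric]) (auto cong: measurable_cong_sets)
    finally show "emeasure (distr ?P ?P ?t) (PiE I A) = (\<Prod>i\<in>I. emeasure haar (A i))"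
      by (simp add: distr_haar_add)
  qed simp
  then have "(\<integral>\<^sup>+ y. f y \<partial>?P) = (\<integral>\<^sup>+ y. f y \<partial>distr ?P ?P ?t)" by simp
  also have "\<dots> = (\<integral>\<^sup>+ y. f (?t y) \<partial>?P)" by (rule nn_integral_distr[OF t]) (use f in simp)
  finally show ?thesis ..
qed

text \<open>The old corner is outermost and the diagonal entry innermost, since the shift that
  normalizes the latter depends on the corner and the column.\<close>

lemma nn_integral_upper_Suc:
  fixes f :: "(nat \<times> nat \<Rightarrow> 'p::prime_card zp) \<Rightarrow> ennreal"
  assumes f: "f \<in> borel_measurable (PiM (upper (Suc n)) (\<lambda>_. haar))"
  shows "(\<integral>\<^sup>+ x. f x \<partial>PiM (upper (Suc n)) (\<lambda>_. haar)) =
    (\<integral>\<^sup>+ x. \<integral>\<^sup>+ y. \<integral>\<^sup>+ c. f ((merge (upper n) (last_col n) (x, y))((n, n) := c)) \<partial>haar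
       \<partial>PiM (last_col n) (\<lambda>_. haar) \<partial>PiM (upper n) (\<lambda>_. haar))"
proof -
  have fin: "finite (upper n \<union> last_col n)" by simp
  have f': "f \<in> borel_measurable (PiM (insert (n, n) (upper n \<union> last_col n)) (\<lambda>_. haar))"
    using f by (simp add: upper_Suc)
  have "(\<lambda>(x, c). x((n, n) := c)) \<in> measurable (PiM (upper n \<union> last_col n) (\<lambda>_. haar) \<Otimes>\<^sub>M haar)
      (PiM (insert (n, n) (upper n \<union> last_col n)) (\<lambda>_. haar :: 'p zp measure))"
    by (rule measurable_add_dim)
  then have "(\<lambda>x. f (case x of (x, c) \<Rightarrow> x((n, n) := c))) \<in> borel_measurable (PiM (upper n \<union> last_col n) (\<lambda>_. haar) \<Otimes>\<^sub>M haar)"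
    by (rule measurable_compose[OF _ f'])
  then have h: "(\<lambda>x. \<integral>\<^sup>+ c. f (x((n, n) := c)) \<partial>haar) \<in> borel_measurable (PiM (upper n \<union> last_col n) (\<lambda>_. haar))"
    by (intro haar.borel_measurable_nn_integral) (simp add: case_prod_beta')
  show ?thesis
    unfolding upper_Suc haar_prod.product_nn_integral_insert[OF fin upper_disjoint(2) f']
    by (rule haar_prod.product_nn_integral_fold[OF upper_disjoint(1) _ _ h]) simp_all
qed

section \<open>Almost sure non-singularity\<close>

lemma merge_upper: "z \<in> upper n \<Longrightarrow> ((merge (upper n) (last_col n) (x, y))((n, n) := c)) z = x z"
  using upper_disjoint(2)[of n] by (auto simp: merge_def)

text \<open>By \<open>singular_corner_unique\<close> at most one diagonal entry is bad, so the
  integrand is bounded by the indicator of a point.\<close>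

lemma emeasure_singular_new_corner:
  fixes x :: "nat \<times> nat \<Rightarrow> 'p::prime_card zp"
  assumes "ker_class n x \<in> X_S"
  shows "(\<integral>\<^sup>+ c. indicator (- X_S) (ker_class (Suc n) (x((n, n) := c))) \<partial>haar) = 0"
proof -
  define S where "S = {c. \<not> nonsing (sym_ext (x((n, n) := c))) (Suc n)}"
  have ns: "nonsing (sym_ext (x((n, n) := c))) n" for c
  proof -
    have "ker_class n (x((n, n) := c)) = ker_class n x"
      using upper_disjoint(2)[of n] by (intro ker_class_cong) auto
    then show ?thesis using assms ker_class_in_X_S_iff[of n "x((n, n) := c)"] by simp
  qed
  have "c = d" if "c \<in> S" "d \<in> S" for c d
  proof -
    have e: "sym_ext (x((n, n) := c)) i j = sym_ext (x((n, n) := d)) i j" if "(i, j) \<noteq> (n, n)" for i j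
    proof -
      have ne: "(min i j, max i j) \<noteq> (n, n)" using that by (auto simp: min_def max_def split: if_splits)
      show ?thesis unfolding sym_ext_def by (simp only: fun_upd_other[OF ne])
    qed
    have "\<not> nonsing (sym_ext (x((n, n) := d))) (Suc n)" "\<not> nonsing (sym_ext (x((n, n) := c))) (Suc n)"
      using that by (simp_all add: S_def)
    then have "sym_ext (x((n, n) := c)) n n = sym_ext (x((n, n) := d)) n n"
      by (rule singular_corner_unique[OF ns[of d] _ _ e])
    then show ?thesis by (simp add: sym_ext_def)
  qed
  then obtain d where d: "S \<subseteq> {d}" by (cases "S = {}") blast+
  have "(\<integral>\<^sup>+ c. indicator (- X_S) (ker_class (Suc n) (x((n, n) := c))) \<partial>haar) \<le> (\<integral>\<^sup>+ c. indicator {d} c \<partial>haar)"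
    using d by (intro nn_integral_mono) (auto simp: indicator_def S_def ker_class_in_X_S_iff)
  also have "\<dots> = 0" by (simp add: zp_singleton_borel emeasure_haar_singleton)
  finally show ?thesis by simp
qed

lemma measurable_indicator_ker_class:
  assumes "B \<in> sets class_space" "finite I" "upper n \<subseteq> I"
  shows "(\<lambda>x. indicator B (ker_class n x) :: ennreal) \<in> borel_measurable (PiM I (\<lambda>_. haar :: 'p::prime_card zp measure))"
  by (rule measurable_compose[OF measurable_ker_class_haar[OF assms(2,3)]]) (rule borel_measurable_indicator[OF assms(1)])

text \<open>The integral over the diagonal entry is 0 if the smaller corner is non-singular and at
  most 1 otherwise, hence bounded by the indicator of the smaller singular set. The empty matrix is
  non-singular and starts the induction.\<close>

lemma singular_null:
  "(\<integral>\<^sup>+ x. indicator (- X_S) (ker_class n x) \<partial>PiM (upper n) (\<lambda>_. haar :: 'p::prime_card zp measure)) = 0"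
proof (induction n)
  case 0
  have "ker_class 0 x \<in> X_S" for x :: "nat \<times> nat \<Rightarrow> 'p zp"
    unfolding ker_class_in_X_S_iff by (simp add: nonsing_def)
  then show ?case by simp
next
  case (Suc n)
  let ?P = "\<lambda>I. PiM I (\<lambda>_. haar :: 'p zp measure)"
  have col: "emeasure (?P (last_col n)) (space (?P (last_col n))) = 1"
    by (rule prob_space.emeasure_space_1[OF prob_space_PiM[OF prob_space_haar]])
  have "(\<integral>\<^sup>+ x. indicator (- X_S) (ker_class (Suc n) x) \<partial>?P (upper (Suc n))) \<le>
      (\<integral>\<^sup>+ x. \<integral>\<^sup>+ y. indicator (- X_S) (ker_class n x) \<partial>?P (last_col n) \<partial>?P (upper n))"
    unfolding nn_integral_upper_Suc[OF measurable_indicator_ker_class[OF X_S_compl_in_class_space finite_upper(1) order_refl]]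
  proof (intro nn_integral_mono)
    fix x y :: "nat \<times> nat \<Rightarrow> 'p zp"
    let ?z = "merge (upper n) (last_col n) (x, y)"
    show "(\<integral>\<^sup>+ c. indicator (- X_S) (ker_class (Suc n) (?z((n, n) := c))) \<partial>haar) \<le> indicator (- X_S) (ker_class n x)"
    proof (cases "ker_class n x \<in> X_S")
      case True
      have "ker_class n ?z = ker_class n x" by (rule ker_class_cong) (auto simp: merge_def)
      with True have "(\<integral>\<^sup>+ c. indicator (- X_S) (ker_class (Suc n) (?z((n, n) := c))) \<partial>haar) = 0"
        by (intro emeasure_singular_new_corner) simp
      then show ?thesis by simp
    next
      case False
      have "(\<integral>\<^sup>+ c. indicator (- X_S) (ker_class (Suc n) (?z((n, n) := c))) \<partial>haar) \<le> (\<integral>\<^sup>+ c. 1 \<partial>(haar :: 'p zp measure))"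
        by (intro nn_integral_mono) (simp add: indicator_def)
      then show ?thesis using False prob_space.emeasure_space_1[OF prob_space_haar[where 'p = 'p]] by simp
    qed
  qed
  also have "\<dots> = 0" using Suc.IH col by simp
  finally show ?case by simp
qed

section \<open>One step of the chain\<close>

text \<open>\<open>D g\<close> is the probability of landing in B once g is picked, and
  \<open>h y\<close> is the element of G that the column y represents. The diagonal integral equals
  \<open>D (h y)\<close> for each y, and shifting the column turns the integral of this into the
  average of D, which is what \<open>Delta_S\<close> gives by Fubini.\<close>

lemma one_step:
  fixes x :: "nat \<times> nat \<Rightarrow> 'p::prime_card zp" and G :: "(nat, 'p) paired_group"
  assumes G: "perfect_symmetric_p_group G" and x: "ker_class n x = iso_class G"
    and B: "B \<in> sets class_space"
  shows "(\<integral>\<^sup>+ y. \<integral>\<^sup>+ c. indicator B (ker_class (Suc n) ((merge (upper n) (last_col n) (x, y))((n, n) := c))) \<partial>haar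
       \<partial>PiM (last_col n) (\<lambda>_. haar)) = emeasure (Delta_S G) B"
proof -
  let ?K = "ker_fun (sym_ext x) n" and ?Q = "PiM (last_col n) (\<lambda>_. haar :: 'p zp measure)"
  define glue where "glue y c = (merge (upper n) (last_col n) (x, y))((n, n) := c)" for y c
  define T where "T g z = iso_class (delta_quotient G g (qp_lift (- pairing G g g) + of_zp z))" for g z
  define D where "D g = (\<integral>\<^sup>+ z. indicator B (T g z) \<partial>haar)" for g
  interpret G: comm_group G using G by (simp add: perfect_symmetric_p_group_def)
  have finG: "finite (carrier G)" using G by (simp add: perfect_symmetric_p_group_def)
  have cG: "card (carrier G) \<noteq> 0" using card_0_eq[OF finG] G.one_closed by blast
  have "iso_class G \<in> X_S" using G by (rule iso_class_in_X_S)
  then have "nonsing (sym_ext x) n" using x ker_class_in_X_S_iff[of n x] by simp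
  then obtain C N where C: "qp_inverse (sym_ext x) n C N" using nonsing_qp_inverse by blast
  have C1: "mv (sym_ext x) n (\<lambda>j. C j k) i = (if i = k then 1 else 0)" if "i < n" "k < n" for i k
    using C that by (simp add: qp_inverse_def)
  have C2: "(\<Sum>j<n. C i j * mv (sym_ext x) n V j) = V i" if "i < n" for i V
    using C that by (simp add: qp_inverse_def)
  have "paired_iso G ?K"
  proof (rule paired_iso_sym)
    show "group ?K" using ker_comm_group by (rule comm_group.axioms(2))
    show "paired_iso ?K G"
      using x unfolding ker_class_def by (rule iso_class_eq_imp_paired_iso) (rule G.group_axioms)
  qed
  then obtain F where F: "F \<in> iso G ?K"
    and Fp: "\<And>x y. x \<in> carrier G \<Longrightarrow> y \<in> carrier G \<Longrightarrow> pairing ?K (F x) (F y) = pairing G x y"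
    unfolding paired_iso_def by blast
  have Fim: "F ` carrier G = carrier ?K" and Finj: "inj_on F (carrier G)"
    using F by (simp_all add: iso_def bij_betw_def)
  have Fadd: "F (g \<otimes>\<^bsub>G\<^esub> h) = F g + F h" if "g \<in> carrier G" "h \<in> carrier G" for g h
    using F that by (auto simp: iso_def hom_def)
  define \<gamma> where "\<gamma> y i = (\<Sum>j<n. of_zp (y (j, n)) * C i j)" for y :: "nat \<times> nat \<Rightarrow> 'p zp" and i
  have mv\<gamma>: "mv (sym_ext x) n (\<gamma> y) i = of_zp (y (i, n))" if i: "i < n" for y i
  proof -
    have "mv (sym_ext x) n (\<gamma> y) i = (\<Sum>j<n. of_zp (y (j, n)) * mv (sym_ext x) n (\<lambda>k. C k j) i)"
      unfolding \<gamma>_def mv_sum mv_scale ..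
    also have "\<dots> = (\<Sum>j<n. if j = i then of_zp (y (i, n)) else 0)"
      by (rule sum.cong) (simp_all add: C1[OF i])
    finally show ?thesis using i by simp
  qed
  have \<gamma>K: "qvec n (\<gamma> y) \<in> carrier ?K" for y by (simp add: qvec_in_ker_iff mv\<gamma>)
  define h where "h y = inv_into (carrier G) F (qvec n (\<gamma> y))" for y
  have hG: "h y \<in> carrier G" and Fh: "F (h y) = qvec n (\<gamma> y)" for y
    using \<gamma>K[of y] unfolding Fim[symmetric] h_def by (simp_all add: inv_into_into f_inv_into_f)
  have h_surj: "\<exists>y. h y = g" if g: "g \<in> carrier G" for g
  proof -
    have "F g \<in> carrier ?K" using Fim g by blast
    then obtain V where V: "F g = qvec n V" "\<And>i. i < n \<Longrightarrow> integral_qp (mv (sym_ext x) n V i)"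
      using ker_cases by blast
    have "\<forall>i. \<exists>r. i < n \<longrightarrow> mv (sym_ext x) n V i = of_zp r" using V(2) by (auto simp: integral_qp_def)
    then obtain r where r: "\<And>i. i < n \<Longrightarrow> mv (sym_ext x) n V i = of_zp (r i)" by metis
    have "\<gamma> (\<lambda>z. r (fst z)) i = V i" if "i < n" for i
    proof -
      have "\<gamma> (\<lambda>z. r (fst z)) i = (\<Sum>j<n. C i j * mv (sym_ext x) n V j)"
        unfolding \<gamma>_def by (rule sum.cong) (simp_all add: r mult.commute)
      then show ?thesis using C2[OF that] by simp
    qed
    then have "qvec n (\<gamma> (\<lambda>z. r (fst z))) = F g" unfolding V(1) qvec_eq_iff by simp
    then have "h (\<lambda>z. r (fst z)) = g" unfolding h_def using Finj g by (simp add: inv_into_f_f)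
    then show ?thesis by blast
  qed
  have h_add: "h (\<lambda>z\<in>last_col n. w z + y z) = h w \<otimes>\<^bsub>G\<^esub> h y" for w y
  proof -
    have "\<gamma> (\<lambda>z\<in>last_col n. w z + y z) i = \<gamma> w i + \<gamma> y i" for i
      unfolding \<gamma>_def sum.distrib[symmetric]
      by (rule sum.cong) (auto simp: last_col_def of_zp_simps(3) distrib_right)
    then have "\<gamma> (\<lambda>z\<in>last_col n. w z + y z) = (\<lambda>i. \<gamma> w i + \<gamma> y i)" by (rule ext)
    then have "F (h (\<lambda>z\<in>last_col n. w z + y z)) = F (h w \<otimes>\<^bsub>G\<^esub> h y)"
      using Fadd[OF hG hG, of w y] by (simp only: Fh qvec_add)
    then show ?thesis using Finj hG G.m_closed[OF hG hG] by (simp add: inj_on_eq_iff)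
  qed
  have glue_old: "sym_ext (glue y c) i j = sym_ext x i j" if "i < n" "j < n" for y c i j
    unfolding glue_def using that by (intro sym_ext_cong[of n]) (rule merge_upper)
  have glue_col: "sym_ext (glue y c) i n = y (i, n)" "sym_ext (glue y c) n i = y (i, n)" if "i < n" for y c i
    using that by (auto simp: glue_def sym_ext_def merge_def upper_def last_col_def)
  have glue_last: "sym_ext (glue y c) n n = c" for y c by (simp add: glue_def sym_ext_def)
  \<comment> \<open>The parameter of the enlarged matrix and the lift chosen in
    \<open>Delta_S\<close> lie in the same coset of Z_p up to c; their offset d depends on the
    column but not on c.\<close>
  have "\<exists>d. \<forall>c. ker_class (Suc n) (glue y c) = T (h y) (d + c)" for y
  proof -
    let ?s = "\<Sum>i<n. of_zp (y (i, n)) * \<gamma> y i"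
    have "pairing G (h y) (h y) = pairing ?K (qvec n (\<gamma> y)) (qvec n (\<gamma> y))"
      using Fp[OF hG hG, of y y] by (simp add: Fh)
    also have "\<dots> = qpzp_of (\<Sum>i<n. \<gamma> y i * mv (sym_ext x) n (\<gamma> y) i)"
      by (rule ker_pairing[of "sym_ext x", OF sym_ext_sym]) (simp_all add: mv\<gamma>)
    also have "(\<Sum>i<n. \<gamma> y i * mv (sym_ext x) n (\<gamma> y) i) = ?s"
      by (rule sum.cong) (simp_all add: mv\<gamma> mult.commute)
    finally have "qpzp_of (- ?s) = qpzp_of (qp_lift (- pairing G (h y) (h y)))"
      by (simp add: qpzp_of_uminus)
    then have "integral_qp (- ?s - qp_lift (- pairing G (h y) (h y)))" unfolding qpzp_of_eq_iff_integral .
    then obtain d where d: "- ?s - qp_lift (- pairing G (h y) (h y)) = of_zp d" by (rule integral_qpE)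
    have d': "qp_lift (- pairing G (h y) (h y)) + of_zp d = - ?s"
      unfolding d[symmetric] by simp
    have "ker_class (Suc n) (glue y c) = T (h y) (d + c)" for c
    proof -
      have K: "ker_fun (sym_ext (glue y c)) n = ?K" by (rule ker_fun_cong) (rule glue_old)
      have mv_glue: "mv (sym_ext (glue y c)) n V i = mv (sym_ext x) n V i" if "i < n" for V i
        unfolding mv_def using that by (intro sum.cong) (simp_all add: glue_old)
      have q: "qp_lift (- pairing G (h y) (h y)) + of_zp (d + c) = of_zp (sym_ext (glue y c) n n)
          - (\<Sum>i<n. of_zp (sym_ext (glue y c) n i) * \<gamma> y i)"
        unfolding of_zp_simps(3) add.assoc[symmetric] d' by (simp add: glue_last glue_col)
      have "T (h y) (d + c) = iso_class (ker_fun (sym_ext (glue y c)) (Suc n))"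
        unfolding T_def
      proof (rule iso_class_delta_quotient[where F = F and \<gamma> = "\<gamma> y", OF sym_ext_sym G _ _ hG _ _ q])
        show "F \<in> iso G (ker_fun (sym_ext (glue y c)) n)" using F unfolding K .
        show "pairing (ker_fun (sym_ext (glue y c)) n) (F a) (F b) = pairing G a b"
          if "a \<in> carrier G" "b \<in> carrier G" for a b using Fp[OF that] unfolding K .
        show "mv (sym_ext (glue y c)) n (\<gamma> y) i = of_zp (sym_ext (glue y c) i n)" if "i < n" for i
          using that by (simp add: mv_glue mv\<gamma> glue_col)
      qed (rule Fh)
      then show ?thesis by (simp add: ker_class_def)
    qed
    then show ?thesis by blast
  qed
  then obtain d where d: "\<And>y c. ker_class (Suc n) (glue y c) = T (h y) (d y + c)" by metis
  \<comment> \<open>The restriction allows a check entry by entry, and \<open>ker_class\<close> does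
    not see it.\<close>
  have glue_meas: "(\<lambda>(y, c). restrict (glue y c) (upper (Suc n))) \<in>
      measurable (?Q \<Otimes>\<^sub>M haar) (PiM (upper (Suc n)) (\<lambda>_. haar))"
    unfolding case_prod_beta'
  proof (rule measurable_restrict)
    fix z assume "z \<in> upper (Suc n)"
    then consider "z = (n, n)" | "z \<in> upper n" "z \<noteq> (n, n)" | "z \<in> last_col n" "z \<noteq> (n, n)" "z \<notin> upper n"
      unfolding upper_Suc using upper_disjoint[of n] by blast
    then show "(\<lambda>p. glue (fst p) (snd p) z) \<in> measurable (?Q \<Otimes>\<^sub>M haar) haar"
    proof cases
      case 1
      then show ?thesis by (simp add: glue_def)
    next
      case 2
      then show ?thesis by (simp add: glue_def merge_def)
    next
      case 3
      have "(\<lambda>p. fst p z) \<in> measurable (?Q \<Otimes>\<^sub>M haar) haar"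
        by (rule measurable_compose[OF measurable_fst]) (rule measurable_component_singleton[OF 3(1)])
      then show ?thesis using 3 by (simp add: glue_def merge_def)
    qed
  qed
  have "ker_class (Suc n) (restrict (glue y c) (upper (Suc n))) = ker_class (Suc n) (glue y c)" for y c
    by (rule ker_class_cong) simp
  then have meas2: "(\<lambda>(y, c). ker_class (Suc n) (glue y c)) \<in> measurable (?Q \<Otimes>\<^sub>M haar) class_space"
    using measurable_compose[OF glue_meas measurable_ker_class_haar[OF finite_upper(1) order_refl]]
    by (simp add: case_prod_beta')
  have meas1: "(\<lambda>c. ker_class (Suc n) (glue y c)) \<in> measurable haar class_space" if "y \<in> space ?Q" for y
    using measurable_compose[OF measurable_Pair1'[OF that] meas2] by simp
  \<comment> \<open>Measurability of the \<open>Delta_S\<close> side comes from the kernel side: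
    pick a column representing g and undo the offset. Cutting the column down to
    \<open>last_col n\<close> puts it in the product space without changing
    \<open>h\<close>.\<close>
  have T_meas: "T g \<in> measurable haar class_space" if g: "g \<in> carrier G" for g
  proof -
    obtain y where y: "h y = g" using h_surj[OF g] by blast
    define y' where "y' = restrict y (last_col n)"
    have "\<gamma> y' i = \<gamma> y i" for i unfolding \<gamma>_def y'_def by (rule sum.cong) (auto simp: last_col_def)
    then have y'h: "h y' = g" using y unfolding h_def by (simp add: qvec_def)
    have "y' \<in> space ?Q" by (simp add: y'_def space_PiM)
    then have "(\<lambda>z. ker_class (Suc n) (glue y' (- d y' + z))) \<in> measurable haar class_space"
      using measurable_compose[OF _ meas1[of y'], of "\<lambda>z. - d y' + z" haar] measurable_zp_add[of "- d y'"]
      by (simp cong: measurable_cong_sets)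
    then show ?thesis unfolding d y'h by simp
  qed
  have ind_T: "(\<lambda>z. indicator B (T g z) :: ennreal) \<in> borel_measurable borel" if "g \<in> carrier G" for g
    using measurable_compose[OF T_meas[OF that] borel_measurable_indicator[OF B]]
    by (simp cong: measurable_cong_sets)
  have inner: "(\<integral>\<^sup>+ c. indicator B (ker_class (Suc n) (glue y c)) \<partial>haar) = D (h y)" for y
    unfolding d D_def by (rule nn_integral_haar_add[OF ind_T[OF hG]])
  have Dh: "(\<lambda>y. D (h y)) \<in> borel_measurable ?Q"
    unfolding inner[symmetric]
    by (rule haar.borel_measurable_nn_integral)
      (use measurable_compose[OF meas2 borel_measurable_indicator[OF B]] in \<open>simp add: case_prod_beta'\<close>)
  have inv: "(\<integral>\<^sup>+ y. D (g \<otimes>\<^bsub>G\<^esub> h y) \<partial>?Q) = (\<integral>\<^sup>+ y. D (h y) \<partial>?Q)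
      \<and> (\<lambda>y. D (g \<otimes>\<^bsub>G\<^esub> h y)) \<in> borel_measurable ?Q" if g: "g \<in> carrier G" for g
  proof -
    obtain w where w: "h w = g" using h_surj[OF g] by blast
    have t: "(\<lambda>y. \<lambda>z\<in>last_col n. w z + y z) \<in> measurable ?Q ?Q"
    proof (rule measurable_restrict)
      fix i assume "i \<in> last_col n"
      then have "(\<lambda>y. y i) \<in> measurable ?Q haar" by (rule measurable_component_singleton)
      moreover have "(\<lambda>z. w i + z) \<in> measurable haar (haar :: 'p zp measure)"
        using measurable_zp_add by (simp cong: measurable_cong_sets)
      ultimately show "(\<lambda>y. w i + y i) \<in> measurable ?Q haar" by (rule measurable_compose)
    qed
    show ?thesis
      using nn_integral_PiM_haar_add[OF finite_upper(2) Dh, of w] measurable_compose[OF t Dh]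
      by (simp add: h_add w)
  qed
  have sum_shift: "(\<Sum>g\<in>carrier G. D (g \<otimes>\<^bsub>G\<^esub> b)) = (\<Sum>g\<in>carrier G. D g)" if b: "b \<in> carrier G" for b
  proof (rule sum.reindex_bij_witness[where i = "\<lambda>g. g \<otimes>\<^bsub>G\<^esub> inv\<^bsub>G\<^esub> b" and j = "\<lambda>g. g \<otimes>\<^bsub>G\<^esub> b"])
  qed (use b in \<open>simp_all add: G.m_assoc\<close>)
  have one: "emeasure ?Q (space ?Q) = 1"
    by (rule prob_space.emeasure_space_1[OF prob_space_PiM[OF prob_space_haar]])
  \<comment> \<open>Each shift by g leaves the integral unchanged. After exchanging sum and
    integral, translation by \<open>h y\<close> only permutes G, so the integrand is the constant
    sum of D.\<close>
  have "of_nat (card (carrier G)) * (\<integral>\<^sup>+ y. D (h y) \<partial>?Q) = (\<Sum>g\<in>carrier G. \<integral>\<^sup>+ y. D (g \<otimes>\<^bsub>G\<^esub> h y) \<partial>?Q)"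
    using inv by simp
  also have "\<dots> = (\<integral>\<^sup>+ y. (\<Sum>g\<in>carrier G. D (g \<otimes>\<^bsub>G\<^esub> h y)) \<partial>?Q)"
    using inv by (intro nn_integral_sum[symmetric]) blast
  also have "\<dots> = (\<Sum>g\<in>carrier G. D g)"
    by (simp add: sum_shift[OF hG] one)
  finally have avg: "of_nat (card (carrier G)) * (\<integral>\<^sup>+ y. D (h y) \<partial>?Q) = (\<Sum>g\<in>carrier G. D g)" .
  let ?U = "uniform_count_measure (carrier G)"
  have T2: "(\<lambda>(g, z). T g z) \<in> measurable (?U \<Otimes>\<^sub>M haar) class_space"
  proof -
    have "(\<lambda>(g, z). T g z) \<in> measurable (count_space (carrier G) \<Otimes>\<^sub>M haar) class_space"
      by (rule measurable_pair_measure_countable1) (use finG T_meas in \<open>simp_all add: countable_finite\<close>)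
    then show ?thesis
      by (simp cong: measurable_cong_sets add: sets_pair_measure_cong[OF sets_uniform_count_measure_count_space])
  qed
  have "emeasure (Delta_S G) B = (\<integral>\<^sup>+ p. indicator B (case p of (g, z) \<Rightarrow> T g z) \<partial>(?U \<Otimes>\<^sub>M haar))"
  proof -
    have "Delta_S G = distr (?U \<Otimes>\<^sub>M haar) class_space (\<lambda>(g, z). T g z)"
      unfolding Delta_S_def T_def ..
    then have "emeasure (Delta_S G) B = (\<integral>\<^sup>+ v. indicator B v \<partial>distr (?U \<Otimes>\<^sub>M haar) class_space (\<lambda>(g, z). T g z))"
      using B by simp
    also have "\<dots> = (\<integral>\<^sup>+ p. indicator B (case p of (g, z) \<Rightarrow> T g z) \<partial>(?U \<Otimes>\<^sub>M haar))"
      by (rule nn_integral_distr[OF T2]) (rule borel_measurable_indicator, use B in simp)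
    finally show ?thesis .
  qed
  also have "\<dots> = (\<integral>\<^sup>+ g. \<integral>\<^sup>+ z. indicator B (T g z) \<partial>haar \<partial>?U)"
    using haar.nn_integral_fst[OF measurable_compose[OF T2 borel_measurable_indicator[OF B]]] by simp
  also have "\<dots> = (\<Sum>g\<in>carrier G. ennreal (1 / card (carrier G)) * D g)"
    unfolding uniform_count_measure_def D_def[symmetric] by (rule nn_integral_point_measure_finite[OF finG])
  also have "\<dots> = ennreal (1 / card (carrier G)) * (of_nat (card (carrier G)) * (\<integral>\<^sup>+ y. D (h y) \<partial>?Q))"
    unfolding avg sum_distrib_left ..
  also have "\<dots> = (\<integral>\<^sup>+ y. D (h y) \<partial>?Q)"
    unfolding mult.assoc[symmetric] ennreal_of_nat_eq_real_of_nat using cG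
    by (simp add: ennreal_mult'[symmetric])
  finally show ?thesis unfolding inner[symmetric] glue_def ..
qed

section \<open>The Markov chain\<close>

definition corner_entries :: "(nat \<Rightarrow> nat \<Rightarrow> 'w \<Rightarrow> 'b) \<Rightarrow> nat \<Rightarrow> 'w \<Rightarrow> nat \<times> nat \<Rightarrow> 'b" where
  "corner_entries a n \<omega> = (\<lambda>z\<in>upper n. case_prod a z \<omega>)"

lemma random_entry:
  assumes "sym_haar M a" "z \<in> upper n"
  shows "case_prod a z \<in> measurable M borel"
proof -
  interpret prob_space M using assms(1) by (simp add: sym_haar_def)
  have "indep_vars (\<lambda>_. borel) (\<lambda>(i, j). a i j) {(i, j). i \<le> j}" using assms(1) by (simp add: sym_haar_def)
  then have "random_variable borel ((\<lambda>(i, j). a i j) z)"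
    using assms(2) unfolding indep_vars_def upper_def by blast
  then show ?thesis .
qed

lemma measurable_corner_entries:
  assumes "sym_haar M a"
  shows "corner_entries a n \<in> measurable M (PiM (upper n) (\<lambda>_. borel))"
  unfolding corner_entries_def by (rule measurable_restrict) (rule random_entry[OF assms])

lemma distr_corner_entries:
  assumes "sym_haar M (a :: nat \<Rightarrow> nat \<Rightarrow> 'w \<Rightarrow> 'p::prime_card zp)" "1 \<le> n"
  shows "distr M (PiM (upper n) (\<lambda>_. borel)) (corner_entries a n) = PiM (upper n) (\<lambda>_. haar)"
proof -
  interpret prob_space M using assms(1) by (simp add: sym_haar_def)
  have "indep_vars (\<lambda>_. borel) (\<lambda>(i, j). a i j) {(i, j). i \<le> j}" using assms(1) by (simp add: sym_haar_def)
  then have ind: "indep_vars (\<lambda>_. borel) (case_prod a) (upper n)"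
    by (rule indep_vars_subset) (auto simp: upper_def)
  \<comment> \<open>The product-law criterion for independence asks for a nonempty index set, whence
    \<open>1 \<le> n\<close>.\<close>
  have "(0, 0) \<in> upper n" using assms(2) by (simp add: upper_def)
  then have ne: "upper n \<noteq> {}" by blast
  have "distr M (PiM (upper n) (\<lambda>_. borel)) (corner_entries a n) = PiM (upper n) (\<lambda>z. distr M borel (case_prod a z))"
    using iffD1[OF indep_vars_iff_distr_eq_PiM'[OF ne random_entry[OF assms(1)]] ind]
    by (simp add: corner_entries_def[abs_def])
  also have "\<dots> = PiM (upper n) (\<lambda>_. haar)"
    using assms(1) by (intro PiM_cong refl) (auto simp: sym_haar_def upper_def)
  finally show ?thesis .
qed

text \<open>Allowing a larger corner \<open>k\<close> lets a single vector of entries determine the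
  next state together with the whole past.\<close>

lemma ker_chain_eq:
  assumes "sym_haar M a" "\<omega> \<in> space M" "n \<le> k"
  shows "ker_chain a n \<omega> = ker_class n (corner_entries a k \<omega>)"
proof -
  have "ker_fun (\<lambda>i j. a i j \<omega>) n = ker_fun (sym_ext (corner_entries a k \<omega>)) n"
  proof (rule ker_fun_cong)
    fix i j assume "i < n" "j < n"
    then have "(min i j, max i j) \<in> upper k" using assms(3) by (auto simp: upper_def)
    moreover have "a (min i j) (max i j) \<omega> = a i j \<omega>"
      using assms(1,2) by (auto simp: sym_haar_def min_def max_def)
    ultimately show "a i j \<omega> = sym_ext (corner_entries a k \<omega>) i j"
      by (simp add: sym_ext_def corner_entries_def)
  qed
  then show ?thesis by (simp add: ker_chain_def corner_def ker_class_def ker_fun_def)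
qed

lemma measurable_ker_chain:
  fixes a :: "nat \<Rightarrow> nat \<Rightarrow> 'w \<Rightarrow> 'p::prime_card zp"
  assumes "sym_haar M a"
  shows "ker_chain a n \<in> measurable M class_space"
proof -
  have "(\<lambda>\<omega>. ker_class n (corner_entries a n \<omega>)) \<in> measurable M class_space"
    by (rule measurable_compose[OF measurable_corner_entries[OF assms] measurable_ker_class]) simp_all
  then show ?thesis
    using ker_chain_eq[OF assms _ order_refl] by (simp cong: measurable_cong)
qed

lemma nn_integral_corner_entries:
  fixes a :: "nat \<Rightarrow> nat \<Rightarrow> 'w \<Rightarrow> 'p::prime_card zp"
  assumes "sym_haar M a" "1 \<le> n" and f: "f \<in> borel_measurable (PiM (upper n) (\<lambda>_. haar :: 'p zp measure))"
  shows "(\<integral>\<^sup>+ \<omega>. f (corner_entries a n \<omega>) \<partial>M) = (\<integral>\<^sup>+ x. f x \<partial>PiM (upper n) (\<lambda>_. haar))"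
proof -
  have "f \<in> borel_measurable (PiM (upper n) (\<lambda>_. borel))"
    using f unfolding measurable_cong_sets[OF sets_PiM_haar refl] .
  then show ?thesis
    using nn_integral_distr[OF measurable_corner_entries[OF assms(1)], of f n]
    by (simp add: distr_corner_entries[OF assms(1,2)])
qed

lemma AE_ker_chain_in_X_S:
  fixes a :: "nat \<Rightarrow> nat \<Rightarrow> 'w \<Rightarrow> 'p::prime_card zp"
  assumes a: "sym_haar M a" and n: "1 \<le> n"
  shows "AE \<omega> in M. ker_chain a n \<omega> \<in> X_S"
proof -
  have i: "(\<lambda>x. indicator (- X_S) (ker_class n x) :: ennreal) \<in> borel_measurable (PiM (upper n) (\<lambda>_. haar :: 'p zp measure))"
    by (rule measurable_indicator_ker_class[OF X_S_compl_in_class_space]) simp_all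
  have "(\<integral>\<^sup>+ \<omega>. indicator (- X_S) (ker_chain a n \<omega>) \<partial>M) = (\<integral>\<^sup>+ \<omega>. indicator (- X_S) (ker_class n (corner_entries a n \<omega>)) \<partial>M)"
    by (rule nn_integral_cong) (simp add: ker_chain_eq[OF a _ order_refl])
  also have "\<dots> = 0" unfolding nn_integral_corner_entries[OF a n i] by (rule singular_null)
  finally have "AE \<omega> in M. indicator (- X_S) (ker_chain a n \<omega>) = (0 :: ennreal)"
    using measurable_compose[OF measurable_ker_chain[OF a] borel_measurable_indicator[OF X_S_compl_in_class_space]]
    by (subst (asm) nn_integral_0_iff_AE) simp_all
  then show ?thesis by (rule AE_mp) (simp add: indicator_def split: if_splits)
qed

text \<open>The indicator of the past depends only on the old corner, so it leaves the two inner
  integrals. Where it is 1, \<open>one_step\<close> evaluates them to a value depending on the past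
  through \<open>x n\<close> alone.\<close>

lemma emeasure_past_and_next:
  fixes a :: "nat \<Rightarrow> nat \<Rightarrow> 'w \<Rightarrow> 'p::prime_card zp" and G :: "(nat, 'p) paired_group"
  assumes a: "sym_haar M a" and n: "1 \<le> n"
    and xS: "\<And>i. i \<in> {1..n} \<Longrightarrow> x i \<in> X_S"
    and G: "perfect_symmetric_p_group G" and xn: "iso_class G = x n" and B: "B \<in> sets class_space"
  defines "E \<equiv> {\<omega> \<in> space M. \<forall>i\<in>{1..n}. ker_chain a i \<omega> = x i}"
  shows "E \<in> sets M"
    and "emeasure M (E \<inter> (ker_chain a (Suc n) -` B \<inter> space M)) = emeasure M E * emeasure (Delta_S G) B"
proof -
  define past :: "(nat \<times> nat \<Rightarrow> 'p zp) \<Rightarrow> ennreal" where "past y = (\<Prod>i=1..n. indicator {x i} (ker_class i y))" for y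
  have past_iff: "past y = (if \<forall>i\<in>{1..n}. ker_class i y = x i then 1 else 0)" for y
    by (auto simp: past_def indicator_def intro!: prod.neutral prod_zero)
  have past_meas: "past \<in> borel_measurable (PiM (upper k) (\<lambda>_. haar :: 'p zp measure))" if "n \<le> k" for k
    unfolding past_def
  proof (rule borel_measurable_prod_ennreal)
    fix i assume i: "i \<in> {1..n}"
    \<comment> \<open>Singletons are measurable here because the sigma-algebra is discrete on
      \<open>X_S\<close>.\<close>
    have "{x i} \<in> sets class_space" using xS[OF i] by (intro X_S_subset_in_class_space) simp
    then show "(\<lambda>y. indicator {x i} (ker_class i y) :: ennreal) \<in> borel_measurable (PiM (upper k) (\<lambda>_. haar))"
      using i that by (intro measurable_indicator_ker_class upper_mono) simp_all
  qed
  have past_chain: "past (corner_entries a k \<omega>) = indicator E \<omega>" if "\<omega> \<in> space M" "n \<le> k" for \<omega> k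
    using that ker_chain_eq[OF a that(1), of _ k] by (auto simp: past_iff E_def indicator_def)
  have "E = (\<Inter>i\<in>{1..n}. ker_chain a i -` {x i} \<inter> space M)"
    using n by (auto simp: E_def)
  also have "\<dots> \<in> sets M"
    using n xS by (intro sets.finite_INT measurable_sets[OF measurable_ker_chain[OF a]] X_S_subset_in_class_space) auto
  finally show E: "E \<in> sets M" .
  have past_E: "(\<integral>\<^sup>+ y. past y \<partial>PiM (upper n) (\<lambda>_. haar)) = emeasure M E"
  proof -
    have "(\<integral>\<^sup>+ y. past y \<partial>PiM (upper n) (\<lambda>_. haar)) = (\<integral>\<^sup>+ \<omega>. past (corner_entries a n \<omega>) \<partial>M)"
      by (rule nn_integral_corner_entries[OF a n past_meas[OF order_refl], symmetric])
    also have "\<dots> = (\<integral>\<^sup>+ \<omega>. indicator E \<omega> \<partial>M)" by (rule nn_integral_cong) (simp add: past_chain)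
    finally show ?thesis using E by simp
  qed
  let ?f = "\<lambda>y. past y * indicator B (ker_class (Suc n) y)"
  have f: "?f \<in> borel_measurable (PiM (upper (Suc n)) (\<lambda>_. haar))"
    using past_meas[of "Suc n"] measurable_indicator_ker_class[OF B finite_upper(1) order_refl]
    by (intro borel_measurable_times_ennreal) simp_all
  have "emeasure M (E \<inter> (ker_chain a (Suc n) -` B \<inter> space M)) = (\<integral>\<^sup>+ \<omega>. indicator (E \<inter> (ker_chain a (Suc n) -` B \<inter> space M)) \<omega> \<partial>M)"
    using E measurable_sets[OF measurable_ker_chain[OF a] B] by (intro nn_integral_indicator[symmetric]) blast
  also have "\<dots> = (\<integral>\<^sup>+ \<omega>. ?f (corner_entries a (Suc n) \<omega>) \<partial>M)"
    by (rule nn_integral_cong) (auto simp: past_chain ker_chain_eq[OF a _ order_refl] indicator_def)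
  also have "\<dots> = (\<integral>\<^sup>+ y. ?f y \<partial>PiM (upper (Suc n)) (\<lambda>_. haar))"
    by (rule nn_integral_corner_entries[OF a _ f]) simp
  also have "\<dots> = (\<integral>\<^sup>+ y. past y * emeasure (Delta_S G) B \<partial>PiM (upper n) (\<lambda>_. haar))"
    unfolding nn_integral_upper_Suc[OF f]
  proof (rule nn_integral_cong)
    fix y :: "nat \<times> nat \<Rightarrow> 'p zp"
    have eq: "past ((merge (upper n) (last_col n) (y, z))((n, n) := c)) = past y" for z c
    proof -
      have "ker_class i ((merge (upper n) (last_col n) (y, z))((n, n) := c)) = ker_class i y" if "i \<in> {1..n}" for i
        using that by (intro ker_class_cong merge_upper subsetD[OF upper_mono[of i n]]) simp_all
      then show ?thesis by (simp add: past_iff)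
    qed
    show "(\<integral>\<^sup>+ z. \<integral>\<^sup>+ c. ?f ((merge (upper n) (last_col n) (y, z))((n, n) := c)) \<partial>haar \<partial>PiM (last_col n) (\<lambda>_. haar))
        = past y * emeasure (Delta_S G) B"
    proof (cases "\<forall>i\<in>{1..n}. ker_class i y = x i")
      case True
      then have "ker_class n y = iso_class G" using n xn by simp
      from one_step[OF G this B] True show ?thesis unfolding eq by (simp add: past_iff)
    next
      case False
      then have "past y = 0" by (simp add: past_iff)
      then show ?thesis unfolding eq by simp
    qed
  qed
  also have "\<dots> = emeasure M E * emeasure (Delta_S G) B"
    using past_meas[OF order_refl] by (simp add: nn_integral_multc past_E)
  finally show "emeasure M (E \<inter> (ker_chain a (Suc n) -` B \<inter> space M)) = emeasure M E * emeasure (Delta_S G) B" .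
qed

theorem corollary2p1:
  fixes M :: "'w measure" and a :: "nat \<Rightarrow> nat \<Rightarrow> 'w \<Rightarrow> 'p::prime_card zp"
  assumes "sym_haar M a"
  shows "(\<forall>n\<ge>1. ker_chain a n \<in> measurable M class_space \<and> (AE \<omega> in M. ker_chain a n \<omega> \<in> X_S)) \<and>
    (\<forall>n\<ge>1. \<forall>(x :: nat \<Rightarrow> 'p paired_class) (G :: (nat, 'p) paired_group).
       (\<forall>i\<in>{1..n}. x i \<in> X_S) \<longrightarrow>
       perfect_symmetric_p_group G \<longrightarrow> iso_class G = x n \<longrightarrow>
       emeasure M {\<omega> \<in> space M. \<forall>i\<in>{1..n}. ker_chain a i \<omega> = x i} \<noteq> 0 \<longrightarrow>
       distr (uniform_measure M {\<omega> \<in> space M. \<forall>i\<in>{1..n}. ker_chain a i \<omega> = x i}) class_space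
         (ker_chain a (n + 1)) = Delta_S G)"
proof (intro conjI allI impI)
  fix n :: nat assume n: "1 \<le> n"
  show "ker_chain a n \<in> measurable M class_space" using assms by (rule measurable_ker_chain)
  show "AE \<omega> in M. ker_chain a n \<omega> \<in> X_S" using assms n by (rule AE_ker_chain_in_X_S)
next
  fix n :: nat and x :: "nat \<Rightarrow> 'p paired_class" and G :: "(nat, 'p) paired_group"
  let ?E = "{\<omega> \<in> space M. \<forall>i\<in>{1..n}. ker_chain a i \<omega> = x i}"
  assume n: "1 \<le> n" and xS: "\<forall>i\<in>{1..n}. x i \<in> X_S" and G: "perfect_symmetric_p_group G"
    and xn: "iso_class G = x n" and E0: "emeasure M ?E \<noteq> 0"
  interpret prob_space M using assms by (simp add: sym_haar_def)
  have xS: "\<And>i. i \<in> {1..n} \<Longrightarrow> x i \<in> X_S" using xS by blast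
  note past = emeasure_past_and_next[where x = x, OF assms n xS G xn]
  \<comment> \<open>The claim about the event mentions no B but shares the hypothesis on it; the
    whole space serves as B.\<close>
  have E: "?E \<in> sets M" using past(1)[of UNIV] by (simp add: sigma_sets_top)
  show "distr (uniform_measure M ?E) class_space (ker_chain a (n + 1)) = Delta_S G"
  proof (rule measure_eqI)
    show "sets (distr (uniform_measure M ?E) class_space (ker_chain a (n + 1))) = sets (Delta_S G)"
      by (simp add: Delta_S_def)
    fix B assume "B \<in> sets (distr (uniform_measure M ?E) class_space (ker_chain a (n + 1)))"
    then have B: "B \<in> sets class_space" by simp
    have m: "ker_chain a (n + 1) \<in> measurable (uniform_measure M ?E) class_space"
      using measurable_ker_chain[OF assms] by (simp cong: measurable_cong_sets)
    have "emeasure (distr (uniform_measure M ?E) class_space (ker_chain a (n + 1))) B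
        = emeasure (uniform_measure M ?E) (ker_chain a (Suc n) -` B \<inter> space M)"
      using emeasure_distr[OF m B] by simp
    also have "\<dots> = emeasure M (?E \<inter> (ker_chain a (Suc n) -` B \<inter> space M)) / emeasure M ?E"
      by (rule emeasure_uniform_measure[OF E measurable_sets[OF measurable_ker_chain[OF assms] B]])
    also have "emeasure M (?E \<inter> (ker_chain a (Suc n) -` B \<inter> space M)) = emeasure M ?E * emeasure (Delta_S G) B"
      by (rule past(2)[OF _ B])
    also have "\<dots> / emeasure M ?E = emeasure (Delta_S G) B"
      by (subst mult.commute) (rule ennreal_mult_divide_eq[OF E0 emeasure_finite])
    finally show "emeasure (distr (uniform_measure M ?E) class_space (ker_chain a (n + 1))) B = emeasure (Delta_S G) B" .
  qed
qed

end
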